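(* Let $n\ge2$. Every weakly separated collection $C\subseteq2^{[n]}$ of maximum cardinality (among weakly separated collections in $2^{[n]}$) is the spectrum $B_T$ of some generalized tiling $T$ on $Z_n$.
   Context: Notation: $[n]=\{1,\dots,n\}$, $[p..q]=\{p,\dots,q\}$, $[q]=[1..q]$, $[0]=\emptyset$; $Xi=X\cup\{i\}$ etc. Weak separation. $X\prec Y$ means $Y\setminus X\ne\emptyset$ and $i<j$ for all $i\in X\setminus Y$, $j\in Y\setminus X$. $X\rhd Y$ means $Y\setminus X$ has a bipartition $\{Y_1,Y_2\}$ with $Y_1,Y_2,X\setminus Y$ nonempty and $Y_1\prec X\setminus Y\prec Y_2$. $X,Y$ are weakly separated if $X\prec Y$, or $Y\prec X$, or ($X\rhd Y$ and $|X|\ge|Y|$), or ($Y\rhd X$ and $|Y|\ge|X|$). A collection is weakly separated if any two members are. G-tilings. Fix $\xi_i=(a_i,1)$, $a_1<\dots<a_n$, all integer combinations distinct; identify $X\subseteq[n]$ with $\sum_{i\in X}\xi_i$. $Z_n=\{\sum\lambda_i\xi_i:0\le\lambda_i\le1\}$, with boundary segments joining $[i-1]$ to $[i]$ and $[i+1..n]$ to $[i..n]$. Tile $\tau(X;i,j)$ ($i<j$, $X\subseteq[n]\setminus\{i,j\}$): parallelogram with vertices $b(\tau)=X$, $\ell(\tau)=Xi$, $r(\tau)=Xj$, $t(\tau)=Xij$; sides are edges, an edge between $Y$ and $Yq$ directed from $Y$ to $Yq$. A g-tiling is a finite set $T$ of tiles partitioned into white and black with: (T1) tiles lie in $Z_n$;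 each boundary segment is an edge of exactly one tile; each other edge is an edge of exactly two tiles; no two tiles coincide; (T2) white tiles sharing an edge have no common interior point; a white and a black tile sharing an edge have a common interior point; no two black tiles share an edge; (T3) for black $\tau$: $b(\tau),t(\tau)$ are not vertices of another black tile, all edges at $b(\tau)$ leave it, all edges at $t(\tau)$ enter it; (T4) the union of squares $\mathrm{conv}\{X,Xi,Xj,Xij\}\subset[0,1]^n$ over tiles $\tau(X;i,j)\in T$ is homeomorphic to a closed disc. Terminal vertices: bottom/top vertices of black tiles; spectrum $B_T$: set of non-terminal vertices (as subsets of $[n]$). *)

theory Defs
  imports "HOL-Analysis.Analysis"
begin

definition sprec :: "nat set \<Rightarrow> nat set \<Rightarrow> bool" where
  "sprec X Y \<longleftrightarrow> Y - X \<noteq> {} \<and> (\<forall>i\<in>X - Y. \<forall>j\<in>Y - X. i < j)"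

definition splits :: "nat set \<Rightarrow> nat set \<Rightarrow> bool" where
  "splits X Y \<longleftrightarrow>
     (\<exists>Y1 Y2. Y1 \<union> Y2 = Y - X \<and> Y1 \<inter> Y2 = {} \<and>
        Y1 \<noteq> {} \<and> Y2 \<noteq> {} \<and> X - Y \<noteq> {} \<and>
        sprec Y1 (X - Y) \<and> sprec (X - Y) Y2)"

definition weakly_separated :: "nat set \<Rightarrow> nat set \<Rightarrow> bool" where
  "weakly_separated X Y \<longleftrightarrow>
     sprec X Y \<or> sprec Y X \<or>
     (splits X Y \<and> card X \<ge> card Y) \<or> (splits Y X \<and> card Y \<ge> card X)"

text \<open>
  The members compared are distinct: a set is never weakly separated from itself under the
  definition above, since \<open>sprec X Y\<close> requires \<open>Y - X \<noteq> {}\<close>.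
\<close>
definition ws_collection :: "nat \<Rightarrow> nat set set \<Rightarrow> bool" where
  "ws_collection n C \<longleftrightarrow>
     C \<subseteq> Pow {1..n} \<and> (\<forall>X\<in>C. \<forall>Y\<in>C. X \<noteq> Y \<longrightarrow> weakly_separated X Y)"

definition max_ws_collection :: "nat \<Rightarrow> nat set set \<Rightarrow> bool" where
  "max_ws_collection n C \<longleftrightarrow>
     ws_collection n C \<and> (\<forall>D. ws_collection n D \<longrightarrow> card D \<le> card C)"

definition xi :: "(nat \<Rightarrow> real) \<Rightarrow> nat \<Rightarrow> real \<times> real" where
  "xi a i = (a i, 1)"

definition generic_slopes :: "nat \<Rightarrow> (nat \<Rightarrow> real) \<Rightarrow> bool" where
  "generic_slopes n a \<longleftrightarrow>
     strict_mono_on {1..n} a \<and>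
     (\<forall>c d :: nat \<Rightarrow> int.
        (\<Sum>i=1..n. of_int (c i) *\<^sub>R xi a i) = (\<Sum>i=1..n. of_int (d i) *\<^sub>R xi a i) \<longrightarrow>
        (\<forall>i\<in>{1..n}. c i = d i))"

definition pt :: "(nat \<Rightarrow> real) \<Rightarrow> nat set \<Rightarrow> real \<times> real" where
  "pt a X = (\<Sum>i\<in>X. xi a i)"

definition zonogon :: "nat \<Rightarrow> (nat \<Rightarrow> real) \<Rightarrow> (real \<times> real) set" where
  "zonogon n a = {(\<Sum>i=1..n. l i *\<^sub>R xi a i) | l. \<forall>i\<in>{1..n}. 0 \<le> l i \<and> l i \<le> 1}"

text \<open>
  Under \<open>generic_slopes n a\<close> the map \<open>pt a\<close> is injective on subsets of \<open>{1..n}\<close>, so vertices are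
  represented by subsets, and an edge directed from \<open>Y\<close> to \<open>insert q Y\<close> by the pair of these.
\<close>
type_synonym edge = "nat set \<times> nat set"

definition boundary_edges :: "nat \<Rightarrow> edge set" where
  "boundary_edges n =
     {({1..i - 1}, {1..i}) | i. i \<in> {1..n}} \<union> {({i + 1..n}, {i..n}) | i. i \<in> {1..n}}"

datatype tile = Tile (base: "nat set") (lo: nat) (hi: nat)

definition is_tile :: "nat \<Rightarrow> tile \<Rightarrow> bool" where
  "is_tile n t \<longleftrightarrow>
     lo t \<in> {1..n} \<and> hi t \<in> {1..n} \<and> lo t < hi t \<and> base t \<subseteq> {1..n} - {lo t, hi t}"

definition bot_v :: "tile \<Rightarrow> nat set" where "bot_v t = base t"
definition left_v :: "tile \<Rightarrow> nat set" where "left_v t = insert (lo t) (base t)"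
definition right_v :: "tile \<Rightarrow> nat set" where "right_v t = insert (hi t) (base t)"
definition top_v :: "tile \<Rightarrow> nat set" where "top_v t = insert (lo t) (insert (hi t) (base t))"

definition vertices :: "tile \<Rightarrow> nat set set" where
  "vertices t = {bot_v t, left_v t, right_v t, top_v t}"

definition edges :: "tile \<Rightarrow> edge set" where
  "edges t = {(bot_v t, left_v t), (bot_v t, right_v t), (left_v t, top_v t), (right_v t, top_v t)}"

definition region :: "(nat \<Rightarrow> real) \<Rightarrow> tile \<Rightarrow> (real \<times> real) set" where
  "region a t = convex hull (pt a ` vertices t)"

definition share_edge :: "tile \<Rightarrow> tile \<Rightarrow> bool" where
  "share_edge s t \<longleftrightarrow> edges s \<inter> edges t \<noteq> {}"

definition overlap :: "(nat \<Rightarrow> real) \<Rightarrow> tile \<Rightarrow> tile \<Rightarrow> bool" where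
  "overlap a s t \<longleftrightarrow> interior (region a s) \<inter> interior (region a t) \<noteq> {}"

text \<open>
  The cube \<open>[0,1]^n\<close> is modelled inside \<open>nat \<Rightarrow> real\<close> with the product topology: all points that
  occur vanish outside \<open>{1..n}\<close>, and on such functions this is the topology of \<open>\<real>^n\<close>.
  As \<open>nat \<Rightarrow> real\<close> is not an instance of \<open>real_vector\<close>, the convex hull of a finite set is
  spelled out.
\<close>
definition conv_fin :: "(nat \<Rightarrow> real) set \<Rightarrow> (nat \<Rightarrow> real) set" where
  "conv_fin V = {(\<lambda>k. \<Sum>v\<in>V. u v * v k) | u. (\<forall>v\<in>V. 0 \<le> u v) \<and> sum u V = 1}"

definition cube_square :: "tile \<Rightarrow> (nat \<Rightarrow> real) set" where
  "cube_square t = conv_fin (indicator ` vertices t)"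

text \<open>A tiling is given by its sets \<open>W\<close> of white and \<open>B\<close> of black tiles.\<close>

definition tiling_T1 :: "nat \<Rightarrow> (nat \<Rightarrow> real) \<Rightarrow> tile set \<Rightarrow> bool" where
  "tiling_T1 n a T \<longleftrightarrow>
     (\<forall>t\<in>T. region a t \<subseteq> zonogon n a) \<and>
     (\<forall>e\<in>boundary_edges n. card {t \<in> T. e \<in> edges t} = 1) \<and>
     (\<forall>e\<in>(\<Union>t\<in>T. edges t) - boundary_edges n. card {t \<in> T. e \<in> edges t} = 2) \<and>
     inj_on (region a) T"

definition tiling_T2 :: "(nat \<Rightarrow> real) \<Rightarrow> tile set \<Rightarrow> tile set \<Rightarrow> bool" where
  "tiling_T2 a W B \<longleftrightarrow>
     (\<forall>s\<in>W. \<forall>t\<in>W. s \<noteq> t \<and> share_edge s t \<longrightarrow> \<not> overlap a s t) \<and>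
     (\<forall>s\<in>W. \<forall>t\<in>B. share_edge s t \<longrightarrow> overlap a s t) \<and>
     (\<forall>s\<in>B. \<forall>t\<in>B. s \<noteq> t \<longrightarrow> \<not> share_edge s t)"

definition tiling_T3 :: "tile set \<Rightarrow> tile set \<Rightarrow> bool" where
  "tiling_T3 W B \<longleftrightarrow>
     (\<forall>t\<in>B.
        (\<forall>s\<in>B. s \<noteq> t \<longrightarrow> bot_v t \<notin> vertices s \<and> top_v t \<notin> vertices s) \<and>
        (\<forall>(X, Y)\<in>(\<Union>s\<in>W \<union> B. edges s).
           (bot_v t \<in> {X, Y} \<longrightarrow> X = bot_v t) \<and> (top_v t \<in> {X, Y} \<longrightarrow> Y = top_v t)))"

definition tiling_T4 :: "tile set \<Rightarrow> bool" where
  "tiling_T4 T \<longleftrightarrow> (\<Union>t\<in>T. cube_square t) homeomorphic cball (0 :: real \<times> real) 1"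

definition g_tiling :: "nat \<Rightarrow> (nat \<Rightarrow> real) \<Rightarrow> tile set \<Rightarrow> tile set \<Rightarrow> bool" where
  "g_tiling n a W B \<longleftrightarrow>
     finite (W \<union> B) \<and> W \<inter> B = {} \<and> (\<forall>t\<in>W \<union> B. is_tile n t) \<and>
     tiling_T1 n a (W \<union> B) \<and> tiling_T2 a W B \<and> tiling_T3 W B \<and> tiling_T4 (W \<union> B)"

definition terminal_vertices :: "tile set \<Rightarrow> nat set set" where
  "terminal_vertices B = bot_v ` B \<union> top_v ` B"

definition spectrum :: "tile set \<Rightarrow> tile set \<Rightarrow> nat set set" where
  "spectrum W B = (\<Union>t\<in>W \<union> B. vertices t) - terminal_vertices B"

end

theory Submission
  imports Defs
begin

text \<open>
  For a collection \<open>C\<close> and a set \<open>X\<close> consider the labels \<open>q\<close> with \<open>insert q X \<in> C\<close>, and dually those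
  with \<open>X - {q} \<in> C\<close>. White tiles are spanned by two consecutive labels at \<open>X\<close>; if \<open>X \<notin> C\<close> has at
  least three labels, the smallest and the largest one span a black tile. That every edge then has
  a tile on either side, and that the same tiles are obtained from the labels at their top
  vertices, is shown by induction on \<open>n\<close>: a maximum collection splits into the members not
  containing the largest element (left) and, after its removal, those containing it (right). Left
  and right members together form a maximum collection for \<open>n - 1\<close> and share exactly one set of
  every size; a left set precedes a right set that is at least as large, and this decides on which
  side of the common sets each tile lies.

  For the disc, each tile is halved by its horizontal diagonal, and the triangles are drawn in the
  plane on a zonogon with strictly convex position of the generators, black tiles being turned
  over. All triangles are positively oriented and adjacent ones lie on opposite sides of
  their common edge, so every point of the zonogon is covered exactly once.
\<close>

section \<open>Weak separation\<close>

text \<open>Being a disc is a property of the squares in the cube and does not involve the slopes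
  \<open>a\<close>, so the drawing that proves it may use other generators. In \<open>Z_n\<close>
  itself the disc cannot be seen: the sets \<open>insert q X\<close> with fixed \<open>X\<close> lie
  on one horizontal line, and a black tile overlaps the white tiles next to it. With generators on a
  parabola these sets are the corners of a strictly convex polygon. If a terminal vertex
  \<open>X\<close> is placed inside this polygon, the white tiles at \<open>X\<close> fan around it
  and leave just the gap towards the chord from the smallest to the largest label; the black tile,
  seen from its other side, fills this gap. In the induction the obstacle is a tile for
  \<open>n - 1\<close> with vertices on both sides. The common sets exclude it: left sets, the
  common set and right sets of one size follow one another, so a common set would be squeezed
  between the middle vertices of such a tile, where the labels leave no room. Several statements go
  through the induction together because their steps use one another; complementation supplies the
  mirror image of each.\<close>

lemma splits_iff:
  "splits X Y \<longleftrightarrow>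
     (\<exists>Y1 Y2. Y1 \<union> Y2 = Y - X \<and> Y1 \<noteq> {} \<and> Y2 \<noteq> {} \<and> X - Y \<noteq> {} \<and>
        (\<forall>i\<in>Y1. \<forall>j\<in>X - Y. i < j) \<and> (\<forall>i\<in>X - Y. \<forall>j\<in>Y2. i < j))"
  (is "_ = ?R")
proof
  assume "splits X Y"
  then obtain Y1 Y2 where h: "Y1 \<union> Y2 = Y - X" "Y1 \<inter> Y2 = {}" "Y1 \<noteq> {}" "Y2 \<noteq> {}" "X - Y \<noteq> {}"
    "sprec Y1 (X - Y)" "sprec (X - Y) Y2"
    unfolding splits_def by blast
  have "Y1 - (X - Y) = Y1" "X - Y - Y1 = X - Y" "Y2 - (X - Y) = Y2" "X - Y - Y2 = X - Y"
    using h(1) by blast+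
  with h have "\<forall>i\<in>Y1. \<forall>j\<in>X - Y. i < j" "\<forall>i\<in>X - Y. \<forall>j\<in>Y2. i < j"
    unfolding sprec_def by auto
  with h show ?R by blast
next
  assume ?R
  then obtain Y1 Y2 where h: "Y1 \<union> Y2 = Y - X" "Y1 \<noteq> {}" "Y2 \<noteq> {}" "X - Y \<noteq> {}"
    "\<forall>i\<in>Y1. \<forall>j\<in>X - Y. i < j" "\<forall>i\<in>X - Y. \<forall>j\<in>Y2. i < j" by blast
  have "Y1 \<inter> Y2 = {}" using h(4,5,6) by (metis disjoint_iff ex_in_conv order_less_asym)
  moreover have "Y1 - (X - Y) = Y1" "X - Y - Y1 = X - Y" "Y2 - (X - Y) = Y2" "X - Y - Y2 = X - Y"
    using h(1) by blast+
  ultimately show "splits X Y"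
    unfolding splits_def sprec_def using h by (intro exI[of _ Y1] exI[of _ Y2]) auto
qed

lemma weakly_separated_sym: "weakly_separated X Y \<longleftrightarrow> weakly_separated Y X"
  unfolding weakly_separated_def by blast

text \<open>With \<open>p < q < r\<close> the only relation left is \<open>splits Q P\<close>, where
  \<open>P\<close> surrounds \<open>Q\<close>, and this one requires the surrounded set to be at
  least as large as the surrounding one.\<close>

lemma not_weakly_separated_between:
  assumes "p \<in> P - Q" "r \<in> P - Q" "q \<in> Q - P" "p < q" "q < r" "card Q < card P"
  shows "\<not> weakly_separated P Q"
proof -
  have "\<not> sprec P Q" "\<not> sprec Q P" unfolding sprec_def using assms by (meson order_less_asym)+
  moreover have "\<not> splits P Q"
  proof
    assume "splits P Q"
    then obtain Y1 Y2 where h: "Y1 \<union> Y2 = Q - P"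
      "\<forall>i\<in>Y1. \<forall>j\<in>P - Q. i < j" "\<forall>i\<in>P - Q. \<forall>j\<in>Y2. i < j"
      unfolding splits_iff by blast
    from h(1) assms(3) have "q \<in> Y1 \<or> q \<in> Y2" by blast
    with h(2,3) assms show False by (meson order_less_asym)
  qed
  ultimately show ?thesis unfolding weakly_separated_def using assms(6) by auto
qed

text \<open>An alternating pattern of length four rules out precedence and surrounding in both
  directions, so here no comparison of sizes is required.\<close>

lemma not_weakly_separated_crossing:
  assumes "p \<in> P - Q" "r \<in> P - Q" "q \<in> Q - P" "s \<in> Q - P" "p < q" "q < r" "r < s"
  shows "\<not> weakly_separated P Q"
proof -
  have "\<not> sprec P Q" "\<not> sprec Q P" unfolding sprec_def using assms by (meson order_less_asym)+
  moreover have "\<not> splits P Q"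
  proof
    assume "splits P Q"
    then obtain Y1 Y2 where h: "Y1 \<union> Y2 = Q - P"
      "\<forall>i\<in>Y1. \<forall>j\<in>P - Q. i < j" "\<forall>i\<in>P - Q. \<forall>j\<in>Y2. i < j"
      unfolding splits_iff by blast
    from h(1) assms(3) have "q \<in> Y1 \<or> q \<in> Y2" by blast
    with h(2,3) assms show False by (meson order_less_asym)
  qed
  moreover have "\<not> splits Q P"
  proof
    assume "splits Q P"
    then obtain Y1 Y2 where h: "Y1 \<union> Y2 = P - Q"
      "\<forall>i\<in>Y1. \<forall>j\<in>Q - P. i < j" "\<forall>i\<in>Q - P. \<forall>j\<in>Y2. i < j"
      unfolding splits_iff by blast
    from h(1) assms(2) have "r \<in> Y1 \<or> r \<in> Y2" by blast
    with h(2,3) assms show False by (meson order_less_asym)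
  qed
  ultimately show ?thesis unfolding weakly_separated_def by blast
qed

text \<open>This is \<open>sprec\<close> without the nonemptiness condition. It therefore holds for
  equal sets too and can be applied uniformly to sets that are both left and right.\<close>

definition left_of :: "nat set \<Rightarrow> nat set \<Rightarrow> bool" where
  "left_of X Y \<longleftrightarrow> (\<forall>i\<in>X - Y. \<forall>j\<in>Y - X. i < j)"

lemma left_ofD: "left_of X Y \<Longrightarrow> i \<in> X \<Longrightarrow> i \<notin> Y \<Longrightarrow> j \<in> Y \<Longrightarrow> j \<notin> X \<Longrightarrow> i < j"
  unfolding left_of_def by blast

lemma left_of_imp_weakly_separated: "left_of X Y \<Longrightarrow> X \<noteq> Y \<Longrightarrow> weakly_separated X Y"
  unfolding left_of_def weakly_separated_def sprec_def by blast

text \<open>\<open>N\<close> lies above all of \<open>X\<close>, so \<open>insert N Y\<close>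
  neither precedes \<open>X\<close> nor is surrounded by it. That \<open>insert N Y\<close>
  surrounds \<open>X\<close> is excluded by the sizes. Only precedence remains; this is the source
  of the order between left and right sets.\<close>

lemma weakly_separated_insert_max:
  assumes ws: "weakly_separated X (insert N Y)" and X: "X \<subseteq> {..<N}" and Y: "Y \<subseteq> {..<N}"
    and c: "card X \<le> card Y"
  shows "left_of X Y"
proof -
  have N: "N \<notin> X" "N \<notin> Y" using X Y by auto
  have fin: "finite Y" using Y finite_subset by blast
  have c': "card X < card (insert N Y)" using c N fin by simp
  have "\<not> sprec (insert N Y) X"
  proof
    assume "sprec (insert N Y) X"
    then obtain x where "x \<in> X - insert N Y" "N < x" unfolding sprec_def using N by blast
    with X show False by auto
  qed
  moreover have "\<not> splits (insert N Y) X"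
  proof
    assume "splits (insert N Y) X"
    then obtain Y1 Y2 where h: "Y1 \<union> Y2 = X - insert N Y" "Y2 \<noteq> {}"
      "\<forall>i\<in>insert N Y - X. \<forall>j\<in>Y2. i < j"
      unfolding splits_iff by blast
    then obtain x where "x \<in> Y2" "N < x" using N by blast
    with h(1) X show False by auto
  qed
  ultimately have "sprec X (insert N Y)" using ws c' unfolding weakly_separated_def by auto
  then show ?thesis unfolding sprec_def left_of_def using N by auto
qed

text \<open>Beyond the case of precedence, \<open>insert N Y\<close> surrounds \<open>X\<close> with
  \<open>N\<close> in the upper block. Deleting \<open>N\<close> either keeps this block nonempty,
  or empties it, and then \<open>Y\<close> precedes \<open>X\<close>.\<close>

lemma weakly_separated_delete_one:
  assumes ws: "weakly_separated X (insert N Y)" and X: "X \<subseteq> {..<N}" and Y: "Y \<subseteq> {..<N}"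
    and ne: "X \<noteq> Y"
  shows "weakly_separated X Y"
proof (cases "card X \<le> card Y")
  case True
  then show ?thesis
    using weakly_separated_insert_max[OF ws X Y] left_of_imp_weakly_separated ne by blast
next
  case False
  have N: "N \<notin> X" "N \<notin> Y" using X Y by auto
  have d: "X - insert N Y = X - Y" "insert N Y - X = insert N (Y - X)" using N by auto
  have "\<not> sprec (insert N Y) X" "\<not> splits (insert N Y) X"
  proof -
    show "\<not> sprec (insert N Y) X"
    proof
      assume "sprec (insert N Y) X"
      then obtain x where "x \<in> X - insert N Y" "N < x" unfolding sprec_def using N by blast
      with X show False by auto
    qed
    show "\<not> splits (insert N Y) X"
    proof
      assume "splits (insert N Y) X"
      then obtain Y1 Y2 where h: "Y1 \<union> Y2 = X - insert N Y" "Y2 \<noteq> {}"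
        "\<forall>i\<in>insert N Y - X. \<forall>j\<in>Y2. i < j"
        unfolding splits_iff by blast
      then obtain x where "x \<in> Y2" "N < x" using N by blast
      with h(1) X show False by auto
    qed
  qed
  then consider "sprec X (insert N Y)" | "splits X (insert N Y)"
    using ws unfolding weakly_separated_def by blast
  then show ?thesis
  proof cases
    case 1
    then have "left_of X Y" unfolding sprec_def left_of_def using N by auto
    then show ?thesis using left_of_imp_weakly_separated ne by blast
  next
    case 2
    then obtain Y1 Y2 where h: "Y1 \<union> Y2 = insert N (Y - X)" "Y1 \<noteq> {}" "Y2 \<noteq> {}" "X - Y \<noteq> {}"
      "\<forall>i\<in>Y1. \<forall>j\<in>X - Y. i < j" "\<forall>i\<in>X - Y. \<forall>j\<in>Y2. i < j"
      unfolding splits_iff d by blast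
    have N1: "N \<notin> Y1" using h(4,5) X by (metis DiffD1 ex_in_conv lessThan_iff order_less_asym subsetD)
    have e: "Y1 \<union> (Y2 - {N}) = Y - X" using h(1) N N1 by auto
    show ?thesis
    proof (cases "Y2 - {N} = {}")
      case True
      then have "left_of Y X" unfolding left_of_def using h(5) e by auto
      then show ?thesis using left_of_imp_weakly_separated ne weakly_separated_sym by blast
    next
      case False
      then have "splits X Y"
        unfolding splits_iff using h e by (intro exI[of _ Y1] exI[of _ "Y2 - {N}"]) auto
      then show ?thesis unfolding weakly_separated_def using \<open>\<not> card X \<le> card Y\<close> by auto
    qed
  qed
qed

lemma weakly_separated_insert_both:
  assumes "N \<notin> X" "N \<notin> Y" "finite X" "finite Y"
  shows "weakly_separated (insert N X) (insert N Y) \<longleftrightarrow> weakly_separated X Y"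
proof -
  have "insert N X - insert N Y = X - Y" "insert N Y - insert N X = Y - X" using assms by auto
  then show ?thesis unfolding weakly_separated_def sprec_def splits_iff using assms by simp
qed

text \<open>Complementing exchanges \<open>X - Y\<close> with \<open>Y - X\<close> and reverses the
  comparison of sizes, so each size condition stays attached to the right surrounding
  relation.\<close>

lemma weakly_separated_complement:
  assumes "X \<subseteq> {1..n}" "Y \<subseteq> {1..n}"
  shows "weakly_separated ({1..n} - X) ({1..n} - Y) \<longleftrightarrow> weakly_separated X Y"
proof (cases "X = Y")
  case False
  have d: "{1..n} - X - ({1..n} - Y) = Y - X" "{1..n} - Y - ({1..n} - X) = X - Y" using assms by auto
  have f: "finite X" "finite Y" using assms finite_subset by blast+
  have cc: "card ({1..n} - X) = n - card X" "card ({1..n} - Y) = n - card Y"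
    using assms f by (simp_all add: card_Diff_subset)
  have "card X \<le> n" "card Y \<le> n" using assms by (metis card_atLeastAtMost card_mono diff_Suc_1 finite_atLeastAtMost)+
  with cc have c: "card ({1..n} - X) \<ge> card ({1..n} - Y) \<longleftrightarrow> card Y \<ge> card X"
     "card ({1..n} - Y) \<ge> card ({1..n} - X) \<longleftrightarrow> card X \<ge> card Y" by auto
  have lo: "sprec A B \<or> sprec B A \<longleftrightarrow> left_of A B \<or> left_of B A" if "A \<noteq> B" for A B
    using that unfolding sprec_def left_of_def by blast
  have "left_of ({1..n} - X) ({1..n} - Y) \<longleftrightarrow> left_of Y X" "left_of ({1..n} - Y) ({1..n} - X) \<longleftrightarrow> left_of X Y"
    unfolding left_of_def d by blast+
  moreover have "{1..n} - X \<noteq> {1..n} - Y" using False d by blast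
  ultimately have 1: "sprec ({1..n} - X) ({1..n} - Y) \<or> sprec ({1..n} - Y) ({1..n} - X) \<longleftrightarrow> sprec X Y \<or> sprec Y X"
    using lo False by metis
  have 2: "splits ({1..n} - X) ({1..n} - Y) \<longleftrightarrow> splits Y X" "splits ({1..n} - Y) ({1..n} - X) \<longleftrightarrow> splits X Y"
    unfolding splits_iff d by blast+
  show ?thesis unfolding weakly_separated_def 2 c using 1 by blast
next
  case True
  have "\<not> weakly_separated Z Z" for Z unfolding weakly_separated_def sprec_def splits_iff by auto
  with True show ?thesis by simp
qed

section \<open>Labels at a set and the pairs of labels that span tiles\<close>

definition up_labels :: "nat set set \<Rightarrow> nat set \<Rightarrow> nat set" where
  "up_labels D X = {q. q \<notin> X \<and> insert q X \<in> D}"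

definition down_labels :: "nat set set \<Rightarrow> nat set \<Rightarrow> nat set" where
  "down_labels D Y = {q \<in> Y. Y - {q} \<in> D}"

definition adjacent :: "nat set \<Rightarrow> nat \<Rightarrow> nat \<Rightarrow> bool" where
  "adjacent Q i j \<longleftrightarrow> i \<in> Q \<and> j \<in> Q \<and> i < j \<and> (\<forall>k\<in>Q. \<not> (i < k \<and> k < j))"

text \<open>The pair consists of the minimum and the maximum of a set with at least three elements.
  Phrased by bounds, it is determined by \<open>Q\<close> even without finiteness.\<close>

definition lens_labels :: "nat set \<Rightarrow> nat \<Rightarrow> nat \<Rightarrow> bool" where
  "lens_labels Q i j \<longleftrightarrow> i \<in> Q \<and> j \<in> Q \<and> (\<forall>k\<in>Q. i \<le> k \<and> k \<le> j) \<and> (\<exists>k\<in>Q. i < k \<and> k < j)"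

text \<open>The second condition leaves out nonmembers \<open>X\<close> with only two labels: no
  black tile stands on such an \<open>X\<close>, so a white tile there would have a bottom that is
  neither a member nor terminal.\<close>

definition white_pair :: "nat set set \<Rightarrow> nat set \<Rightarrow> nat \<Rightarrow> nat \<Rightarrow> bool" where
  "white_pair D X i j \<longleftrightarrow>
     adjacent (up_labels D X) i j \<and> (X \<in> D \<or> (\<exists>k\<in>up_labels D X. k \<noteq> i \<and> k \<noteq> j))"

definition co_white_pair :: "nat set set \<Rightarrow> nat set \<Rightarrow> nat \<Rightarrow> nat \<Rightarrow> bool" where
  "co_white_pair D Y i j \<longleftrightarrow>
     adjacent (down_labels D Y) i j \<and> (Y \<in> D \<or> (\<exists>k\<in>down_labels D Y. k \<noteq> i \<and> k \<noteq> j))"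

definition black_pair :: "nat set set \<Rightarrow> nat set \<Rightarrow> nat \<Rightarrow> nat \<Rightarrow> bool" where
  "black_pair D X i j \<longleftrightarrow> X \<notin> D \<and> lens_labels (up_labels D X) i j"

definition co_black_pair :: "nat set set \<Rightarrow> nat set \<Rightarrow> nat \<Rightarrow> nat \<Rightarrow> bool" where
  "co_black_pair D Y i j \<longleftrightarrow> Y \<notin> D \<and> lens_labels (down_labels D Y) i j"

lemma ws_collectionD: "ws_collection n D \<Longrightarrow> X \<in> D \<Longrightarrow> Y \<in> D \<Longrightarrow> X \<noteq> Y \<Longrightarrow> weakly_separated X Y"
  unfolding ws_collection_def by blast

lemma ws_collection_finite_member: "ws_collection n D \<Longrightarrow> X \<in> D \<Longrightarrow> finite X"
  unfolding ws_collection_def by (meson PowD finite_atLeastAtMost finite_subset subsetD)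

lemma card_less_insert2: "finite X \<Longrightarrow> i \<notin> X \<Longrightarrow> j \<notin> X \<Longrightarrow> i \<noteq> j \<Longrightarrow> k \<in> X \<Longrightarrow>
   card X < card (insert i (insert j X) - {k})"
  by (subst card_Diff_singleton) auto

text \<open>A down-label \<open>k\<close> between \<open>i\<close> and \<open>j\<close> would give a
  member that contains \<open>i\<close> and \<open>j\<close> but not \<open>k\<close>. If
  \<open>X\<close> is a member, this violates separation from the smaller set \<open>X\<close>,
  which contains \<open>k\<close>. Otherwise there is a third label \<open>l\<close> outside the
  interval, and the member crosses \<open>insert l X\<close>.\<close>

lemma white_pair_adjacent_down:
  assumes D: "ws_collection n D" and w: "white_pair D X i j"
  shows "adjacent (down_labels D (insert i (insert j X))) i j"
proof -
  let ?Y = "insert i (insert j X)"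
  have a: "i \<notin> X" "j \<notin> X" "insert i X \<in> D" "insert j X \<in> D" "i < j"
    and c: "\<And>k. k \<in> up_labels D X \<Longrightarrow> \<not> (i < k \<and> k < j)"
    using w unfolding white_pair_def adjacent_def up_labels_def by auto
  have fX: "finite X" using ws_collection_finite_member[OF D a(3)] by simp
  have "?Y - {i} = insert j X" "?Y - {j} = insert i X" using a by auto
  then have ij: "i \<in> down_labels D ?Y" "j \<in> down_labels D ?Y" unfolding down_labels_def using a by auto
  have "\<not> (i < k \<and> k < j)" if k: "k \<in> down_labels D ?Y" for k
  proof
    assume ikj: "i < k \<and> k < j"
    have kX: "k \<in> X" "?Y - {k} \<in> D" using k ikj unfolding down_labels_def by auto
    consider "X \<in> D" | l where "l \<in> up_labels D X" "l \<noteq> i" "l \<noteq> j"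
      using w unfolding white_pair_def by blast
    then show False
    proof cases
      case 1
      have "card X < card (?Y - {k})" using card_less_insert2[of X i j k] fX a kX by simp
      then have "\<not> weakly_separated (?Y - {k}) X"
        using not_weakly_separated_between[of i "?Y - {k}" X j k] a ikj kX by auto
      then show False using ws_collectionD[OF D kX(2) 1] kX(1) by blast
    next
      case 2
      have l: "l \<notin> X" "insert l X \<in> D" using 2 unfolding up_labels_def by auto
      have "l < i \<or> j < l" using c[OF 2(1)] 2(2,3) by force
      then have "\<not> weakly_separated (?Y - {k}) (insert l X)"
      proof
        assume "j < l"
        then show ?thesis
          using not_weakly_separated_crossing[of i "?Y - {k}" "insert l X" j k l] a ikj kX l 2 by auto
      next
        assume "l < i"
        then show ?thesis
          using not_weakly_separated_crossing[of l "insert l X" "?Y - {k}" k i j] a ikj kX l 2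
            weakly_separated_sym by auto
      qed
      then show False using ws_collectionD[OF D kX(2) l(2)] kX(1) by blast
    qed
  qed
  then show ?thesis unfolding adjacent_def using ij a by blast
qed

text \<open>An inner label \<open>l\<close> decides everything. The top is larger than
  \<open>insert l X\<close> and contains \<open>i\<close> and \<open>j\<close> around
  \<open>l\<close>, so it is no member; and a down-label \<open>k\<close> outside the interval from
  \<open>i\<close> to \<open>j\<close> would give a member crossing
  \<open>insert l X\<close>.\<close>

lemma black_pair_top:
  assumes D: "ws_collection n D" and b: "black_pair D X i j"
  shows "insert i (insert j X) \<notin> D"
    "\<And>k. k \<in> down_labels D (insert i (insert j X)) \<Longrightarrow> i \<le> k \<and> k \<le> j"
    "i \<in> down_labels D (insert i (insert j X))" "j \<in> down_labels D (insert i (insert j X))"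
proof -
  let ?Y = "insert i (insert j X)"
  have a: "i \<notin> X" "j \<notin> X" "insert i X \<in> D" "insert j X \<in> D"
    using b unfolding black_pair_def lens_labels_def up_labels_def by auto
  obtain l where l: "l \<notin> X" "insert l X \<in> D" "i < l" "l < j"
    using b unfolding black_pair_def lens_labels_def up_labels_def by auto
  have fX: "finite X" using ws_collection_finite_member[OF D a(3)] by simp
  have "?Y - {i} = insert j X" "?Y - {j} = insert i X" using a l by auto
  then show "i \<in> down_labels D ?Y" "j \<in> down_labels D ?Y" unfolding down_labels_def using a by auto
  show "?Y \<notin> D"
  proof
    assume Y: "?Y \<in> D"
    have "card (insert l X) < card ?Y" using a l fX by simp
    then have "\<not> weakly_separated ?Y (insert l X)"
      using not_weakly_separated_between[of i ?Y "insert l X" j l] a l by auto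
    moreover have "?Y \<noteq> insert l X" using a l by (metis insertE insertI1 order_less_irrefl)
    ultimately show False using ws_collectionD[OF D Y l(2)] by blast
  qed
  fix k assume k: "k \<in> down_labels D ?Y"
  then have kY: "k \<in> ?Y" "?Y - {k} \<in> D" unfolding down_labels_def by auto
  show "i \<le> k \<and> k \<le> j"
  proof (rule ccontr)
    assume "\<not> (i \<le> k \<and> k \<le> j)"
    then have kk: "k < i \<or> j < k" by auto
    then have kX: "k \<in> X" using kY l by auto
    from kk have "\<not> weakly_separated (?Y - {k}) (insert l X)"
    proof
      assume "j < k"
      then show ?thesis
        using not_weakly_separated_crossing[of i "?Y - {k}" "insert l X" j l k] a l kX by auto
    next
      assume "k < i"
      then show ?thesis
        using not_weakly_separated_crossing[of k "insert l X" "?Y - {k}" l i j] a l kX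
          weakly_separated_sym by auto
    qed
    then show False using ws_collectionD[OF D kY(2) l(2)] kX by blast
  qed
qed

section \<open>Maximum collections and deletion of the last element\<close>

lemma weakly_separated_initial:
  assumes "X \<noteq> {1..h}" "X \<subseteq> {1..n}"
  shows "weakly_separated {1..h} X"
proof -
  have "left_of {1..h} X" unfolding left_of_def using assms by auto
  then show ?thesis using left_of_imp_weakly_separated assms by metis
qed

lemma weakly_separated_final:
  assumes "X \<noteq> {Suc h..n}" "X \<subseteq> {1..n}"
  shows "weakly_separated X {Suc h..n}"
proof -
  have "left_of X {Suc h..n}" unfolding left_of_def using assms by fastforce
  then show ?thesis using left_of_imp_weakly_separated assms by metis
qed

lemma ws_collection_finite: "ws_collection n D \<Longrightarrow> finite D"
  unfolding ws_collection_def by (meson finite_Pow_iff finite_atLeastAtMost finite_subset)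

lemma max_ws_collection_insert:
  assumes D: "max_ws_collection n D" and X: "X \<subseteq> {1..n}"
    and ws: "\<And>Y. Y \<in> D \<Longrightarrow> Y \<noteq> X \<Longrightarrow> weakly_separated X Y"
  shows "X \<in> D"
proof (rule ccontr)
  assume "X \<notin> D"
  have w: "ws_collection n D" using D unfolding max_ws_collection_def by blast
  have "ws_collection n (insert X D)"
    using w X ws weakly_separated_sym unfolding ws_collection_def by (metis PowI insert_iff insert_subset)
  then have "card (insert X D) \<le> card D" using D unfolding max_ws_collection_def by blast
  then show False using \<open>X \<notin> D\<close> ws_collection_finite[OF w] by simp
qed

lemma max_ws_collection_ws: "max_ws_collection n D \<Longrightarrow> ws_collection n D"
  unfolding max_ws_collection_def by blast

lemma ws_collection_subset: "ws_collection n D \<Longrightarrow> X \<in> D \<Longrightarrow> X \<subseteq> {1..n}"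
  unfolding ws_collection_def by blast

lemma max_ws_collection_boundary:
  assumes D: "max_ws_collection n D" and "h \<le> n"
  shows "{1..h} \<in> D" "{Suc h..n} \<in> D"
proof -
  have sub: "\<And>Y. Y \<in> D \<Longrightarrow> Y \<subseteq> {1..n}" using D ws_collection_subset max_ws_collection_ws by blast
  show "{1..h} \<in> D"
  proof (rule max_ws_collection_insert[OF D])
    show "weakly_separated {1..h} Y" if "Y \<in> D" "Y \<noteq> {1..h}" for Y
      using weakly_separated_initial[OF that(2) sub[OF that(1)]] .
  qed (use assms in auto)
  show "{Suc h..n} \<in> D"
  proof (rule max_ws_collection_insert[OF D])
    show "weakly_separated {Suc h..n} Y" if "Y \<in> D" "Y \<noteq> {Suc h..n}" for Y
      using weakly_separated_final[OF that(2) sub[OF that(1)]] weakly_separated_sym by blast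
  qed auto
qed

section \<open>Complementation as a symmetry\<close>

definition complements :: "nat \<Rightarrow> nat set set \<Rightarrow> nat set set" where
  "complements n D = (\<lambda>X. {1..n} - X) ` D"

lemma complements_complements: "D \<subseteq> Pow {1..n} \<Longrightarrow> complements n (complements n D) = D"
proof -
  assume D: "D \<subseteq> Pow {1..n}"
  have "(\<lambda>X. {1..n} - ({1..n} - X)) ` D = (\<lambda>X. X) ` D"
    by (rule image_cong[OF refl]) (use D in blast)
  then show ?thesis unfolding complements_def image_image by simp
qed

lemma complements_iff:
  "D \<subseteq> Pow {1..n} \<Longrightarrow> X \<subseteq> {1..n} \<Longrightarrow> {1..n} - X \<in> complements n D \<longleftrightarrow> X \<in> D"
proof -
  assume D: "D \<subseteq> Pow {1..n}" and X: "X \<subseteq> {1..n}"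
  have "Y = X" if "Y \<in> D" "{1..n} - X = {1..n} - Y" for Y
  proof -
    have "Y \<subseteq> {1..n}" using that D by blast
    then show ?thesis using X that(2) double_diff[OF X order_refl] double_diff[of Y "{1..n}"] by simp
  qed
  then show ?thesis unfolding complements_def by auto
qed

lemma ws_collection_complements:
  assumes "ws_collection n D" shows "ws_collection n (complements n D)" "card (complements n D) = card D"
proof -
  have sub: "D \<subseteq> Pow {1..n}" using assms unfolding ws_collection_def by blast
  have inj: "inj_on (\<lambda>X. {1..n} - X) D"
    by (rule inj_onI) (use sub in blast)
  then show "card (complements n D) = card D" unfolding complements_def by (rule card_image)
  have "weakly_separated ({1..n} - X) ({1..n} - Y)"
    if "X \<in> D" "Y \<in> D" "{1..n} - X \<noteq> {1..n} - Y" for X Y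
    using that assms sub weakly_separated_complement unfolding ws_collection_def
    by (metis PowD subsetD)
  then show "ws_collection n (complements n D)" unfolding ws_collection_def complements_def by auto
qed

lemma max_ws_collection_complements:
  assumes "max_ws_collection n D" shows "max_ws_collection n (complements n D)"
  using assms ws_collection_complements unfolding max_ws_collection_def by metis

text \<open>Complementation is the central reflection of the zonogon: an edge keeps its label and is
  reversed, and the left boundary becomes the right one.\<close>

lemma up_labels_complements:
  assumes D: "D \<subseteq> Pow {1..n}" and X: "X \<subseteq> {1..n}"
  shows "up_labels (complements n D) ({1..n} - X) = down_labels D X"
proof -
  have "q \<in> up_labels (complements n D) ({1..n} - X) \<longleftrightarrow> q \<in> down_labels D X" for q
  proof (cases "q \<in> X")
    case True
    then have "insert q ({1..n} - X) = {1..n} - (X - {q})" using X by auto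
    then show ?thesis
      using complements_iff[OF D, of "X - {q}"] X True unfolding up_labels_def down_labels_def by auto
  next
    case False
    have "insert q ({1..n} - X) \<notin> complements n D" if "q \<notin> {1..n}"
      using that D unfolding complements_def by blast
    then show ?thesis using False unfolding up_labels_def down_labels_def by auto
  qed
  then show ?thesis by blast
qed

lemma down_labels_complements:
  assumes D: "D \<subseteq> Pow {1..n}" and X: "X \<subseteq> {1..n}"
  shows "down_labels (complements n D) ({1..n} - X) = up_labels D X"
proof -
  have "complements n D \<subseteq> Pow {1..n}" unfolding complements_def by blast
  from up_labels_complements[OF this, of "{1..n} - X"] show ?thesis
    using complements_complements[OF D] X by (simp add: double_diff)
qed

section \<open>Members without and with the largest element\<close>

definition left_part :: "nat \<Rightarrow> nat set set \<Rightarrow> nat set set" where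
  "left_part N C = {X \<in> C. N \<notin> X}"

definition right_part :: "nat \<Rightarrow> nat set set \<Rightarrow> nat set set" where
  "right_part N C = {X. N \<notin> X \<and> insert N X \<in> C}"

context
  fixes m :: nat and C :: "nat set set"
  assumes C: "ws_collection (Suc m) C"
begin

private abbreviation "L \<equiv> left_part (Suc m) C"
private abbreviation "R \<equiv> right_part (Suc m) C"

lemma parts_subset: "L \<subseteq> Pow {1..m}" "R \<subseteq> Pow {1..m}"
proof -
  have sub: "\<And>X. X \<in> C \<Longrightarrow> X \<subseteq> {1..Suc m}" using ws_collection_subset[OF C] .
  have *: "X \<subseteq> {1..m}" if "Suc m \<notin> X" "X \<subseteq> {1..Suc m}" for X
    using that by (metis atLeastAtMostSuc_conv le_Suc_eq le_add1 plus_1_eq_Suc subset_insert)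
  show "L \<subseteq> Pow {1..m}"
  proof
    fix X assume "X \<in> L"
    then show "X \<in> Pow {1..m}" using *[OF _ sub] unfolding left_part_def by simp
  qed
  show "R \<subseteq> Pow {1..m}"
  proof
    fix X assume "X \<in> R"
    then show "X \<in> Pow {1..m}" using *[of X] sub[of "insert (Suc m) X"] unfolding right_part_def by simp
  qed
qed

lemma parts_less: "X \<in> L \<union> R \<Longrightarrow> X \<subseteq> {..<Suc m}"
proof -
  have "{1..m} \<subseteq> {..<Suc m}" by auto
  then show "X \<in> L \<union> R \<Longrightarrow> X \<subseteq> {..<Suc m}" using parts_subset by blast
qed

lemma parts_left_of:
  assumes "X \<in> L" "Y \<in> R" "card X \<le> card Y" shows "left_of X Y"
proof (rule weakly_separated_insert_max)
  show "X \<subseteq> {..<Suc m}" "Y \<subseteq> {..<Suc m}" using parts_less assms by blast+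
  show "weakly_separated X (insert (Suc m) Y)"
    by (rule ws_collectionD[OF C]) (use assms in \<open>auto simp: left_part_def right_part_def\<close>)
qed (rule assms)

lemma ws_collection_parts: "ws_collection m (L \<union> R)"
  unfolding ws_collection_def
proof (intro conjI ballI impI)
  show "L \<union> R \<subseteq> Pow {1..m}" using parts_subset by blast
  fix X Y assume XY: "X \<in> L \<union> R" "Y \<in> L \<union> R" "X \<noteq> Y"
  have lt: "X \<subseteq> {..<Suc m}" "Y \<subseteq> {..<Suc m}" using XY parts_less by blast+
  have fin: "finite X" "finite Y" using lt finite_subset by blast+
  have one: "weakly_separated A B" if "A \<in> L" "B \<in> R" "A \<noteq> B" for A B
  proof (rule weakly_separated_delete_one)
    show "weakly_separated A (insert (Suc m) B)"
      by (rule ws_collectionD[OF C]) (use that in \<open>auto simp: left_part_def right_part_def\<close>)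
  qed (use that parts_less in blast)+
  consider "X \<in> L \<and> Y \<in> L" | "X \<in> R \<and> Y \<in> R" | "X \<in> L \<and> Y \<in> R" | "X \<in> R \<and> Y \<in> L" using XY by blast
  then show "weakly_separated X Y"
  proof cases
    case 1 then show ?thesis using ws_collectionD[OF C] XY unfolding left_part_def by blast
  next
    case 2
    then have m: "Suc m \<notin> X" "Suc m \<notin> Y" "insert (Suc m) X \<in> C" "insert (Suc m) Y \<in> C"
      unfolding right_part_def by auto
    then have "insert (Suc m) X \<noteq> insert (Suc m) Y" using XY by (metis insert_ident)
    then show ?thesis
      using ws_collectionD[OF C m(3,4)] weakly_separated_insert_both[OF m(1,2) fin] by blast
  next
    case 3 then show ?thesis using one XY by blast
  next
    case 4 then show ?thesis using one XY weakly_separated_sym by blast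
  qed
qed

text \<open>Two common sets of one size precede each other in both directions. If they were
  distinct, both differences would be nonempty, which is impossible.\<close>

lemma parts_unique:
  assumes "X \<in> L \<inter> R" "Y \<in> L \<inter> R" "card X = card Y" shows "X = Y"
proof (rule ccontr)
  assume ne: "X \<noteq> Y"
  have fin: "finite X" "finite Y" using assms parts_less finite_subset[OF _ finite_lessThan] by blast+
  have lo: "left_of X Y" "left_of Y X" using assms parts_left_of by auto
  have "X - Y \<noteq> {}" "Y - X \<noteq> {}" using ne assms(3) fin
    by (metis Diff_eq_empty_iff card_subset_eq)+
  then obtain x y where "x \<in> X - Y" "y \<in> Y - X" by blast
  then have "x < y" "y < x" using lo unfolding left_of_def by auto
  then show False by simp
qed

lemma parts_card_image: "card (L \<inter> R) = card (card ` (L \<inter> R))" "card ` (L \<inter> R) \<subseteq> {..m}"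
proof -
  show "card (L \<inter> R) = card (card ` (L \<inter> R))"
    by (rule card_image[symmetric], rule inj_onI) (use parts_unique in blast)
  show "card ` (L \<inter> R) \<subseteq> {..m}"
  proof
    fix h assume "h \<in> card ` (L \<inter> R)"
    then obtain X where "X \<in> L" "h = card X" by blast
    then have "X \<subseteq> {1..m}" using parts_subset by blast
    then show "h \<in> {..m}" using card_mono[of "{1..m}" X] \<open>h = card X\<close> by simp
  qed
qed

lemma card_parts: "card C = card (L \<union> R) + card (L \<inter> R)"
proof -
  have fL: "finite L" "finite R" 
    by (rule finite_subset[OF parts_subset(1)], simp) (rule finite_subset[OF parts_subset(2)], simp)
  have e: "C = L \<union> insert (Suc m) ` R"
  proof
    show "C \<subseteq> L \<union> insert (Suc m) ` R"
    proof
      fix X assume X: "X \<in> C"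
      show "X \<in> L \<union> insert (Suc m) ` R"
      proof (cases "Suc m \<in> X")
        case True
        then have "X = insert (Suc m) (X - {Suc m})" "X - {Suc m} \<in> R"
          using X by (auto simp: right_part_def insert_absorb)
        then show ?thesis by blast
      qed (use X in \<open>simp add: left_part_def\<close>)
    qed
  qed (auto simp: left_part_def right_part_def)
  have "L \<inter> insert (Suc m) ` R = {}" unfolding left_part_def by blast
  then have "card C = card L + card (insert (Suc m) ` R)"
    using e fL by (metis card_Un_disjoint finite_imageI)
  also have "card (insert (Suc m) ` R) = card R"
    by (rule card_image, rule inj_onI) (simp add: right_part_def insert_ident)
  finally show ?thesis using card_Un_Int[OF fL] by simp
qed

end

text \<open>In closed form this is \<open>1 + n * (n + 1) / 2\<close>. The increment
  \<open>Suc m\<close> is the number of possible sizes of a common set.\<close>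

fun max_ws_size :: "nat \<Rightarrow> nat" where
  "max_ws_size 0 = 1"
| "max_ws_size (Suc m) = max_ws_size m + Suc m"

lemma ws_collection_card_le: "ws_collection n C \<Longrightarrow> card C \<le> max_ws_size n"
proof (induction n arbitrary: C)
  case 0
  then have "C \<subseteq> {{}}" unfolding ws_collection_def by auto
  then show ?case using card_mono[of "{{}}" C] by simp
next
  case (Suc m)
  have "card (left_part (Suc m) C \<inter> right_part (Suc m) C) \<le> Suc m"
    using parts_card_image[OF Suc.prems] card_mono[of "{..m}"] by (metis card_atMost finite_atMost)
  then show ?case using Suc.IH[OF ws_collection_parts[OF Suc.prems]] card_parts[OF Suc.prems] by simp
qed

text \<open>All intervals in \<open>{1..n}\<close> together with the empty set. The intervals added
  in a step are final ones, and these are weakly separated from every other set; so the size bound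
  is attained.\<close>

fun intervals :: "nat \<Rightarrow> nat set set" where
  "intervals 0 = {{}}"
| "intervals (Suc m) = intervals m \<union> (\<lambda>h. {Suc h..Suc m}) ` {..m}"

lemma intervals_ws: "ws_collection n (intervals n) \<and> card (intervals n) = max_ws_size n"
proof (induction n)
  case 0 then show ?case unfolding ws_collection_def by auto
next
  case (Suc m)
  let ?F = "(\<lambda>h. {Suc h..Suc m}) ` {..m}"
  have w: "ws_collection m (intervals m)" and c: "card (intervals m) = max_ws_size m" using Suc by auto
  have sub: "X \<subseteq> {1..m}" if "X \<in> intervals m" for X using ws_collection_subset[OF w that] .
  have disj: "intervals m \<inter> ?F = {}" using sub by fastforce
  have inj: "inj_on (\<lambda>h. {Suc h..Suc m}) {..m}" by (rule inj_onI) (auto simp: Icc_eq_Icc)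
  have "card (intervals (Suc m)) = max_ws_size (Suc m)"
    using card_Un_disjoint[OF ws_collection_finite[OF w] _ disj] card_image[OF inj] c by simp
  moreover have "ws_collection (Suc m) (intervals (Suc m))"
    unfolding ws_collection_def
  proof (intro conjI ballI impI)
    have "X \<subseteq> {1..Suc m}" if "X \<in> intervals (Suc m)" for X using that sub by force
    then show P: "intervals (Suc m) \<subseteq> Pow {1..Suc m}" by blast
    fix X Y assume XY: "X \<in> intervals (Suc m)" "Y \<in> intervals (Suc m)" "X \<noteq> Y"
    show "weakly_separated X Y"
    proof (cases "X \<in> ?F \<or> Y \<in> ?F")
      case True
      then show ?thesis using weakly_separated_final[of _ _ "Suc m"] weakly_separated_sym XY P by blast
    next
      case False
      then show ?thesis using XY ws_collectionD[OF w] by auto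
    qed
  qed
  ultimately show ?case by blast
qed

lemma max_ws_collection_card:
  "max_ws_collection n C \<longleftrightarrow> ws_collection n C \<and> card C = max_ws_size n"
  using intervals_ws[of n] ws_collection_card_le[of n] unfolding max_ws_collection_def
  by (metis order_antisym)

text \<open>The sizes of the union and of the intersection of the two parts are bounded by
  \<open>max_ws_size m\<close> and \<open>Suc m\<close>. In a maximum collection their sum attains
  the sum of the bounds, so each bound is attained separately.\<close>

lemma max_ws_collection_parts:
  assumes "max_ws_collection (Suc m) C"
  shows "max_ws_collection m (left_part (Suc m) C \<union> right_part (Suc m) C)"
    "\<And>h. h \<le> m \<Longrightarrow> \<exists>S\<in>left_part (Suc m) C \<inter> right_part (Suc m) C. card S = h"
proof -
  let ?L = "left_part (Suc m) C" and ?R = "right_part (Suc m) C"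
  have C: "ws_collection (Suc m) C" "card C = max_ws_size (Suc m)"
    using assms unfolding max_ws_collection_card by auto
  have sub: "card ` (?L \<inter> ?R) \<subseteq> {..m}" using parts_card_image[OF C(1)] by blast
  have le: "card (?L \<inter> ?R) \<le> Suc m"
    using parts_card_image[OF C(1)] card_mono[of "{..m}"] by (metis card_atMost finite_atMost)
  have "card (?L \<union> ?R) \<le> max_ws_size m" using ws_collection_card_le[OF ws_collection_parts[OF C(1)]] .
  then have e: "card (?L \<union> ?R) = max_ws_size m" "card (?L \<inter> ?R) = Suc m"
    using card_parts[OF C(1)] C(2) le by auto
  show "max_ws_collection m (?L \<union> ?R)"
    unfolding max_ws_collection_card using e ws_collection_parts[OF C(1)] by blast
  have "card ` (?L \<inter> ?R) = {..m}"
    using card_subset_eq[OF _ sub] e parts_card_image(1)[OF C(1)] by simp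
  then show "\<exists>S\<in>?L \<inter> ?R. card S = h" if "h \<le> m" for h using that by (metis atMost_iff imageE)
qed

section \<open>Local structure of maximum collections\<close>

lemma labelsD:
  "q \<in> up_labels D X \<Longrightarrow> q \<notin> X" "q \<in> up_labels D X \<Longrightarrow> insert q X \<in> D"
  "q \<in> down_labels D Y \<Longrightarrow> q \<in> Y" "q \<in> down_labels D Y \<Longrightarrow> Y - {q} \<in> D"
  unfolding up_labels_def down_labels_def by auto

lemma up_labels_subset: "D \<subseteq> Pow {1..n} \<Longrightarrow> up_labels D X \<subseteq> {1..n}"
  unfolding up_labels_def by auto

lemma finite_up_labels: "D \<subseteq> Pow {1..n} \<Longrightarrow> finite (up_labels D X)"
  by (rule finite_subset[OF up_labels_subset]) auto

lemma finite_down_labels: "D \<subseteq> Pow {1..n} \<Longrightarrow> finite (down_labels D Y)"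
proof (cases "down_labels D Y = {}")
  case False
  assume D: "D \<subseteq> Pow {1..n}"
  from False obtain q where "Y - {q} \<in> D" unfolding down_labels_def by blast
  then have "finite (Y - {q})" using D by (meson PowD finite_atLeastAtMost finite_subset subsetD)
  then show ?thesis unfolding down_labels_def by simp
qed simp

lemma lens_labels_MinMax:
  assumes "finite Q" "i \<in> Q" "k \<in> Q" "j \<in> Q" "i < k" "k < j"
  shows "lens_labels Q (Min Q) (Max Q)"
  unfolding lens_labels_def
proof (intro conjI ballI bexI[of _ k])
  show "Min Q \<in> Q" "Max Q \<in> Q" by (rule Min_in Max_in; use assms in auto)+
  show "Min Q < k" "k < Max Q" using assms Min_le[of Q i] Max_ge[of Q j] by linarith+
qed (use assms in auto)

lemma ex_adjacent_above:
  assumes "finite Q" "i \<in> Q" "r \<in> Q" "i < r"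
  obtains s where "adjacent Q i s"
proof -
  define t where "t = Min {s \<in> Q. i < s}"
  have "t \<in> {s \<in> Q. i < s}" unfolding t_def by (rule Min_in) (use assms in auto)
  moreover have "\<not> (i < k \<and> k < t)" if "k \<in> Q" for k
  proof
    assume k: "i < k \<and> k < t"
    have "t \<le> k" unfolding t_def by (rule Min_le) (use assms that k in auto)
    with k show False by simp
  qed
  ultimately have "adjacent Q i t" unfolding adjacent_def using assms by auto
  then show ?thesis using that by blast
qed

lemma ex_adjacent_below:
  assumes "finite Q" "i \<in> Q" "r \<in> Q" "r < i"
  obtains s where "adjacent Q s i"
proof -
  define t where "t = Max {s \<in> Q. s < i}"
  have "t \<in> {s \<in> Q. s < i}" unfolding t_def by (rule Max_in) (use assms in auto)
  moreover have "\<not> (t < k \<and> k < i)" if "k \<in> Q" for k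
  proof
    assume k: "t < k \<and> k < i"
    have "k \<le> t" unfolding t_def by (rule Max_ge) (use assms that k in auto)
    with k show False by simp
  qed
  ultimately have "adjacent Q t i" unfolding adjacent_def using assms by auto
  then show ?thesis using that by blast
qed

text \<open>
  \<open>strip\<close>: every edge has a neighbour on its right, except on the right boundary;
  \<open>white\<close>, \<open>black\<close>: the pairs defined by up-labels are also pairs for the down-labels of the top;
  \<open>inner\<close>: a vertex with no lower neighbour is an inner vertex of the upper chain of a lens.
\<close>
locale half_structure =
  fixes n :: nat and D :: "nat set set"
  assumes max: "max_ws_collection n D"
    and strip: "\<lbrakk>A \<in> D; q \<in> up_labels D A\<rbrakk> \<Longrightarrow>
      (\<exists>r\<in>up_labels D A. q < r) \<or> (\<exists>r\<in>down_labels D (insert q A). r < q) \<or> A = {Suc q..n}"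
    and white: "white_pair D X i j \<Longrightarrow> insert i (insert j X) \<in> D \<or>
      (\<exists>k\<in>down_labels D (insert i (insert j X)). k \<noteq> i \<and> k \<noteq> j)"
    and black: "black_pair D X i j \<Longrightarrow>
      \<exists>k\<in>down_labels D (insert i (insert j X)). i < k \<and> k < j"
    and inner: "\<lbrakk>A \<in> D; A \<noteq> {}; down_labels D A = {}\<rbrakk> \<Longrightarrow>
      \<exists>l\<in>A. \<exists>i\<in>up_labels D (A - {l}). \<exists>j\<in>up_labels D (A - {l}). i < l \<and> l < j"
    \<comment> \<open>A nonmember cannot have two labels upwards and two downwards at the same time,
      so a terminal vertex is not the bottom of one black tile and the top of another. This
      statement is its own mirror image under complementation.\<close>
    and terminal: "\<lbrakk>X \<notin> D; i \<in> up_labels D X; j \<in> up_labels D X; i \<noteq> j;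
      k \<in> down_labels D X; l \<in> down_labels D X\<rbrakk> \<Longrightarrow> k = l"
begin

lemma ws: "ws_collection n D" using max max_ws_collection_ws by blast

lemma sub: "D \<subseteq> Pow {1..n}" using ws unfolding ws_collection_def by blast

lemma white_imp_co_white: "white_pair D X i j \<Longrightarrow> co_white_pair D (insert i (insert j X)) i j"
  unfolding co_white_pair_def using white white_pair_adjacent_down[OF ws] by blast

lemma black_imp_co_black: "black_pair D X i j \<Longrightarrow> co_black_pair D (insert i (insert j X)) i j"
  unfolding co_black_pair_def lens_labels_def using black black_pair_top[OF ws] by blast

end

lemma white_pair_complements:
  assumes "D \<subseteq> Pow {1..n}" "Y \<subseteq> {1..n}"
  shows "white_pair (complements n D) ({1..n} - Y) i j \<longleftrightarrow> co_white_pair D Y i j"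
    "co_white_pair (complements n D) ({1..n} - Y) i j \<longleftrightarrow> white_pair D Y i j"
    "black_pair (complements n D) ({1..n} - Y) i j \<longleftrightarrow> co_black_pair D Y i j"
    "co_black_pair (complements n D) ({1..n} - Y) i j \<longleftrightarrow> black_pair D Y i j"
  unfolding white_pair_def co_white_pair_def black_pair_def co_black_pair_def
    up_labels_complements[OF assms] down_labels_complements[OF assms] complements_iff[OF assms] by simp_all

lemma down_labels_two_subset:
  assumes "D \<subseteq> Pow {1..n}" "i \<in> down_labels D Y" "j \<in> down_labels D Y" "i \<noteq> j"
  shows "Y \<subseteq> {1..n}"
proof -
  have "Y - {i} \<subseteq> {1..n}" "Y - {j} \<subseteq> {1..n}" using assms labelsD(4) by blast+
  then show ?thesis using assms(4) by blast
qed

text \<open>Only one of each pair of mirrored statements goes through the induction; the other is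
  the same statement for the complements, which again form a maximum collection.\<close>

locale full_structure = half_structure + dual: half_structure n "complements n D"
begin

lemma strip': 
  assumes "A \<in> D" "q \<in> up_labels D A"
  shows "(\<exists>r\<in>up_labels D A. r < q) \<or> (\<exists>r\<in>down_labels D (insert q A). q < r) \<or> A = {1..<q}"
proof -
  have s: "insert q A \<subseteq> {1..n}" "A \<subseteq> {1..n}" using labelsD(2)[OF assms(2)] sub by auto
  have qA: "q \<notin> A" using labelsD(1)[OF assms(2)] .
  let ?A = "{1..n} - insert q A"
  have i: "insert q ?A = {1..n} - A" using s qA by auto
  have "?A \<in> complements n D" using complements_iff[OF sub s(1)] labelsD(2)[OF assms(2)] by blast
  moreover have "q \<in> up_labels (complements n D) ?A"
    unfolding up_labels_complements[OF sub s(1)] down_labels_def using assms qA by simp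
  ultimately have "(\<exists>r\<in>down_labels D (insert q A). q < r) \<or> (\<exists>r\<in>up_labels D A. r < q) \<or> ?A = {Suc q..n}"
    using dual.strip[of ?A q]
    unfolding i up_labels_complements[OF sub s(1)] down_labels_complements[OF sub s(2)] by blast
  moreover have "A = {1..<q}" if "?A = {Suc q..n}"
  proof -
    have "insert q A = {1..n} - {Suc q..n}" using that s(1) by blast
    also have "\<dots> = insert q {1..<q}" using s(1) by auto
    finally show ?thesis using qA by (metis atLeastLessThan_iff insert_ident order_less_irrefl)
  qed
  ultimately show ?thesis by blast
qed

lemma co_white_imp_white:
  assumes "co_white_pair D Y i j" shows "white_pair D (Y - {i, j}) i j"
proof -
  have ij: "i \<in> down_labels D Y" "j \<in> down_labels D Y" "i \<noteq> j"
    using assms unfolding co_white_pair_def adjacent_def by auto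
  have Y: "Y \<subseteq> {1..n}" using down_labels_two_subset[OF sub ij] .
  have "co_white_pair (complements n D) (insert i (insert j ({1..n} - Y))) i j"
    by (rule dual.white_imp_co_white) (use white_pair_complements[OF sub Y] assms in blast)
  moreover have "insert i (insert j ({1..n} - Y)) = {1..n} - (Y - {i, j})"
    using labelsD(3)[OF ij(1)] labelsD(3)[OF ij(2)] Y by auto
  moreover have "Y - {i, j} \<subseteq> {1..n}" using Y by blast
  ultimately show ?thesis using white_pair_complements(2)[OF sub] by metis
qed

lemma co_black_imp_black:
  assumes "co_black_pair D Y i j" shows "black_pair D (Y - {i, j}) i j"
proof -
  have ij: "i \<in> down_labels D Y" "j \<in> down_labels D Y" "i \<noteq> j"
    using assms unfolding co_black_pair_def lens_labels_def by auto
  have Y: "Y \<subseteq> {1..n}" using down_labels_two_subset[OF sub ij] .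
  have "co_black_pair (complements n D) (insert i (insert j ({1..n} - Y))) i j"
    by (rule dual.black_imp_co_black) (use white_pair_complements[OF sub Y] assms in blast)
  moreover have "insert i (insert j ({1..n} - Y)) = {1..n} - (Y - {i, j})"
    using labelsD(3)[OF ij(1)] labelsD(3)[OF ij(2)] Y by auto
  moreover have "Y - {i, j} \<subseteq> {1..n}" using Y by blast
  ultimately show ?thesis using white_pair_complements(4)[OF sub] by metis
qed

end

lemma full_structureI:
  assumes "\<And>D. max_ws_collection n D \<Longrightarrow> half_structure n D" "max_ws_collection n D"
  shows "full_structure n D"
  using assms max_ws_collection_complements by (simp add: full_structure_def)

section \<open>Position of edges, tiles and lenses relative to the common sets\<close>

locale deletion =
  fixes m :: nat and C :: "nat set set"
  assumes maxC: "max_ws_collection (Suc m) C"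
    and IH: "full_structure m (left_part (Suc m) C \<union> right_part (Suc m) C)"
begin

abbreviation "N \<equiv> Suc m"
abbreviation "L \<equiv> left_part N C"
abbreviation "R \<equiv> right_part N C"
abbreviation "D \<equiv> L \<union> R"

sublocale full_structure m D by (rule IH)

lemma wsC: "ws_collection N C" using maxC max_ws_collection_ws by blast

lemma mem_left: "N \<notin> X \<Longrightarrow> X \<in> C \<longleftrightarrow> X \<in> L" unfolding left_part_def by simp
lemma mem_right: "N \<notin> X \<Longrightarrow> insert N X \<in> C \<longleftrightarrow> X \<in> R" unfolding right_part_def by simp

lemma memD: "X \<in> D \<Longrightarrow> X \<subseteq> {1..m}" "X \<in> D \<Longrightarrow> N \<notin> X" "X \<in> D \<Longrightarrow> finite X"
proof -
  assume "X \<in> D"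
  then show X: "X \<subseteq> {1..m}" using sub by blast
  then show "N \<notin> X" by auto
  show "finite X" using X by (rule finite_subset) simp
qed

lemma labels_less: "insert q X \<in> D \<Longrightarrow> q < N" using memD(1) by fastforce

lemma left_of_parts: "X \<in> L \<Longrightarrow> Y \<in> R \<Longrightarrow> card X \<le> card Y \<Longrightarrow> left_of X Y"
  using parts_left_of[OF wsC] .

lemma up_left: "N \<notin> A \<Longrightarrow> q \<in> up_labels C A \<longleftrightarrow> (if q = N then A \<in> R else q \<notin> A \<and> insert q A \<in> L)"
  unfolding up_labels_def left_part_def right_part_def by auto

lemma up_right: "N \<notin> A \<Longrightarrow> q \<in> up_labels C (insert N A) \<longleftrightarrow> q \<noteq> N \<and> q \<notin> A \<and> insert q A \<in> R"
  unfolding up_labels_def right_part_def by (auto simp: insert_commute)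

lemma down_left: "N \<notin> A \<Longrightarrow> q \<in> down_labels C A \<longleftrightarrow> q \<in> A \<and> A - {q} \<in> L"
  unfolding down_labels_def left_part_def by auto

lemma down_right:
  assumes "N \<notin> A"
  shows "q \<in> down_labels C (insert N A) \<longleftrightarrow> (if q = N then A \<in> L else q \<in> A \<and> A - {q} \<in> R)"
proof -
  have "insert N A - {q} = insert N (A - {q})" if "q \<noteq> N" using that by auto
  then show ?thesis using assms unfolding down_labels_def left_part_def right_part_def by auto
qed

text \<open>Upper neighbours of one set have equal size, so a left one precedes a right one. For
  lower neighbours, in \<open>down_order\<close>, labels are deleted instead of inserted and their
  order is reversed.\<close>

lemma up_order:
  assumes "insert j X \<in> L" "insert k X \<in> R" "j \<notin> X" "k \<notin> X" shows "j \<le> k"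
proof (cases "j = k")
  case False
  have "finite X" using memD(3)[of "insert j X"] assms by auto
  then have "left_of (insert j X) (insert k X)" using left_of_parts assms by simp
  then have "j < k" using False assms by (intro left_ofD[of "insert j X" "insert k X"]) auto
  then show ?thesis by simp
qed simp

lemma down_order:
  assumes "Y - {j} \<in> L" "Y - {k} \<in> R" "j \<in> Y" "k \<in> Y" shows "k \<le> j"
proof (cases "j = k")
  case False
  have "finite Y" using memD(3)[of "Y - {j}"] assms by auto
  then have "left_of (Y - {j}) (Y - {k})" using left_of_parts assms by simp
  then have "k < j" using False assms by (intro left_ofD[of "Y - {j}" "Y - {k}"]) auto
  then show ?thesis by simp
qed simp

lemma initial_left: "q \<le> m \<Longrightarrow> {1..q} \<in> L"
  using max_ws_collection_boundary(1)[OF maxC, of q] mem_left[of "{1..q}"] by auto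

lemma final_right: "q \<le> m \<Longrightarrow> {Suc q..m} \<in> R"
proof -
  assume "q \<le> m"
  then have "insert N {Suc q..m} = {Suc q..N}" by auto
  then show ?thesis
    using max_ws_collection_boundary(2)[OF maxC, of q] mem_right[of "{Suc q..m}"] \<open>q \<le> m\<close> by auto
qed

lemma ex_mid: "h \<le> m \<Longrightarrow> \<exists>S. S \<in> L \<and> S \<in> R \<and> card S = h"
  using max_ws_collection_parts(2)[OF maxC] by blast

lemma card_le: "X \<in> D \<Longrightarrow> card X \<le> m"
  using card_mono[of "{1..m}" X] memD(1) by simp

lemma finite_labels: "finite (up_labels D X)" "finite (down_labels D X)"
  using finite_up_labels[OF sub] finite_down_labels[OF sub] .

lemma ex_diff: "finite X \<Longrightarrow> finite Y \<Longrightarrow> card X = card Y \<Longrightarrow> X \<noteq> Y \<Longrightarrow> \<exists>x. x \<in> X \<and> x \<notin> Y"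
  by (metis card_subset_eq subsetI)

text \<open>Otherwise consider the common sets \<open>S\<close> and \<open>S'\<close> of the sizes
  of \<open>A\<close> and of \<open>insert q A\<close>. The orders squeeze \<open>S\<close> below
  \<open>insert q A\<close> and \<open>S'\<close> above \<open>A\<close>, so that \<open>q\<close>
  lies in \<open>S - S'\<close> and some \<open>s < q\<close> of \<open>A\<close> lies in
  \<open>S' - S\<close>. This contradicts \<open>left_of S S'\<close>.\<close>

lemma no_gap:
  assumes A: "A \<in> D" and B: "insert q A \<in> D" and q: "q \<notin> A"
  shows "A \<in> R \<or> insert q A \<in> L"
proof (rule ccontr)
  assume "\<not> ?thesis"
  then have AL: "A \<in> L" "A \<notin> R" and BR: "insert q A \<in> R" "insert q A \<notin> L" using A B by auto
  let ?B = "insert q A"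
  have fA: "finite A" using memD(3)[OF A] .
  have cB: "card ?B = Suc (card A)" using fA q by simp
  obtain S where S: "S \<in> L" "S \<in> R" "card S = card A" using ex_mid[of "card A"] card_le[OF A] by auto
  obtain S' where S': "S' \<in> L" "S' \<in> R" "card S' = Suc (card A)" using ex_mid[of "card ?B"] card_le[OF B] cB by auto
  have fS: "finite S" "finite S'" using memD(3) S S' by auto
  have AS: "left_of A S" and SB: "left_of S ?B" and AS': "left_of A S'" and SB': "left_of S' ?B" and SS': "left_of S S'"
    using left_of_parts AL BR S S' cB by auto
  obtain s where s: "s \<in> A" "s \<notin> S" using ex_diff[of A S] fA fS S AL by auto
  have "S \<subseteq> ?B"
  proof
    fix x assume x: "x \<in> S"
    show "x \<in> ?B"
    proof (rule ccontr)
      assume nx: "x \<notin> ?B"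
      have "s < x" using left_ofD[OF AS s x] nx by auto
      moreover have "x < s" using left_ofD[OF SB x nx, of s] s by auto
      ultimately show False by simp
    qed
  qed
  moreover obtain t where t: "t \<in> S" "t \<notin> A" using ex_diff[of S A] fA fS S AL by auto
  ultimately have qS: "q \<in> S" by auto
  have sq: "s < q" using left_ofD[OF AS s qS] q by auto
  obtain s' where s': "s' \<in> S'" "s' \<notin> ?B" using ex_diff[of S' ?B] fA fS S' BR cB by auto
  have AS'': "A \<subseteq> S'"
  proof
    fix x assume x: "x \<in> A"
    show "x \<in> S'"
    proof (rule ccontr)
      assume nx: "x \<notin> S'"
      have "x < s'" using left_ofD[OF AS' x nx s'(1)] s' by auto
      moreover have "s' < x" using left_ofD[OF SB' s', of x] x nx by auto
      ultimately show False by simp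
    qed
  qed
  have qS': "q \<notin> S'"
  proof
    assume "q \<in> S'"
    then have "?B \<subseteq> S'" using AS'' by auto
    then have "?B = S'" using card_subset_eq[OF fS(2)] S' cB by auto
    then show False using s' by auto
  qed
  have "q < s" using left_ofD[OF SS' qS qS', of s] s AS'' by auto
  with sq show False by simp
qed

text \<open>The common set of this size is squeezed between the two given sets. Either it contains
  \<open>K\<close> and arises by inserting some \<open>s\<close>, or it lies in the union of the two
  and arises by deleting some \<open>s\<close>; in both cases the orders put \<open>s\<close>
  strictly between \<open>i\<close> and \<open>j\<close>.\<close>

lemma separated:
  assumes K: "i \<notin> K" "j \<notin> K" "i < j" and i: "insert i K \<in> L" "insert i K \<notin> R"
    and j: "insert j K \<in> R" "insert j K \<notin> L"
  shows "\<exists>s. i < s \<and> s < j \<and> (s \<in> up_labels D K \<or> s \<in> down_labels D (insert i (insert j K)))"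
proof -
  let ?A = "insert i K" and ?A' = "insert j K" and ?B = "insert i (insert j K)"
  have fK: "finite K" using memD(3)[of ?A] i by auto
  obtain S where S: "S \<in> L" "S \<in> R" "card S = Suc (card K)"
    using ex_mid[of "card ?A"] card_le[of ?A] i fK K by auto
  have fS: "finite S" using memD(3) S by auto
  have cA: "card ?A = Suc (card K)" "card ?A' = Suc (card K)" using fK K by auto
  have AS: "left_of ?A S" and SA: "left_of S ?A'" using left_of_parts i j S cA by auto
  have ne: "S \<noteq> ?A" "S \<noteq> ?A'" using S i j by auto
  show ?thesis
  proof (cases "K \<subseteq> S")
    case True
    have "\<not> S \<subseteq> K" using card_mono[OF fK, of S] S by auto
    then obtain s where s: "s \<in> S" "s \<notin> K" by blast
    have "insert s K = S" using card_subset_eq[OF fS, of "insert s K"] True s S fK by auto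
    then have "S = insert s K" by simp
    with ne have "s \<noteq> i" "s \<noteq> j" by auto
    have "i < s" using left_ofD[OF AS, of i s] \<open>S = insert s K\<close> s K \<open>s \<noteq> i\<close> by auto
    moreover have "s < j" using left_ofD[OF SA, of s j] \<open>S = insert s K\<close> s K \<open>s \<noteq> j\<close> by auto
    moreover have "s \<in> up_labels D K" unfolding up_labels_def using s S \<open>S = insert s K\<close> by auto
    ultimately show ?thesis by blast
  next
    case False
    then obtain s where s: "s \<in> K" "s \<notin> S" by blast
    have "S \<subseteq> ?B"
    proof
      fix x assume x: "x \<in> S"
      show "x \<in> ?B"
      proof (rule ccontr)
        assume nx: "x \<notin> ?B"
        have "s < x" using left_ofD[OF AS, of s x] s x nx by auto
        moreover have "x < s" using left_ofD[OF SA, of x s] s x nx by auto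
        ultimately show False by simp
      qed
    qed
    then have "S \<subseteq> ?B - {s}" using s by auto
    moreover have "card (?B - {s}) = Suc (card K)" using s K fK by (subst card_Diff_singleton) auto
    ultimately have e: "S = ?B - {s}" using card_subset_eq[of "?B - {s}" S] fK S by auto
    have ij: "i \<in> S" "j \<in> S" unfolding e using s K by auto
    have "s < j" using left_ofD[OF AS, of s j] s ij K by auto
    moreover have "i < s" using left_ofD[OF SA, of i s] s ij K by auto
    moreover have "s \<in> down_labels D ?B" unfolding down_labels_def using s S e by auto
    ultimately show ?thesis by blast
  qed
qed

text \<open>For a white tile the labels are adjacent at the bottom and at the top, which leaves no
  room for the label that \<open>separated\<close> would supply. Hence no white tile is torn apart
  between the two sides.\<close>

lemma white_sides:
  assumes "white_pair D X i j"
  shows "insert i X \<in> R \<or> insert j X \<in> L"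
proof (rule ccontr)
  assume neg: "\<not> ?thesis"
  have a: "adjacent (up_labels D X) i j" "adjacent (down_labels D (insert i (insert j X))) i j"
    using assms white_pair_adjacent_down[OF ws] unfolding white_pair_def by auto
  then have "i \<notin> X" "j \<notin> X" "i < j" "insert i X \<in> D" "insert j X \<in> D"
    unfolding adjacent_def up_labels_def by auto
  then obtain s where "i < s" "s < j" "s \<in> up_labels D X \<or> s \<in> down_labels D (insert i (insert j X))"
    using separated[of i X j] neg by auto
  then show False using a unfolding adjacent_def by blast
qed

text \<open>The sets have equal size and differ in \<open>{l, k}\<close> against
  \<open>{i, j}\<close>. As \<open>l\<close> lies strictly between \<open>i\<close> and
  \<open>j\<close>, neither set can precede the other.\<close>

lemma lens_inner:
  assumes b: "black_pair D X i j"
    and l: "l \<in> up_labels D X" "i < l" "l < j"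
    and k: "k \<in> down_labels D (insert i (insert j X))" "i < k" "k < j"
  shows "\<not> (insert l X \<in> L \<and> insert i (insert j X) - {k} \<in> R)"
    "\<not> (insert l X \<in> R \<and> insert i (insert j X) - {k} \<in> L)"
proof -
  let ?Y = "insert i (insert j X)"
  have ij: "i \<notin> X" "j \<notin> X" "insert i X \<in> D"
    using b unfolding black_pair_def lens_labels_def up_labels_def by auto
  have lX: "l \<notin> X" "insert l X \<in> D" by (rule labelsD(1)[OF l(1)], rule labelsD(2)[OF l(1)])
  have kX: "k \<in> X" using labelsD(3)[OF k(1)] k by auto
  have fX: "finite X" using memD(3)[OF lX(2)] by simp
  have c: "card (?Y - {k}) = Suc (card X)" using kX ij k fX by (subst card_Diff_singleton) auto
  have c': "card (insert l X) = Suc (card X)" using fX lX by simp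
  show "\<not> (insert l X \<in> L \<and> ?Y - {k} \<in> R)"
  proof
    assume "insert l X \<in> L \<and> ?Y - {k} \<in> R"
    then have "left_of (insert l X) (?Y - {k})" using left_of_parts c c' by auto
    then have "l < i" by (rule left_ofD) (use lX ij l k kX in auto)
    with l show False by simp
  qed
  show "\<not> (insert l X \<in> R \<and> ?Y - {k} \<in> L)"
  proof
    assume "insert l X \<in> R \<and> ?Y - {k} \<in> L"
    then have "left_of (?Y - {k}) (insert l X)" using left_of_parts c c' by auto
    then have "j < l" by (rule left_ofD) (use lX ij l k kX in auto)
    with l show False by simp
  qed
qed

lemma lens_inner_strict:
  assumes b: "black_pair D X i j" and l: "l \<in> up_labels D X" "i < l" "l < j"
  shows "\<not> (insert l X \<in> L \<and> insert l X \<in> R)"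
proof -
  obtain k where k: "k \<in> down_labels D (insert i (insert j X))" "i < k" "k < j" using black[OF b] by blast
  have "insert i (insert j X) - {k} \<in> D" using labelsD(4)[OF k(1)] .
  then show ?thesis using lens_inner[OF b l k] by blast
qed

text \<open>By \<open>lens_inner\<close> all inner vertices, from the bottom and from the top, lie
  on one side only. One end of the lens follows by \<open>up_order\<close>; for the other,
  \<open>white_sides\<close> is applied to the white tile between this end and its neighbouring
  label.\<close>

lemma lens_sides:
  assumes b: "black_pair D X i j"
  defines "Y \<equiv> insert i (insert j X)"
  obtains "\<And>q. q \<in> up_labels D X \<Longrightarrow> insert q X \<in> L" "\<And>k. k \<in> down_labels D Y \<Longrightarrow> Y - {k} \<in> L"
  | "\<And>q. q \<in> up_labels D X \<Longrightarrow> insert q X \<in> R" "\<And>k. k \<in> down_labels D Y \<Longrightarrow> Y - {k} \<in> R"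
proof -
  have ij: "i \<in> up_labels D X" "j \<in> up_labels D X" "\<And>q. q \<in> up_labels D X \<Longrightarrow> i \<le> q \<and> q \<le> j"
    using b unfolding black_pair_def lens_labels_def by auto
  obtain l where l: "l \<in> up_labels D X" "i < l" "l < j"
    using b unfolding black_pair_def lens_labels_def by auto
  obtain k where k: "k \<in> down_labels D Y" "i < k" "k < j" using black[OF b] unfolding Y_def by blast
  have Yk: "Y - {k} \<in> D" if "k \<in> down_labels D Y" for k using labelsD(4)[OF that] .
  have Xl: "insert l X \<in> D" "l \<notin> X" if "l \<in> up_labels D X" for l
    by (rule labelsD(2)[OF that], rule labelsD(1)[OF that])
  note inn = lens_inner[OF b, folded Y_def]
  have nij: "i \<notin> X" "j \<notin> X" by (rule labelsD(1)[OF ij(1)], rule labelsD(1)[OF ij(2)])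
  have Yij: "Y - {i} = insert j X" "Y - {j} = insert i X" unfolding Y_def using nij l by auto
  have dn: "k = i \<or> k = j \<or> (i < k \<and> k < j)" if "k \<in> down_labels D Y" for k
    using black_pair_top(2)[OF ws b, of k] that unfolding Y_def by force
  have up: "q = i \<or> q = j \<or> (i < q \<and> q < j)" if "q \<in> up_labels D X" for q
    using ij(3)[OF that] by force
  have third: "white_pair D X p q" if "adjacent (up_labels D X) p q" "p = i \<or> q = j" "p \<noteq> i \<or> q \<noteq> j" for p q
  proof (cases "p = i")
    case True
    then have "j \<noteq> p" "j \<noteq> q" using that l by auto
    then show ?thesis unfolding white_pair_def using that(1) ij(2) by blast
  next
    case False
    then have "i \<noteq> p" "i \<noteq> q" using that l by auto
    then show ?thesis unfolding white_pair_def using that(1) ij(1) by blast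
  qed
  show ?thesis
  proof (cases "insert l X \<in> L")
    case True
    have a: "Y - {k'} \<in> L" if "k' \<in> down_labels D Y" "i < k'" "k' < j" for k'
      using inn(1)[OF l that] True Yk[OF that(1)] by blast
    have c: "insert l' X \<in> L \<and> insert l' X \<notin> R" if "l' \<in> up_labels D X" "i < l'" "l' < j" for l'
      using inn(2)[OF that k] a[OF k] Xl[OF that(1)] by blast
    have "insert i X \<in> L" using up_order[of l X i] Xl[OF l(1)] Xl[OF ij(1)] True l by auto
    moreover have "insert j X \<in> L"
    proof -
      obtain p where p: "adjacent (up_labels D X) p j"
        by (rule ex_adjacent_below[OF finite_labels(1) ij(2) l(1,3)])
      have "p \<noteq> i" using p l unfolding adjacent_def by blast
      then have "white_pair D X p j" using third p by blast
      moreover have "insert p X \<notin> R" using c[of p] p \<open>p \<noteq> i\<close> up[of p] unfolding adjacent_def by auto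
      ultimately show ?thesis using white_sides by blast
    qed
    ultimately show ?thesis using that(1) a c up dn Yij by metis
  next
    case False
    then have lR: "insert l X \<in> R" using Xl[OF l(1)] by blast
    have a: "Y - {k'} \<in> R" if "k' \<in> down_labels D Y" "i < k'" "k' < j" for k'
      using inn(2)[OF l that] lR Yk[OF that(1)] by blast
    have c: "insert l' X \<in> R \<and> insert l' X \<notin> L" if "l' \<in> up_labels D X" "i < l'" "l' < j" for l'
      using inn(1)[OF that k] a[OF k] Xl[OF that(1)] by blast
    have "insert j X \<in> R" using up_order[of j X l] Xl[OF l(1)] Xl[OF ij(2)] lR l by auto
    moreover have "insert i X \<in> R"
    proof -
      obtain p where p: "adjacent (up_labels D X) i p"
        by (rule ex_adjacent_above[OF finite_labels(1) ij(1) l(1,2)])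
      have "p \<noteq> j" using p l unfolding adjacent_def by blast
      then have "white_pair D X i p" using third p by blast
      moreover have "insert p X \<notin> L" using c[of p] p \<open>p \<noteq> j\<close> up[of p] unfolding adjacent_def by auto
      ultimately show ?thesis using white_sides by blast
    qed
    ultimately show ?thesis using that(2) a c up dn Yij by metis
  qed
qed

text \<open>Two labels that give left sets exclude the right alternative of
  \<open>lens_sides\<close>, since sets lying on both sides would have their labels ordered in both
  ways.\<close>

lemma lens_left:
  assumes b: "black_pair D X i j" and pq: "p \<in> up_labels D X" "q \<in> up_labels D X" "p \<noteq> q"
    "insert p X \<in> L" "insert q X \<in> L"
  shows "r \<in> up_labels D X \<Longrightarrow> insert r X \<in> L"
    "k \<in> down_labels D (insert i (insert j X)) \<Longrightarrow> insert i (insert j X) - {k} \<in> L"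
  by (rule lens_sides[OF b]; use pq up_order labelsD(1) in \<open>metis order_antisym\<close>)+

lemma lens_right:
  assumes b: "black_pair D X i j" and pq: "p \<in> up_labels D X" "q \<in> up_labels D X" "p \<noteq> q"
    "insert p X \<in> R" "insert q X \<in> R"
  shows "r \<in> up_labels D X \<Longrightarrow> insert r X \<in> R"
    "k \<in> down_labels D (insert i (insert j X)) \<Longrightarrow> insert i (insert j X) - {k} \<in> R"
  by (rule lens_sides[OF b]; use pq up_order labelsD(1) in \<open>metis order_antisym\<close>)+

lemma colens:
  assumes Y: "Y \<notin> D" and ij: "i \<in> down_labels D Y" "j \<in> down_labels D Y" "k \<in> down_labels D Y"
    "i \<noteq> j" "k \<noteq> i" "k \<noteq> j"
  obtains X p q where "black_pair D X p q" "Y = insert p (insert q X)"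
proof -
  define p q where pq: "p = Min (down_labels D Y)" "q = Max (down_labels D Y)"
  have "lens_labels (down_labels D Y) p q"
  proof -
    consider "i < j \<and> j < k" | "i < k \<and> k < j" | "j < i \<and> i < k" | "j < k \<and> k < i" | "k < i \<and> i < j" | "k < j \<and> j < i"
      using ij by linarith
    then show ?thesis unfolding pq
      by cases (use lens_labels_MinMax[OF finite_labels(2)] ij in blast)+
  qed
  then have "co_black_pair D Y p q" using Y unfolding co_black_pair_def by blast
  moreover from this have "p \<in> Y" "q \<in> Y" unfolding co_black_pair_def lens_labels_def using labelsD(3) by blast+
  ultimately show ?thesis using that[of "Y - {p, q}" p q] co_black_imp_black by (metis insert_Diff_if insert_Diff insert_iff Diff_insert Diff_insert2)
qed

lemma colens_left:
  assumes Y: "Y \<notin> D" and ij: "i \<in> down_labels D Y" "j \<in> down_labels D Y" "k \<in> down_labels D Y"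
    "i \<noteq> j" "k \<noteq> i" "k \<noteq> j" and L: "Y - {i} \<in> L" "Y - {j} \<in> L"
  shows "Y - {k} \<in> L"
proof -
  obtain X p q where b: "black_pair D X p q" "Y = insert p (insert q X)" using colens[OF Y ij] .
  show ?thesis
    by (rule lens_sides[OF b(1), folded b(2)]; use ij L down_order labelsD(3) in \<open>metis order_antisym\<close>)
qed

lemma colens_right:
  assumes Y: "Y \<notin> D" and ij: "i \<in> down_labels D Y" "j \<in> down_labels D Y" "k \<in> down_labels D Y"
    "i \<noteq> j" "k \<noteq> i" "k \<noteq> j" and R: "Y - {i} \<in> R" "Y - {j} \<in> R"
  shows "Y - {k} \<in> R"
proof -
  obtain X p q where b: "black_pair D X p q" "Y = insert p (insert q X)" using colens[OF Y ij] .
  show ?thesis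
    by (rule lens_sides[OF b(1), folded b(2)]; use ij R down_order labelsD(3) in \<open>metis order_antisym\<close>)
qed

end

section \<open>The inductive step for each of the structural statements\<close>

context deletion
begin

lemma up_leftI: "q \<in> up_labels D A \<Longrightarrow> insert q A \<in> L \<Longrightarrow> q \<in> up_labels C A"
  unfolding up_labels_def left_part_def by auto

lemma down_leftI: "q \<in> down_labels D A \<Longrightarrow> A - {q} \<in> L \<Longrightarrow> q \<in> down_labels C A"
  unfolding down_labels_def left_part_def by auto

lemma N_up: "A \<in> R \<Longrightarrow> N \<in> up_labels C A"
  unfolding up_labels_def right_part_def by auto

lemma up_less: "q \<in> up_labels D A \<Longrightarrow> q < N"
  using labels_less labelsD(2) by blast

lemma down_less: "A \<in> D \<Longrightarrow> q \<in> A \<Longrightarrow> q < N"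
  using memD(1) by fastforce

lemma split_N:
  obtains "N \<notin> A" | A' where "A = insert N A'" "N \<notin> A'"
  by (metis Set.set_insert)

lemma lens_of_inner:
  assumes A: "A \<in> D" "A \<noteq> {}" "down_labels D A = {}"
  obtains l i j p q where "l \<in> A" "i \<in> up_labels D (A - {l})" "j \<in> up_labels D (A - {l})" "i < l" "l < j"
    "black_pair D (A - {l}) p q" "l \<in> up_labels D (A - {l})" "insert l (A - {l}) = A" "p < l" "l < q"
proof -
  obtain l i j where l: "l \<in> A" "i \<in> up_labels D (A - {l})" "j \<in> up_labels D (A - {l})" "i < l" "l < j"
    using inner[OF A] by blast
  let ?Q = "up_labels D (A - {l})"
  have lQ: "l \<in> ?Q" "insert l (A - {l}) = A" unfolding up_labels_def using A(1) l(1) by (auto simp: insert_absorb)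
  have "A - {l} \<notin> D" using A(3) l(1) unfolding down_labels_def by blast
  then have b: "black_pair D (A - {l}) (Min ?Q) (Max ?Q)"
    unfolding black_pair_def using lens_labels_MinMax[OF finite_labels(1) l(2) lQ(1) l(3-5)] by blast
  have "Min ?Q < l" using Min_le[OF finite_labels(1) l(2)] l(4) by (rule le_less_trans)
  moreover have "l < Max ?Q" using l(5) Max_ge[OF finite_labels(1) l(3)] by (rule less_le_trans)
  ultimately show ?thesis using that[OF l b lQ] by blast
qed

text \<open>A common set is never an inner vertex of a lens, so it has a lower neighbour. The
  witness deletes the smallest down-label \<open>k\<close>. If the result were left only, every
  alternative of \<open>strip\<close> would fail: a larger up-label violates
  \<open>up_order\<close>, a smaller down-label violates minimality, and a final interval is a right
  set.\<close>

lemma mid_has_lower: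
  assumes A: "A \<in> L" "A \<in> R" "A \<noteq> {}"
  obtains k where "k \<in> A" "A - {k} \<in> R"
proof -
  have AD: "A \<in> D" using A by blast
  have ne: "down_labels D A \<noteq> {}"
  proof
    assume e: "down_labels D A = {}"
    obtain l p q where "black_pair D (A - {l}) p q" "l \<in> up_labels D (A - {l})" "insert l (A - {l}) = A" "p < l" "l < q"
      by (rule lens_of_inner[OF AD A(3) e])
    then show False using lens_inner_strict A by metis
  qed
  define k where "k = Min (down_labels D A)"
  have kd: "k \<in> down_labels D A" unfolding k_def using Min_in[OF finite_labels(2) ne] .
  have k: "k \<in> A" "A - {k} \<in> D" using labelsD(3)[OF kd] labelsD(4)[OF kd] .
  have ik: "insert k (A - {k}) = A" using k by blast
  have "A - {k} \<in> R"
  proof (rule ccontr)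
    assume nR: "A - {k} \<notin> R"
    have "k \<in> up_labels D (A - {k})" unfolding up_labels_def using ik AD by simp
    from strip[OF k(2) this, unfolded ik] consider
      r where "r \<in> up_labels D (A - {k})" "k < r" | r where "r \<in> down_labels D A" "r < k"
      | "A - {k} = {Suc k..m}" by blast
    then show False
    proof cases
      case 1
      have r: "r \<notin> A - {k}" "insert r (A - {k}) \<in> D" using labelsD(1)[OF 1(1)] labelsD(2)[OF 1(1)] .
      have "insert r (A - {k}) \<in> L" using no_gap[OF k(2) r(2,1)] nR by blast
      then have "r \<le> k" by (rule up_order) (use ik A r in auto)
      with 1 show False by simp
    next
      case 2
      have "k \<le> r" unfolding k_def using Min_le[OF finite_labels(2) 2(1)] .
      with 2 show False by simp
    next
      case 3
      have "k \<le> m" using down_less[OF AD k(1)] by simp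
      then show False using final_right[of k] 3 nR by simp
    qed
  qed
  with k that show ?thesis by blast
qed

text \<open>A neighbour known for \<open>D\<close> must lie on the side on which the edge occurs in
  \<open>C\<close>; this follows from \<open>no_gap\<close>, the orders of labels and
  \<open>white_sides\<close>. A left edge that starts at a common set has the up-label
  \<open>N\<close> as neighbour, and an edge labelled \<open>N\<close> gets one from
  \<open>mid_has_lower\<close>.\<close>

lemma strip_C:
  assumes A: "A \<in> C" and q: "q \<in> up_labels C A"
  shows "(\<exists>r\<in>up_labels C A. q < r) \<or> (\<exists>r\<in>down_labels C (insert q A). r < q) \<or> A = {Suc q..N}"
proof (cases rule: split_N[of A])
  case 1
  then have AL: "A \<in> L" using A mem_left by blast
  show ?thesis
  proof (cases "q = N")
    case True
    then have AR: "A \<in> R" using q up_left[OF 1] by auto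
    show ?thesis
    proof (cases "A = {}")
      case True
      \<comment> \<open>For the empty set the edge labelled \<open>N\<close> is a boundary edge,
        because \<open>{Suc N..N}\<close> is empty.\<close>
      then show ?thesis using \<open>q = N\<close> by auto
    next
      case False
      then obtain k where k: "k \<in> A" "A - {k} \<in> R" using mid_has_lower[OF AL AR] by blast
      have "k < N" using down_less AL k by blast
      moreover have "k \<in> down_labels C (insert N A)" using down_right[OF 1] k \<open>k < N\<close> by auto
      ultimately show ?thesis using True by blast
    qed
  next
    case False
    then have qA: "q \<notin> A" "insert q A \<in> L" using q up_left[OF 1] by auto
    show ?thesis
    proof (cases "A \<in> R")
      case True
      then show ?thesis using N_up labels_less[of q A] qA by blast
    next
      case nR: False
      have AD: "A \<in> D" and BD: "insert q A \<in> D" using AL qA by auto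
      have qD: "q \<in> up_labels D A" unfolding up_labels_def using qA by auto
      from strip[OF AD qD] consider
        r where "r \<in> up_labels D A" "q < r" | r where "r \<in> down_labels D (insert q A)" "r < q"
        | "A = {Suc q..m}" by blast
      then show ?thesis
      proof cases
        case 1
        have "insert r A \<in> L" using no_gap[OF AD labelsD(2)[OF 1(1)] labelsD(1)[OF 1(1)]] nR by blast
        then show ?thesis using up_leftI[OF 1(1)] 1(2) by blast
      next
        case 2
        have qd: "q \<in> down_labels D (insert q A)" unfolding down_labels_def using qA AD by simp
        \<comment> \<open>Passing from an arbitrary smaller down-label to the adjacent one produces
          a white tile, to which \<open>white_sides\<close> applies.\<close>
        obtain s where s: "adjacent (down_labels D (insert q A)) s q"
          by (rule ex_adjacent_below[OF finite_labels(2) qd 2])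
        have sd: "s \<in> down_labels D (insert q A)" "s < q" using s unfolding adjacent_def by auto
        have sA: "s \<in> A" using labelsD(3)[OF sd(1)] sd(2) by auto
        have "co_white_pair D (insert q A) s q" unfolding co_white_pair_def using s BD by blast
        then have w: "white_pair D (insert q A - {s, q}) s q" by (rule co_white_imp_white)
        have e: "insert s (insert q A - {s, q}) = A" "insert q (insert q A - {s, q}) = insert q A - {s}"
          using sA qA sd(2) by auto
        have "insert q A - {s} \<in> L" using white_sides[OF w] nR unfolding e by blast
        then show ?thesis using down_leftI[OF sd(1)] sd(2) by blast
      next
        case 3
        have "q \<le> m" using labels_less[of q A] BD by auto
        then show ?thesis using final_right[of q] 3 nR by simp
      qed
    qed
  qed
next
  case (2 A')
  then have AR: "A' \<in> R" using A mem_right by blast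
  have qA: "q \<noteq> N" "q \<notin> A'" "insert q A' \<in> R" using q up_right[OF 2(2)] 2(1) by auto
  have AD: "A' \<in> D" and BD: "insert q A' \<in> D" using AR qA by auto
  have qD: "q \<in> up_labels D A'" unfolding up_labels_def using qA by auto
  have iq: "insert q A = insert N (insert q A')" using 2 by auto
  have Nq: "N \<notin> insert q A'" using memD(2)[OF BD] .
  from strip[OF AD qD] consider
    r where "r \<in> up_labels D A'" "q < r" | r where "r \<in> down_labels D (insert q A')" "r < q"
    | "A' = {Suc q..m}" by blast
  then show ?thesis
  proof cases
    case 1
    have r: "r \<notin> A'" "insert r A' \<in> D" using labelsD(1)[OF 1(1)] labelsD(2)[OF 1(1)] .
    have "insert r A' \<notin> L" using up_order[of r A' q] qA r 1(2) by auto
    then have "insert r A' \<in> R" using r by blast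
    then have "r \<in> up_labels C A" using up_right[OF 2(2)] 2(1) r labels_less[OF r(2)] by auto
    then show ?thesis using 1(2) by blast
  next
    case (2 r)
    have r: "r \<in> insert q A'" "insert q A' - {r} \<in> D" using labelsD(3)[OF 2(1)] labelsD(4)[OF 2(1)] .
    have "insert q A' - {q} \<in> R" using qA AR by simp
    then have "insert q A' - {r} \<notin> L" using down_order[of "insert q A'" r q] r 2(2) by auto
    then have "insert q A' - {r} \<in> R" using r by blast
    then have "r \<in> down_labels C (insert q A)"
      unfolding iq using down_right[OF Nq] r down_less[OF BD r(1)] by auto
    then show ?thesis using 2(2) by blast
  next
    case 3
    have "q \<le> m" using labels_less[OF BD] by simp
    then have "insert N {Suc q..m} = {Suc q..N}" by auto
    then show ?thesis using 3 2(1) by simp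
  qed
qed

text \<open>For \<open>X\<close> without \<open>N\<close>, the labels in \<open>C\<close> are those
  that lead to left sets, plus \<open>N\<close> if \<open>X\<close> is a right set. So a white pair
  is either inherited from a tile on the left, or it is \<open>(i, N)\<close> and new. If
  \<open>N\<close> is in \<open>X\<close>, all labels lead to right sets and the pair is
  inherited.\<close>

lemma white_C:
  assumes w: "white_pair C X i j"
  defines "Y \<equiv> insert i (insert j X)"
  shows "Y \<in> C \<or> (\<exists>k\<in>down_labels C Y. k \<noteq> i \<and> k \<noteq> j)"
proof (cases rule: split_N[of X])
  case 1
  have a: "i \<in> up_labels C X" "j \<in> up_labels C X" "i < j" "\<And>k. k \<in> up_labels C X \<Longrightarrow> \<not> (i < k \<and> k < j)"
    using w unfolding white_pair_def adjacent_def by auto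
  have iN: "i \<noteq> N"
  proof
    assume "i = N"
    then have "j \<noteq> N" using a by simp
    then have "insert j X \<in> L" using a(2) up_left[OF 1] by auto
    then show False using labels_less[of j X] a(3) \<open>i = N\<close> by auto
  qed
  have i: "i \<notin> X" "insert i X \<in> L" using a(1) up_left[OF 1] iN by auto
  have iD: "i \<in> up_labels D X" unfolding up_labels_def using i by auto
  show ?thesis
  proof (cases "j = N")
    case False
    then have j: "j \<notin> X" "insert j X \<in> L" using a(2) up_left[OF 1] by auto
    have jD: "j \<in> up_labels D X" unfolding up_labels_def using j by auto
    have "\<not> (i < k \<and> k < j)" if "k \<in> up_labels D X" for k
    proof
      assume ik: "i < k \<and> k < j"
      have k: "k \<notin> X" "insert k X \<in> D" using labelsD(1)[OF that] labelsD(2)[OF that] .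
      have "insert k X \<notin> R" using up_order[OF j(2) _ j(1) k(1)] ik by auto
      then have "k \<in> up_labels C X" using up_leftI[OF that] k by blast
      then show False using a(4) ik by blast
    qed
    then have ad: "adjacent (up_labels D X) i j" unfolding adjacent_def using iD jD a(3) by blast
    have "X \<in> D \<or> (\<exists>k\<in>up_labels D X. k \<noteq> i \<and> k \<noteq> j)"
    proof -
      consider "X \<in> C" | k where "k \<in> up_labels C X" "k \<noteq> i" "k \<noteq> j" using w unfolding white_pair_def by blast
      then show ?thesis
      proof cases
        case 1 then show ?thesis using mem_left[OF \<open>N \<notin> X\<close>] by blast
      next
        case (2 k) then show ?thesis using up_left[OF 1, of k] unfolding up_labels_def by (auto split: if_splits)
      qed
    qed
    then have "white_pair D X i j" unfolding white_pair_def using ad by blast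
    then have cw: "co_white_pair D Y i j" unfolding Y_def by (rule white_imp_co_white)
    have NY: "N \<notin> Y" unfolding Y_def using 1 False iN by auto
    have Yij: "Y - {i} = insert j X" "Y - {j} = insert i X" unfolding Y_def using i j a(3) by auto
    show ?thesis
    proof (cases "Y \<in> D")
      case True
      \<comment> \<open>If the top were right only, \<open>no_gap\<close> along both upper edges
        would make both middle vertices right sets, against \<open>up_order\<close>.\<close>
      have "Y \<in> L"
      proof (rule ccontr)
        assume nL: "Y \<notin> L"
        have "insert i X \<in> R"
          using no_gap[of "insert i X" j] i j True nL a(3) unfolding Y_def by (auto simp: insert_commute)
        moreover have "insert j X \<in> R"
          using no_gap[of "insert j X" i] i j True nL a(3) unfolding Y_def by auto
        ultimately show False using up_order[OF j(2) _ j(1) i(1)] a(3) by auto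
      qed
      then show ?thesis using mem_left[OF NY] by blast
    next
      case nY: False
      then obtain k where k: "k \<in> down_labels D Y" "k \<noteq> i" "k \<noteq> j" and
        ij: "i \<in> down_labels D Y" "j \<in> down_labels D Y"
        using cw unfolding co_white_pair_def adjacent_def by blast
      have "Y - {k} \<in> L" by (rule colens_left[OF nY ij k(1)]) (use a(3) k i j Yij in auto)
      then show ?thesis using down_leftI[OF k(1)] k by blast
    qed
  next
    case True
    then have XR: "X \<in> R" using a(2) up_left[OF 1] by auto
    have XD: "X \<in> D" and XiD: "insert i X \<in> D" using XR i by auto
    have Y: "Y = insert N (insert i X)" unfolding Y_def True by auto
    have NX: "N \<notin> insert i X" using 1 iN by auto
    show ?thesis
    proof (cases "insert i X \<in> R")
      case True
      then show ?thesis using mem_right[OF NX] Y by blast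
    next
      case nR: False
      \<comment> \<open>\<open>X\<close> is a right set and \<open>insert i X\<close> is left only.
        An up-label above \<open>i\<close> would produce a label between \<open>i\<close> and
        \<open>N\<close>; a down-label below \<open>i\<close> leads to a right set and is the
        required third label; a final interval would be a right set.\<close>
      from strip[OF XD iD] consider
        r where "r \<in> up_labels D X" "i < r" | r where "r \<in> down_labels D (insert i X)" "r < i"
        | "X = {Suc i..m}" by blast
      then show ?thesis
      proof cases
        case 1
        obtain s where s: "adjacent (up_labels D X) i s"
          by (rule ex_adjacent_above[OF finite_labels(1) iD 1])
        have "white_pair D X i s" unfolding white_pair_def using s XD by blast
        then have "insert s X \<in> L" using white_sides nR by blast
        moreover have sD: "s \<in> up_labels D X" "i < s" using s unfolding adjacent_def by auto
        ultimately have "s \<in> up_labels C X" using up_leftI by blast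
        then show ?thesis using a(4) sD up_less[OF sD(1)] True by blast
      next
        case 2
        have r: "r \<in> insert i X" "insert i X - {r} \<in> D" using labelsD(3)[OF 2(1)] labelsD(4)[OF 2(1)] .
        have "insert i X - {i} \<in> R" using i XR by simp
        then have "insert i X - {r} \<notin> L" using down_order[of "insert i X" r i] r 2(2) by auto
        then have "insert i X - {r} \<in> R" using r by blast
        then have "r \<in> down_labels C Y"
          unfolding Y using down_right[OF NX] r down_less[OF XiD r(1)] by auto
        moreover have "r \<noteq> i" "r \<noteq> j" using 2(2) a(3) by auto
        ultimately show ?thesis by blast
      next
        case 3
        have "i \<in> {1..m}" using memD(1)[OF XiD] by blast
        then have "insert i X = {Suc (i - 1)..m}" using 3 by auto
        moreover have "i - 1 \<le> m" using \<open>i \<in> {1..m}\<close> by auto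
        ultimately show ?thesis using final_right[of "i - 1"] nR by metis
      qed
    qed
  qed
next
  case (2 X')
  have a: "i \<in> up_labels C X" "j \<in> up_labels C X" "i < j" "\<And>k. k \<in> up_labels C X \<Longrightarrow> \<not> (i < k \<and> k < j)"
    using w unfolding white_pair_def adjacent_def by auto
  have i: "i \<noteq> N" "i \<notin> X'" "insert i X' \<in> R" and j: "j \<noteq> N" "j \<notin> X'" "insert j X' \<in> R"
    using a(1,2) up_right[OF 2(2)] 2(1) by auto
  define Y' where "Y' = insert i (insert j X')"
  have Y: "Y = insert N Y'" unfolding Y_def Y'_def 2(1) by auto
  have NY: "N \<notin> Y'" unfolding Y'_def using 2(2) i j by auto
  have "\<not> (i < k \<and> k < j)" if "k \<in> up_labels D X'" for k
  proof
    assume ik: "i < k \<and> k < j"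
    have k: "k \<notin> X'" "insert k X' \<in> D" using labelsD(1)[OF that] labelsD(2)[OF that] .
    have "insert k X' \<notin> L" using up_order[OF _ i(3) k(1) i(2)] ik by auto
    then have "k \<in> up_labels C X" using up_right[OF 2(2)] 2(1) k labels_less[OF k(2)] by auto
    then show False using a(4) ik by blast
  qed
  then have ad: "adjacent (up_labels D X') i j" unfolding adjacent_def up_labels_def using i j a(3) by blast
  have "X' \<in> D \<or> (\<exists>k\<in>up_labels D X'. k \<noteq> i \<and> k \<noteq> j)"
  proof -
    consider "X \<in> C" | k where "k \<in> up_labels C X" "k \<noteq> i" "k \<noteq> j" using w unfolding white_pair_def by blast
    then show ?thesis
    proof cases
      case 1 then show ?thesis using mem_right[OF 2(2)] 2(1) by blast
    next
      case (2 k) then show ?thesis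
        using up_right[OF \<open>N \<notin> X'\<close>, of k] \<open>X = insert N X'\<close> unfolding up_labels_def by auto
    qed
  qed
  then have "white_pair D X' i j" unfolding white_pair_def using ad by blast
  then have cw: "co_white_pair D Y' i j" unfolding Y'_def by (rule white_imp_co_white)
  have Yij: "Y' - {i} = insert j X'" "Y' - {j} = insert i X'" unfolding Y'_def using i j a(3) by auto
  consider "Y' \<in> R" | "Y' \<in> L" | "Y' \<notin> D" by blast
  then show ?thesis
  proof cases
    case 1
    then show ?thesis using mem_right[OF NY] Y by blast
  next
    case 2
    then have "N \<in> down_labels C Y" unfolding Y using down_right[OF NY] by auto
    then show ?thesis using i(1) j(1) by metis
  next
    case 3
    then obtain k where k: "k \<in> down_labels D Y'" "k \<noteq> i" "k \<noteq> j" and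
      ij: "i \<in> down_labels D Y'" "j \<in> down_labels D Y'"
      using cw unfolding co_white_pair_def adjacent_def by blast
    have "Y' - {k} \<in> R" by (rule colens_right[OF 3 ij k(1)]) (use a(3) k i j Yij in auto)
    then have "k \<in> down_labels C Y"
      unfolding Y using down_right[OF NY] labelsD(3)[OF k(1)] NY by auto
    then show ?thesis using k by blast
  qed
qed

end

context deletion
begin

text \<open>A lens of \<open>C\<close> is either a lens of \<open>D\<close> that lies entirely on
  one side, so that it keeps all its labels, or it is new. A new one has \<open>j = N\<close> and
  stands on a set that is right only; its inner down-label comes from the tile to the left of the
  edge labelled \<open>i\<close>.\<close>

lemma black_C:
  assumes b: "black_pair C X i j"
  defines "Y \<equiv> insert i (insert j X)"
  shows "\<exists>k\<in>down_labels C Y. i < k \<and> k < j"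
proof -
  obtain l where l: "l \<in> up_labels C X" "i < l" "l < j"
    using b unfolding black_pair_def lens_labels_def by blast
  have ij: "i \<in> up_labels C X" "j \<in> up_labels C X" "\<And>q. q \<in> up_labels C X \<Longrightarrow> i \<le> q \<and> q \<le> j"
    and XC: "X \<notin> C"
    using b unfolding black_pair_def lens_labels_def by auto
  show ?thesis
  proof (cases rule: split_N[of X])
    case 1
    then have nL: "X \<notin> L" using XC mem_left by blast
    show ?thesis
    proof (cases "X \<in> R")
      case False
      have sub1: "q \<in> up_labels D X \<and> insert q X \<in> L" if "q \<in> up_labels C X" for q
        using that up_left[OF 1, of q] False unfolding up_labels_def by (auto split: if_splits)
      let ?Q = "up_labels D X"
      have bD: "black_pair D X (Min ?Q) (Max ?Q)"
        unfolding black_pair_def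
        using lens_labels_MinMax[OF finite_labels(1), of i X l j] sub1[OF ij(1)] sub1[OF ij(2)] sub1[OF l(1)] l nL False
        by blast
      have all: "q \<in> up_labels C X" if "q \<in> ?Q" for q
        using lens_left(1)[OF bD, of i l q] sub1[OF ij(1)] sub1[OF l(1)] l(2) up_leftI[OF that] that by auto
      then have Q: "?Q = up_labels C X" using sub1 by blast
      have "Min ?Q = i" "Max ?Q = j" unfolding Q
        by (rule Min_eqI Max_eqI; use ij finite_labels(1)[of X, unfolded Q] in auto)+
      with bD have bD: "black_pair D X i j" by simp
      obtain k where k: "k \<in> down_labels D Y" "i < k" "k < j" using black[OF bD] unfolding Y_def by blast
      have "Y - {k} \<in> L"
        using lens_left(2)[OF bD, of i l k] sub1[OF ij(1)] sub1[OF l(1)] l(2) k(1) unfolding Y_def by auto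
      then show ?thesis using down_leftI[OF k(1)] k by blast
    next
      case True
      have XD: "X \<in> D" using True by blast
      \<comment> \<open>As \<open>X\<close> is a right set, \<open>N\<close> is one of its labels in
        \<open>C\<close>, and all other labels are smaller.\<close>
      have "N \<le> j" using ij(3)[OF N_up[OF True]] by simp
      moreover have "j < N" if "j \<noteq> N" using that ij(2) up_left[OF 1, of j] labels_less[of j X] by auto
      ultimately have jN: "j = N" by (meson not_less)
      have i: "i \<notin> X" "insert i X \<in> L" using ij(1) up_left[OF 1, of i] l jN by auto
      have iD: "i \<in> up_labels D X" unfolding up_labels_def using i by auto
      have XiD: "insert i X \<in> D" using i by blast
      have Y: "Y = insert N (insert i X)" unfolding Y_def jN by auto
      have NX: "N \<notin> insert i X" using memD(2)[OF XiD] .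
      from strip'[OF XD iD] consider
        r where "r \<in> up_labels D X" "r < i" | r where "r \<in> down_labels D (insert i X)" "i < r"
        | "X = {1..<i}" by blast
      then show ?thesis
      proof cases
        case 1
        have r: "r \<notin> X" "insert r X \<in> D" using labelsD(1)[OF 1(1)] labelsD(2)[OF 1(1)] .
        have "insert r X \<notin> R" using up_order[OF i(2) _ i(1) r(1)] 1(2) by auto
        then have "r \<in> up_labels C X" using up_leftI[OF 1(1)] r by blast
        then show ?thesis using ij(3)[of r] 1(2) by simp
      next
        case 2
        have id: "i \<in> down_labels D (insert i X)" unfolding down_labels_def using i XD by simp
        obtain s where s: "adjacent (down_labels D (insert i X)) i s"
          by (rule ex_adjacent_above[OF finite_labels(2) id 2])
        have sd: "s \<in> down_labels D (insert i X)" "i < s" using s unfolding adjacent_def by auto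
        have sX: "s \<in> X" using labelsD(3)[OF sd(1)] sd(2) by auto
        have "co_white_pair D (insert i X) i s" unfolding co_white_pair_def using s XiD by blast
        then have w: "white_pair D (insert i X - {i, s}) i s" by (rule co_white_imp_white)
        have e: "insert i (insert i X - {i, s}) = insert i X - {s}" "insert s (insert i X - {i, s}) = X"
          using sX i sd(2) by auto
        have "insert i X - {s} \<in> R" using white_sides[OF w] nL unfolding e by blast
        then have "s \<in> down_labels C Y"
          unfolding Y using down_right[OF NX] sX down_less[OF XD sX] by auto
        then show ?thesis using sd(2) down_less[OF XD sX] jN by blast
      next
        case 3
        have "i \<in> {1..m}" using memD(1)[OF XiD] by blast
        then have "{1..<i} = {1..i - 1}" "i - 1 \<le> m" by auto
        then show ?thesis using initial_left[of "i - 1"] 3 nL by metis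
      qed
    qed
  next
    case (2 X')
    then have nR: "X' \<notin> R" using XC mem_right by blast
    have lab: "q \<noteq> N \<and> q \<notin> X' \<and> insert q X' \<in> R \<and> q \<in> up_labels D X'" if "q \<in> up_labels C X" for q
      using that up_right[OF 2(2), of q] 2(1) unfolding up_labels_def by auto
    \<comment> \<open>Otherwise \<open>no_gap\<close> makes every \<open>insert q X'\<close> common
      to both sides, and \<open>up_order\<close> admits only one such label.\<close>
    have nL: "X' \<notin> L"
    proof
      assume "X' \<in> L"
      then have "insert q X' \<in> L" if "q \<in> up_labels C X" for q
        using no_gap[of X' q] lab[OF that] nR by blast
      then have "j \<le> i" using up_order[of j X' i] lab[OF ij(1)] lab[OF ij(2)] ij by blast
      then show False using l by simp
    qed
    let ?Q = "up_labels D X'"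
    have bD: "black_pair D X' (Min ?Q) (Max ?Q)"
      unfolding black_pair_def
      using lens_labels_MinMax[OF finite_labels(1), of i X' l j] lab[OF ij(1)] lab[OF ij(2)] lab[OF l(1)] l nL nR
      by blast
    have all: "q \<in> up_labels C X" if "q \<in> ?Q" for q
    proof -
      have "insert q X' \<in> R" using lens_right(1)[OF bD, of i l q] lab[OF ij(1)] lab[OF l(1)] l(2) that by auto
      then show ?thesis using up_right[OF 2(2), of q] 2(1) labelsD(1)[OF that] up_less[OF that] by auto
    qed
    then have Q: "?Q = up_labels C X" using lab by blast
    have "Min ?Q = i" "Max ?Q = j" unfolding Q
      by (rule Min_eqI Max_eqI; use ij finite_labels(1)[of X', unfolded Q] in auto)+
    with bD have bD: "black_pair D X' i j" by simp
    define Y' where "Y' = insert i (insert j X')"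
    have Y: "Y = insert N Y'" unfolding Y_def Y'_def 2(1) by auto
    have NY: "N \<notin> Y'" unfolding Y'_def using 2(2) lab[OF ij(1)] lab[OF ij(2)] by auto
    obtain k where k: "k \<in> down_labels D Y'" "i < k" "k < j" using black[OF bD] unfolding Y'_def by blast
    have "Y' - {k} \<in> R"
      using lens_right(2)[OF bD, of i l k] lab[OF ij(1)] lab[OF l(1)] l(2) k(1) unfolding Y'_def by auto
    then have "k \<in> down_labels C Y"
      unfolding Y using down_right[OF NY] labelsD(3)[OF k(1)] NY by auto
    then show ?thesis using k by blast
  qed
qed

text \<open>If a left set loses all its lower neighbours because they are right only, deleting its
  largest down-label \<open>l\<close> leads to a set with the label \<open>N\<close> above
  \<open>l\<close> and, by \<open>strip'\<close>, a left label below \<open>l\<close>. For right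
  sets \<open>no_gap\<close> excludes such a loss, and lenses of \<open>D\<close> are inherited on
  their side.\<close>

lemma inner_C:
  assumes A: "A \<in> C" "A \<noteq> {}" "down_labels C A = {}"
  shows "\<exists>l\<in>A. \<exists>i\<in>up_labels C (A - {l}). \<exists>j\<in>up_labels C (A - {l}). i < l \<and> l < j"
proof (cases rule: split_N[of A])
  case 1
  then have AL: "A \<in> L" using A mem_left by blast
  then have AD: "A \<in> D" by blast
  show ?thesis
  proof (cases "down_labels D A = {}")
    case True
    obtain l i j p q where l: "l \<in> A" "i \<in> up_labels D (A - {l})" "j \<in> up_labels D (A - {l})" "i < l" "l < j"
      and b: "black_pair D (A - {l}) p q" and lq: "l \<in> up_labels D (A - {l})" "insert l (A - {l}) = A" "p < l" "l < q"
      using lens_of_inner[OF AD A(2) True] .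
    have nR: "A \<notin> R" using lens_inner_strict[OF b lq(1,3,4)] lq(2) AL by simp
    have allL: "insert r (A - {l}) \<in> L" if "r \<in> up_labels D (A - {l})" for r
      by (rule lens_sides[OF b]) (use that lq nR in \<open>metis\<close>)+
    show ?thesis using l up_leftI[OF l(2) allL[OF l(2)]] up_leftI[OF l(3) allL[OF l(3)]] by blast
  next
    case False
    define l where "l = Max (down_labels D A)"
    have ld: "l \<in> down_labels D A" unfolding l_def using Max_in[OF finite_labels(2) False] .
    have lA: "l \<in> A" "A - {l} \<in> D" using labelsD(3)[OF ld] labelsD(4)[OF ld] .
    have nL: "A - {l} \<notin> L" using A(3) down_leftI[OF ld] by blast
    then have XR: "A - {l} \<in> R" using lA by blast
    have il: "insert l (A - {l}) = A" using lA by blast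
    have lu: "l \<in> up_labels D (A - {l})" unfolding up_labels_def using il AD by simp
    from strip'[OF lA(2) lu, unfolded il] consider
      r where "r \<in> up_labels D (A - {l})" "r < l" | r where "r \<in> down_labels D A" "l < r"
      | "A - {l} = {1..<l}" by blast
    then show ?thesis
    proof cases
      case 1
      have r: "r \<notin> A - {l}" "insert r (A - {l}) \<in> D" using labelsD(1)[OF 1(1)] labelsD(2)[OF 1(1)] .
      have "insert r (A - {l}) \<notin> R" using up_order[of l "A - {l}" r] il AL r 1(2) by auto
      then have "r \<in> up_labels C (A - {l})" using up_leftI[OF 1(1)] r by blast
      then show ?thesis using N_up[OF XR] 1(2) lA(1) down_less[OF AD lA(1)] by blast
    next
      case 2
      have "r \<le> l" unfolding l_def using Max_ge[OF finite_labels(2) 2(1)] .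
      with 2 show ?thesis by simp
    next
      case 3
      have "l \<in> {1..m}" using memD(1)[OF AD] lA by blast
      then have "{1..<l} = {1..l - 1}" "l - 1 \<le> m" by auto
      then show ?thesis using initial_left[of "l - 1"] 3 nL by metis
    qed
  qed
next
  case (2 A')
  then have AR: "A' \<in> R" using A mem_right by blast
  then have AD: "A' \<in> D" by blast
  have nL: "A' \<notin> L" using A(3) down_right[OF 2(2), of N] 2(1) by auto
  have ne: "A' \<noteq> {}" using initial_left[of 0] nL by auto
  show ?thesis
  proof (cases "down_labels D A' = {}")
    case True
    obtain l i j p q where l: "l \<in> A'" "i \<in> up_labels D (A' - {l})" "j \<in> up_labels D (A' - {l})" "i < l" "l < j"
      and b: "black_pair D (A' - {l}) p q" and lq: "l \<in> up_labels D (A' - {l})" "insert l (A' - {l}) = A'" "p < l" "l < q"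
      using lens_of_inner[OF AD ne True] .
    have allR: "insert r (A' - {l}) \<in> R" if "r \<in> up_labels D (A' - {l})" for r
      by (rule lens_sides[OF b]) (use that lq nL in \<open>metis\<close>)+
    have e: "A - {l} = insert N (A' - {l})" using 2 l(1) by auto
    have "r \<in> up_labels C (A - {l})" if "r \<in> up_labels D (A' - {l})" for r
      unfolding e using up_right[of "A' - {l}" r] 2(2) allR[OF that] labelsD(1)[OF that] up_less[OF that] by auto
    then show ?thesis using l 2(1) by blast
  next
    case False
    then obtain k where k: "k \<in> down_labels D A'" by blast
    have kA: "k \<in> A'" "A' - {k} \<in> D" using labelsD(3)[OF k] labelsD(4)[OF k] .
    have "A' - {k} \<notin> R"
    proof
      assume "A' - {k} \<in> R"
      then have "k \<in> down_labels C A" using down_right[OF 2(2), of k] 2 kA by auto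
      then show False using A(3) by blast
    qed
    moreover have "insert k (A' - {k}) = A'" using kA by blast
    ultimately have "A' \<in> L" using no_gap[OF kA(2), of k] AD by auto
    then show ?thesis using nL by blast
  qed
qed

text \<open>If \<open>X\<close> stripped of \<open>N\<close> is a member of \<open>D\<close> on the
  other side only, \<open>no_gap\<close> puts the neighbours under consideration on both sides, and
  \<open>down_order\<close> or \<open>up_order\<close> then identifies their labels. Otherwise the
  statement is inherited.\<close>

lemma terminal_C:
  assumes X: "X \<notin> C" and ij: "i \<in> up_labels C X" "j \<in> up_labels C X" "i \<noteq> j"
    and kl: "k \<in> down_labels C X" "l \<in> down_labels C X"
  shows "k = l"
proof (cases rule: split_N[of X])
  case 1
  then have nL: "X \<notin> L" using X mem_left by blast
  have k: "k \<in> X" "X - {k} \<in> L" and l: "l \<in> X" "X - {l} \<in> L" using kl down_left[OF 1] by auto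
  show ?thesis
  proof (cases "X \<in> R")
    case True
    have "X - {p} \<in> R" if "p \<in> X" "X - {p} \<in> L" for p
    proof -
      have "insert p (X - {p}) = X" using that by blast
      then show ?thesis using no_gap[of "X - {p}" p] that True nL by auto
    qed
    then have "X - {k} \<in> R" "X - {l} \<in> R" using k l by auto
    then have "l \<le> k" "k \<le> l" using down_order[of X k l] down_order[of X l k] k l by auto
    then show ?thesis by simp
  next
    case False
    have "i \<in> up_labels D X" "j \<in> up_labels D X"
      using ij up_left[OF 1] False unfolding up_labels_def by (auto split: if_splits)
    moreover have "k \<in> down_labels D X" "l \<in> down_labels D X" unfolding down_labels_def using k l by auto
    ultimately show ?thesis using terminal[of X i j k l] nL False ij(3) by blast
  qed
next
  case (2 X')
  then have nR: "X' \<notin> R" using X mem_right by blast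
  have i: "i \<notin> X'" "insert i X' \<in> R" and j: "j \<notin> X'" "insert j X' \<in> R" using ij up_right[OF 2(2)] 2(1) by auto
  show ?thesis
  proof (cases "X' \<in> L")
    case True
    have "insert i X' \<in> L" "insert j X' \<in> L" using no_gap[of X'] i j True nR by auto
    then have "i \<le> j" "j \<le> i" using up_order[of i X' j] up_order[of j X' i] i j by auto
    then show ?thesis using ij(3) by simp
  next
    case False
    have "k \<in> down_labels D X'" "l \<in> down_labels D X'"
      using kl down_right[OF 2(2)] 2(1) False unfolding down_labels_def by (auto split: if_splits)
    moreover have "i \<in> up_labels D X'" "j \<in> up_labels D X'" unfolding up_labels_def using i j by auto
    ultimately show ?thesis using terminal[of X' i j k l] False nR ij(3) by blast
  qed
qed

lemma half_structure_C: "half_structure N C"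
  by unfold_locales
    (fact maxC strip_C white_C black_C inner_C terminal_C | rule strip_C white_C black_C inner_C terminal_C; assumption)+

end

lemma half_structure: "max_ws_collection n C \<Longrightarrow> half_structure n C"
proof (induction n arbitrary: C)
  case 0
  have "X = {}" if "X \<in> C" for X using ws_collection_subset[OF max_ws_collection_ws[OF 0] that] by auto
  then have u: "up_labels C X = {}" for X unfolding up_labels_def by blast
  show ?case
    by unfold_locales
      (use 0 in \<open>auto simp: u white_pair_def black_pair_def adjacent_def lens_labels_def \<open>\<And>X. X \<in> C \<Longrightarrow> X = {}\<close>\<close>)
next
  case (Suc m)
  have "full_structure m (left_part (Suc m) C \<union> right_part (Suc m) C)"
    by (rule full_structureI[OF Suc.IH max_ws_collection_parts(1)[OF Suc.prems]])
  then interpret deletion m C using Suc.prems by (intro deletion.intro)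
  show ?case by (rule half_structure_C)
qed

lemma full_structure: "max_ws_collection n C \<Longrightarrow> full_structure n C"
  by (rule full_structureI[OF half_structure])

section \<open>Tiles\<close>

lemma adjacent_unique:
  "adjacent Q i j \<Longrightarrow> adjacent Q i' j \<Longrightarrow> i = i'" "adjacent Q i j \<Longrightarrow> adjacent Q i j' \<Longrightarrow> j = j'"
  unfolding adjacent_def by (metis linorder_less_linear)+

lemma lens_labels_unique:
  "lens_labels Q i j \<Longrightarrow> lens_labels Q i' j' \<Longrightarrow> i = i' \<and> j = j'"
  unfolding lens_labels_def by (meson order_antisym)

lemma lens_labels_three:
  "finite Q \<Longrightarrow> (\<exists>i j. lens_labels Q i j) \<longleftrightarrow> (\<exists>i\<in>Q. \<exists>k\<in>Q. \<exists>j\<in>Q. i < k \<and> k < j)"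
proof
  assume "\<exists>i j. lens_labels Q i j"
  then show "\<exists>i\<in>Q. \<exists>k\<in>Q. \<exists>j\<in>Q. i < k \<and> k < j" unfolding lens_labels_def by blast
next
  assume f: "finite Q" and "\<exists>i\<in>Q. \<exists>k\<in>Q. \<exists>j\<in>Q. i < k \<and> k < j"
  then obtain i k j where "i \<in> Q" "k \<in> Q" "j \<in> Q" "i < k" "k < j" by blast
  then show "\<exists>i j. lens_labels Q i j" using lens_labels_MinMax[OF f] by blast
qed

lemma three_distinct:
  assumes "i \<in> Q" "j \<in> Q" "k \<in> Q" "i < j" "k \<noteq> i" "k \<noteq> (j :: nat)"
  shows "\<exists>i\<in>Q. \<exists>k\<in>Q. \<exists>j\<in>Q. i < k \<and> k < j"
proof -
  consider "k < i" | "i < k \<and> k < j" | "j < k" using assms by linarith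
  then show ?thesis by cases (use assms in blast)+
qed

lemma tile_eqI: "base s = base t \<Longrightarrow> lo s = lo t \<Longrightarrow> hi s = hi t \<Longrightarrow> s = t"
  by (cases s; cases t) simp

context full_structure
begin

definition white_tiles :: "tile set" where
  "white_tiles = {t. white_pair D (base t) (lo t) (hi t)}"

definition black_tiles :: "tile set" where
  "black_tiles = {t. black_pair D (base t) (lo t) (hi t)}"

abbreviation "tiles \<equiv> white_tiles \<union> black_tiles"

lemma finite_labels': "finite (up_labels D X)" "finite (down_labels D X)"
  using finite_up_labels[OF sub] finite_down_labels[OF sub] .

lemma white_tilesD:
  assumes "t \<in> white_tiles"
  shows "white_pair D (base t) (lo t) (hi t)" "co_white_pair D (top_v t) (lo t) (hi t)"
    "adjacent (up_labels D (base t)) (lo t) (hi t)" "adjacent (down_labels D (top_v t)) (lo t) (hi t)"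
proof -
  show w: "white_pair D (base t) (lo t) (hi t)" using assms unfolding white_tiles_def by blast
  show c: "co_white_pair D (top_v t) (lo t) (hi t)" unfolding top_v_def using white_imp_co_white[OF w] .
  show "adjacent (up_labels D (base t)) (lo t) (hi t)" "adjacent (down_labels D (top_v t)) (lo t) (hi t)"
    using w c unfolding white_pair_def co_white_pair_def by blast+
qed

lemma black_tilesD:
  assumes "t \<in> black_tiles"
  shows "base t \<notin> D" "top_v t \<notin> D"
    "lens_labels (up_labels D (base t)) (lo t) (hi t)" "lens_labels (down_labels D (top_v t)) (lo t) (hi t)"
proof -
  have b: "black_pair D (base t) (lo t) (hi t)" using assms unfolding black_tiles_def by blast
  moreover have c: "co_black_pair D (top_v t) (lo t) (hi t)" unfolding top_v_def using black_imp_co_black[OF b] .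
  ultimately show "base t \<notin> D" "top_v t \<notin> D"
    "lens_labels (up_labels D (base t)) (lo t) (hi t)" "lens_labels (down_labels D (top_v t)) (lo t) (hi t)"
    unfolding black_pair_def co_black_pair_def by blast+
qed

lemma tiles_labels:
  assumes "t \<in> tiles"
  shows "lo t \<in> up_labels D (base t)" "hi t \<in> up_labels D (base t)"
    "lo t \<in> down_labels D (top_v t)" "hi t \<in> down_labels D (top_v t)" "lo t < hi t"
  using assms white_tilesD(3,4)[of t] black_tilesD(3,4)[of t] unfolding adjacent_def lens_labels_def by auto

lemma tiles_simple:
  assumes "t \<in> tiles"
  shows "lo t \<notin> base t" "hi t \<notin> base t" "left_v t \<in> D" "right_v t \<in> D"
    "top_v t - {lo t} = right_v t" "top_v t - {hi t} = left_v t"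
proof -
  note l = tiles_labels[OF assms]
  show a: "lo t \<notin> base t" "hi t \<notin> base t" using l(1,2) labelsD(1) by blast+
  show "left_v t \<in> D" "right_v t \<in> D" unfolding left_v_def right_v_def using l(1,2) labelsD(2) by blast+
  show "top_v t - {lo t} = right_v t" "top_v t - {hi t} = left_v t"
    unfolding top_v_def right_v_def left_v_def using a l(5) by auto
qed

lemma tiles_is_tile: "t \<in> tiles \<Longrightarrow> is_tile n t"
proof -
  assume t: "t \<in> tiles"
  have "left_v t \<subseteq> {1..n}" "right_v t \<subseteq> {1..n}" using tiles_simple(3,4)[OF t] sub by blast+
  then show ?thesis unfolding is_tile_def left_v_def right_v_def
    using tiles_labels(5)[OF t] tiles_simple(1,2)[OF t] by auto
qed

lemma finite_tiles: "finite tiles"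
proof -
  have "tiles \<subseteq> (\<lambda>(X, i, j). Tile X i j) ` (Pow {1..n} \<times> {1..n} \<times> {1..n})"
  proof
    fix t assume "t \<in> tiles"
    then have "is_tile n t" by (rule tiles_is_tile)
    then have "(base t, lo t, hi t) \<in> Pow {1..n} \<times> {1..n} \<times> {1..n}" unfolding is_tile_def by auto
    then have "(\<lambda>(X, i, j). Tile X i j) (base t, lo t, hi t) \<in> (\<lambda>(X, i, j). Tile X i j) ` (Pow {1..n} \<times> {1..n} \<times> {1..n})"
      by (rule imageI)
    then show "t \<in> (\<lambda>(X, i, j). Tile X i j) ` (Pow {1..n} \<times> {1..n} \<times> {1..n})" by simp
  qed
  then show ?thesis by (rule finite_subset) simp
qed

lemma white_black_disjoint: "white_tiles \<inter> black_tiles = {}"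
proof -
  have False if "t \<in> white_tiles" "t \<in> black_tiles" for t
    using white_tilesD(3)[OF that(1)] black_tilesD(3)[OF that(2)] unfolding adjacent_def lens_labels_def by blast
  then show ?thesis by blast
qed

lemma white_tileI:
  "adjacent (up_labels D X) i j \<Longrightarrow> X \<in> D \<Longrightarrow> Tile X i j \<in> white_tiles"
  "adjacent (up_labels D X) i j \<Longrightarrow> k \<in> up_labels D X \<Longrightarrow> k \<noteq> i \<Longrightarrow> k \<noteq> j \<Longrightarrow> Tile X i j \<in> white_tiles"
  unfolding white_tiles_def white_pair_def by auto

lemma white_tile_topI:
  assumes "adjacent (down_labels D Y) i j" "Y \<in> D \<or> (\<exists>k\<in>down_labels D Y. k \<noteq> i \<and> k \<noteq> j)"
  shows "Tile (Y - {i, j}) i j \<in> white_tiles" "top_v (Tile (Y - {i, j}) i j) = Y"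
proof -
  have "co_white_pair D Y i j" using assms unfolding co_white_pair_def by blast
  from co_white_imp_white[OF this] show "Tile (Y - {i, j}) i j \<in> white_tiles" unfolding white_tiles_def by simp
  have "i \<in> Y" "j \<in> Y" using assms(1) labelsD(3) unfolding adjacent_def by blast+
  then show "top_v (Tile (Y - {i, j}) i j) = Y" unfolding top_v_def by auto
qed

lemma black_tileI: "X \<notin> D \<Longrightarrow> lens_labels (up_labels D X) i j \<Longrightarrow> Tile X i j \<in> black_tiles"
  unfolding black_tiles_def black_pair_def by auto

lemma black_tile_topI:
  assumes "Y \<notin> D" "lens_labels (down_labels D Y) i j"
  shows "Tile (Y - {i, j}) i j \<in> black_tiles" "top_v (Tile (Y - {i, j}) i j) = Y"
proof -
  have "co_black_pair D Y i j" using assms unfolding co_black_pair_def by blast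
  from co_black_imp_black[OF this] show "Tile (Y - {i, j}) i j \<in> black_tiles" unfolding black_tiles_def by simp
  have "i \<in> Y" "j \<in> Y" using assms(2) labelsD(3) unfolding lens_labels_def by blast+
  then show "top_v (Tile (Y - {i, j}) i j) = Y" unfolding top_v_def by auto
qed

text \<open>
  In the disc that the tiles form, black tiles are turned over; \<open>left_tile\<close> and \<open>right_tile\<close>
  refer to the sides of an edge in this disc, so for a black tile they are opposite to its
  position in the zonogon.
\<close>
definition left_tile :: "nat set \<Rightarrow> nat \<Rightarrow> tile \<Rightarrow> bool" where
  "left_tile Z q t \<longleftrightarrow>
     t \<in> white_tiles \<and> (base t = Z \<and> hi t = q \<or> top_v t = insert q Z \<and> lo t = q) \<or>
     t \<in> black_tiles \<and> (base t = Z \<and> lo t = q \<or> top_v t = insert q Z \<and> hi t = q)"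

definition right_tile :: "nat set \<Rightarrow> nat \<Rightarrow> tile \<Rightarrow> bool" where
  "right_tile Z q t \<longleftrightarrow>
     t \<in> white_tiles \<and> (base t = Z \<and> lo t = q \<or> top_v t = insert q Z \<and> hi t = q) \<or>
     t \<in> black_tiles \<and> (base t = Z \<and> hi t = q \<or> top_v t = insert q Z \<and> lo t = q)"

section \<open>The two tiles at an edge\<close>

lemma edgesE:
  assumes "t \<in> tiles" "e \<in> edges t"
  obtains Z q where "e = (Z, insert q Z)" "q \<notin> Z" "left_tile Z q t \<or> right_tile Z q t"
proof -
  note s = tiles_simple[OF assms(1)] tiles_labels(5)[OF assms(1)]
  have t: "left_v t = insert (lo t) (base t)" "right_v t = insert (hi t) (base t)"
    "top_v t = insert (hi t) (left_v t)" "top_v t = insert (lo t) (right_v t)"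
    "hi t \<notin> left_v t" "lo t \<notin> right_v t"
    using s unfolding left_v_def right_v_def top_v_def by auto
  consider "e = (base t, left_v t)" | "e = (base t, right_v t)" | "e = (left_v t, top_v t)" | "e = (right_v t, top_v t)"
    using assms(2) unfolding edges_def bot_v_def by blast
  then show ?thesis
  proof cases
    case 1
    then have "e = (base t, insert (lo t) (base t))" using t by simp
    then show ?thesis by (rule that) (use s assms(1) in \<open>auto simp: left_tile_def right_tile_def\<close>)
  next
    case 2
    then have "e = (base t, insert (hi t) (base t))" using t by simp
    then show ?thesis by (rule that) (use s assms(1) in \<open>auto simp: left_tile_def right_tile_def\<close>)
  next
    case 3
    then have "e = (left_v t, insert (hi t) (left_v t))" using t by simp
    then show ?thesis by (rule that) (use t assms(1) in \<open>auto simp: left_tile_def right_tile_def\<close>)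
  next
    case 4
    then have "e = (right_v t, insert (lo t) (right_v t))" using t by simp
    then show ?thesis by (rule that) (use t assms(1) in \<open>auto simp: left_tile_def right_tile_def\<close>)
  qed
qed

lemma side_cases:
  assumes "q \<notin> Z" "left_tile Z q t \<or> right_tile Z q t"
  shows "t \<in> tiles \<and> (base t = Z \<and> (q = lo t \<or> q = hi t) \<or> top_v t = insert q Z \<and> (q = lo t \<or> q = hi t))"
  using assms unfolding left_tile_def right_tile_def by blast

lemma side_edges:
  assumes q: "q \<notin> Z" and s: "left_tile Z q t \<or> right_tile Z q t"
  shows "(Z, insert q Z) \<in> edges t"
proof -
  have t: "t \<in> tiles" using side_cases[OF assms] by blast
  note ts = tiles_simple[OF t]
  consider "base t = Z" "q = lo t \<or> q = hi t" | "top_v t = insert q Z" "q = lo t \<or> q = hi t"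
    using side_cases[OF assms] by blast
  then show ?thesis
  proof cases
    case 1 then show ?thesis unfolding edges_def bot_v_def left_v_def right_v_def by auto
  next
    case 2
    then have "Z = top_v t - {q}" using q by auto
    then show ?thesis using 2 ts(5,6) unfolding edges_def by auto
  qed
qed

lemma side_edges_iff:
  assumes q: "q \<notin> Z" and t: "t \<in> tiles"
  shows "(Z, insert q Z) \<in> edges t \<longleftrightarrow> left_tile Z q t \<or> right_tile Z q t"
proof
  assume "(Z, insert q Z) \<in> edges t"
  then obtain q' where q': "insert q Z = insert q' Z" "q' \<notin> Z" "left_tile Z q' t \<or> right_tile Z q' t"
    by (rule edgesE[OF t]) auto
  then have "q' = q" using q by blast
  then show "left_tile Z q t \<or> right_tile Z q t" using q'(3) by simp
qed (rule side_edges[OF q])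

lemma side_labels:
  assumes q: "q \<notin> Z" and s: "left_tile Z q t \<or> right_tile Z q t"
  shows "base t = Z \<Longrightarrow> q \<in> up_labels D Z" "base t \<noteq> Z \<Longrightarrow> top_v t = insert q Z \<and> q \<in> down_labels D (insert q Z)"
  using side_cases[OF assms] tiles_labels[of t] by auto

lemma top_ne_insert_base:
  assumes "t \<in> tiles" "base t = Z" "q \<notin> Z" shows "top_v t \<noteq> insert q Z"
proof
  assume "top_v t = insert q Z"
  then have "{lo t, hi t} \<subseteq> insert q Z - Z"
    using tiles_simple(1,2)[OF assms(1)] assms(2) unfolding top_v_def by auto
  then have "lo t = q" "hi t = q" using assms(3) by auto
  then show False using tiles_labels(5)[OF assms(1)] by simp
qed

lemma not_left_right:
  assumes "q \<notin> Z" shows "\<not> (left_tile Z q t \<and> right_tile Z q t)"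
proof
  assume h: "left_tile Z q t \<and> right_tile Z q t"
  then have t: "t \<in> tiles" using side_cases[OF assms] by blast
  have lt: "lo t < hi t" using tiles_labels(5)[OF t] .
  have nb: "\<not> (base t = Z \<and> top_v t = insert q Z)" using top_ne_insert_base[OF t _ assms] by blast
  show False using h nb lt white_black_disjoint unfolding left_tile_def right_tile_def by auto
qed

text \<open>The larger set \<open>insert r Z\<close> contains \<open>r\<close> and \<open>s\<close>,
  which lie around the element \<open>q\<close> of the smaller set, so the two members would not be
  weakly separated. An edge thus cannot have, on one side, a tile standing on its lower end and
  another hanging from its upper end.\<close>

lemma no_double_turn:
  assumes "Z \<in> D" "insert q Z \<in> D" "q \<notin> Z" "r \<in> up_labels D Z" "s \<in> down_labels D (insert q Z)"
  shows "\<not> (r < q \<and> q < s)" "\<not> (s < q \<and> q < r)"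
proof -
  have r: "r \<notin> Z" "insert r Z \<in> D" and s: "s \<in> insert q Z" "insert q Z - {s} \<in> D"
    using labelsD(1,2)[OF assms(4)] labelsD(3,4)[OF assms(5)] by auto
  have fZ: "finite Z" using ws_collection_finite_member[OF ws assms(1)] .
  have c: "card (insert q Z - {s}) < card (insert r Z)" using r s fZ assms(3) by simp
  have *: False if "r \<noteq> q" "s \<noteq> q" "r < q \<and> q < s \<or> s < q \<and> q < r"
  proof -
    have "\<not> weakly_separated (insert r Z) (insert q Z - {s})"
      using that(3)
    proof
      assume "r < q \<and> q < s"
      then show ?thesis
        using not_weakly_separated_between[of r "insert r Z" "insert q Z - {s}" s q] r s c assms(3) that by auto
    next
      assume "s < q \<and> q < r"
      then show ?thesis
        using not_weakly_separated_between[of s "insert r Z" "insert q Z - {s}" r q] r s c assms(3) that by auto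
    qed
    moreover have "insert r Z \<noteq> insert q Z - {s}" using c by (metis order_less_irrefl)
    ultimately show False using ws_collectionD[OF ws r(2) s(2)] by blast
  qed
  show "\<not> (r < q \<and> q < s)" "\<not> (s < q \<and> q < r)" using * by auto
qed

text \<open>Two tiles attached at the same end are determined by the labels there; a white and a
  black one do not compete, since an extreme label of a lens has no neighbour on its outer side.
  Tiles attached at different ends are excluded by \<open>no_double_turn\<close>.\<close>

lemma left_tile_unique:
  assumes q: "q \<notin> Z" and s: "left_tile Z q s" and t: "left_tile Z q t"
  shows "s = t"
proof -
  have st: "s \<in> tiles" "t \<in> tiles" using side_cases[OF q] s t by blast+
  have mixed: False if "left_tile Z q u" "left_tile Z q v" "base u = Z" "base v \<noteq> Z" for u v
  proof -
    have u: "q \<in> up_labels D Z" and v: "top_v v = insert q Z" "q \<in> down_labels D (insert q Z)"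
      using side_labels[OF q, of u] side_labels[OF q, of v] that by auto
    then have ZD: "Z \<in> D" "insert q Z \<in> D" using labelsD(2)[OF u] labelsD(4)[OF v(2)] q by auto
    then have "u \<in> white_tiles" "v \<in> white_tiles" "hi u = q" "lo v = q"
      using that v black_tilesD(1)[of u] black_tilesD(2)[of v] top_ne_insert_base[of u, OF _ that(3) q]
      unfolding left_tile_def by auto
    then have "lo u \<in> up_labels D Z" "lo u < q" "hi v \<in> down_labels D (insert q Z)" "q < hi v"
      using tiles_labels[of u] tiles_labels[of v] that v by auto
    then show False using no_double_turn(1)[OF ZD q] by blast
  qed
  consider "base s = Z" "base t = Z" | "base s \<noteq> Z" "base t \<noteq> Z" using mixed s t by blast
  then show ?thesis
  proof cases
    case 1
    have nt: False if "u \<in> tiles" "base u = Z" "top_v u = insert q Z" for u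
      using top_ne_insert_base[OF that(1,2) q] that(3) by blast
    have w: "u \<in> white_tiles \<and> hi u = q \<or> u \<in> black_tiles \<and> lo u = q" if "left_tile Z q u" "base u = Z" for u
      using that nt[of u] unfolding left_tile_def by blast
    have mix: False if "u \<in> white_tiles" "hi u = q" "v \<in> black_tiles" "lo v = q" "base u = Z" "base v = Z" for u v
      using white_tilesD(3)[OF that(1)] black_tilesD(3)[OF that(3)] that unfolding adjacent_def lens_labels_def
      by (metis leD)
    from w[OF s 1(1)] w[OF t 1(2)] show ?thesis
    proof (elim disjE conjE)
      assume "s \<in> white_tiles" "hi s = q" "t \<in> white_tiles" "hi t = q"
      then show ?thesis using white_tilesD(3)[of s] white_tilesD(3)[of t] adjacent_unique 1
        by (metis tile_eqI)
    next
      assume "s \<in> black_tiles" "t \<in> black_tiles"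
      then show ?thesis using black_tilesD(3)[of s] black_tilesD(3)[of t] lens_labels_unique 1
        by (metis tile_eqI)
    qed (use mix 1 in blast)+
  next
    case 2
    have w: "u \<in> white_tiles \<and> lo u = q \<or> u \<in> black_tiles \<and> hi u = q" "top_v u = insert q Z"
      if "left_tile Z q u" "base u \<noteq> Z" for u
      using that unfolding left_tile_def by blast+
    have mix: False if "u \<in> white_tiles" "lo u = q" "v \<in> black_tiles" "hi v = q" "top_v u = insert q Z" "top_v v = insert q Z" for u v
      using white_tilesD(4)[OF that(1)] black_tilesD(4)[OF that(3)] that unfolding adjacent_def lens_labels_def
      by (metis leD)
    have base: "base u = insert q Z - {lo u, hi u}" if "u \<in> tiles" "top_v u = insert q Z" for u
      using tiles_simple(1,2)[OF that(1)] that(2) unfolding top_v_def by auto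
    note b = base[OF st(1) w(2)[OF s 2(1)]] base[OF st(2) w(2)[OF t 2(2)]]
    from w(1)[OF s 2(1)] w(1)[OF t 2(2)] show ?thesis
    proof (elim disjE conjE)
      assume h: "s \<in> white_tiles" "lo s = q" "t \<in> white_tiles" "lo t = q"
      then have "hi s = hi t" using white_tilesD(4)[of s] white_tilesD(4)[of t] adjacent_unique w(2)[OF s 2(1)] w(2)[OF t 2(2)]
        by metis
      then show ?thesis using b h by (intro tile_eqI) auto
    next
      assume h: "s \<in> black_tiles" "t \<in> black_tiles"
      then have "lo s = lo t \<and> hi s = hi t"
        using black_tilesD(4)[of s] black_tilesD(4)[of t] lens_labels_unique w(2)[OF s 2(1)] w(2)[OF t 2(2)] by metis
      then show ?thesis using b h by (intro tile_eqI) auto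
    qed (use mix w(2)[OF s 2(1)] w(2)[OF t 2(2)] in blast)+
  qed
qed

lemma right_tile_unique:
  assumes q: "q \<notin> Z" and s: "right_tile Z q s" and t: "right_tile Z q t"
  shows "s = t"
proof -
  have st: "s \<in> tiles" "t \<in> tiles" using side_cases[OF q] s t by blast+
  have mixed: False if "right_tile Z q u" "right_tile Z q v" "base u = Z" "base v \<noteq> Z" for u v
  proof -
    have u: "q \<in> up_labels D Z" and v: "top_v v = insert q Z" "q \<in> down_labels D (insert q Z)"
      using side_labels[OF q, of u] side_labels[OF q, of v] that by auto
    then have ZD: "Z \<in> D" "insert q Z \<in> D" using labelsD(2)[OF u] labelsD(4)[OF v(2)] q by auto
    then have "u \<in> white_tiles" "v \<in> white_tiles" "lo u = q" "hi v = q"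
      using that v black_tilesD(1)[of u] black_tilesD(2)[of v] top_ne_insert_base[of u, OF _ that(3) q]
      unfolding right_tile_def by auto
    then have "hi u \<in> up_labels D Z" "q < hi u" "lo v \<in> down_labels D (insert q Z)" "lo v < q"
      using tiles_labels[of u] tiles_labels[of v] that v by auto
    then show False using no_double_turn(2)[OF ZD q] by blast
  qed
  consider "base s = Z" "base t = Z" | "base s \<noteq> Z" "base t \<noteq> Z" using mixed s t by blast
  then show ?thesis
  proof cases
    case 1
    have nt: False if "u \<in> tiles" "base u = Z" "top_v u = insert q Z" for u
      using top_ne_insert_base[OF that(1,2) q] that(3) by blast
    have w: "u \<in> white_tiles \<and> lo u = q \<or> u \<in> black_tiles \<and> hi u = q" if "right_tile Z q u" "base u = Z" for u
      using that nt[of u] unfolding right_tile_def by blast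
    have mix: False if "u \<in> white_tiles" "lo u = q" "v \<in> black_tiles" "hi v = q" "base u = Z" "base v = Z" for u v
      using white_tilesD(3)[OF that(1)] black_tilesD(3)[OF that(3)] that unfolding adjacent_def lens_labels_def
      by (metis leD)
    from w[OF s 1(1)] w[OF t 1(2)] show ?thesis
    proof (elim disjE conjE)
      assume "s \<in> white_tiles" "lo s = q" "t \<in> white_tiles" "lo t = q"
      then show ?thesis using white_tilesD(3)[of s] white_tilesD(3)[of t] adjacent_unique 1
        by (metis tile_eqI)
    next
      assume "s \<in> black_tiles" "t \<in> black_tiles"
      then show ?thesis using black_tilesD(3)[of s] black_tilesD(3)[of t] lens_labels_unique 1
        by (metis tile_eqI)
    qed (use mix 1 in blast)+
  next
    case 2
    have w: "u \<in> white_tiles \<and> hi u = q \<or> u \<in> black_tiles \<and> lo u = q" "top_v u = insert q Z"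
      if "right_tile Z q u" "base u \<noteq> Z" for u
      using that unfolding right_tile_def by blast+
    have mix: False if "u \<in> white_tiles" "hi u = q" "v \<in> black_tiles" "lo v = q" "top_v u = insert q Z" "top_v v = insert q Z" for u v
      using white_tilesD(4)[OF that(1)] black_tilesD(4)[OF that(3)] that unfolding adjacent_def lens_labels_def
      by (metis leD)
    have base: "base u = insert q Z - {lo u, hi u}" if "u \<in> tiles" "top_v u = insert q Z" for u
      using tiles_simple(1,2)[OF that(1)] that(2) unfolding top_v_def by auto
    note b = base[OF st(1) w(2)[OF s 2(1)]] base[OF st(2) w(2)[OF t 2(2)]]
    from w(1)[OF s 2(1)] w(1)[OF t 2(2)] show ?thesis
    proof (elim disjE conjE)
      assume h: "s \<in> white_tiles" "hi s = q" "t \<in> white_tiles" "hi t = q"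
      then have "lo s = lo t" using white_tilesD(4)[of s] white_tilesD(4)[of t] adjacent_unique w(2)[OF s 2(1)] w(2)[OF t 2(2)]
        by metis
      then show ?thesis using b h by (intro tile_eqI) auto
    next
      assume h: "s \<in> black_tiles" "t \<in> black_tiles"
      then have "lo s = lo t \<and> hi s = hi t"
        using black_tilesD(4)[of s] black_tilesD(4)[of t] lens_labels_unique w(2)[OF s 2(1)] w(2)[OF t 2(2)] by metis
      then show ?thesis using b h by (intro tile_eqI) auto
    qed (use mix w(2)[OF s 2(1)] w(2)[OF t 2(2)] in blast)+
  qed
qed

text \<open>By the second condition on white pairs, an end of the edge outside \<open>D\<close> at
  which a tile is attached has at least three labels. The other end is then automatically a
  member.\<close>

lemma edge_cases:
  assumes q: "q \<notin> Z" and s: "left_tile Z q t \<or> right_tile Z q t"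
  obtains "Z \<in> D" "insert q Z \<in> D"
  | "Z \<notin> D" "q \<in> up_labels D Z" "\<exists>i\<in>up_labels D Z. \<exists>k\<in>up_labels D Z. \<exists>j\<in>up_labels D Z. i < k \<and> k < j"
  | "insert q Z \<notin> D" "q \<in> down_labels D (insert q Z)"
    "\<exists>i\<in>down_labels D (insert q Z). \<exists>k\<in>down_labels D (insert q Z). \<exists>j\<in>down_labels D (insert q Z). i < k \<and> k < j"
proof -
  have t: "t \<in> tiles" using side_cases[OF assms] by blast
  note tl = tiles_labels[OF t]
  show ?thesis
  proof (cases "base t = Z")
    case True
    have u: "q \<in> up_labels D Z" using side_labels(1)[OF assms True] .
    show ?thesis
    proof (cases "Z \<in> D")
      case True then show ?thesis using that(1) labelsD(2)[OF u] by blast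
    next
      case nZ: False
      have "\<exists>i\<in>up_labels D Z. \<exists>k\<in>up_labels D Z. \<exists>j\<in>up_labels D Z. i < k \<and> k < j"
      proof (cases "t \<in> white_tiles")
        case w: True
        obtain k where "k \<in> up_labels D Z" "k \<noteq> lo t" "k \<noteq> hi t"
          using white_tilesD(1)[OF w] nZ True unfolding white_pair_def by blast
        then show ?thesis using three_distinct[of "lo t" _ "hi t" k] tl True by blast
      next
        case False
        then have "lens_labels (up_labels D Z) (lo t) (hi t)" using black_tilesD(3)[of t] t True by blast
        then show ?thesis using lens_labels_three[OF finite_labels'(1)] by blast
      qed
      then show ?thesis using that(2) u nZ by blast
    qed
  next
    case False
    have u: "q \<in> down_labels D (insert q Z)" "top_v t = insert q Z" using side_labels(2)[OF assms False] by auto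
    show ?thesis
    proof (cases "insert q Z \<in> D")
      case True then show ?thesis using that(1) labelsD(4)[OF u(1)] q by simp
    next
      case nZ: False
      have "\<exists>i\<in>down_labels D (insert q Z). \<exists>k\<in>down_labels D (insert q Z). \<exists>j\<in>down_labels D (insert q Z). i < k \<and> k < j"
      proof (cases "t \<in> white_tiles")
        case w: True
        obtain k where "k \<in> down_labels D (insert q Z)" "k \<noteq> lo t" "k \<noteq> hi t"
          using white_tilesD(2)[OF w] nZ u(2) unfolding co_white_pair_def by auto
        then show ?thesis using three_distinct[of "lo t" _ "hi t" k] tl u(2) by auto
      next
        case False
        then have "lens_labels (down_labels D (insert q Z)) (lo t) (hi t)" using black_tilesD(4)[of t] t u(2) by auto
        then show ?thesis using lens_labels_three[OF finite_labels'(2)] by blast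
      qed
      then show ?thesis using that(3) u nZ by blast
    qed
  qed
qed

lemma third_label:
  fixes Q :: "nat set"
  assumes "\<exists>i\<in>Q. \<exists>k\<in>Q. \<exists>j\<in>Q. i < k \<and> k < j"
  shows "\<exists>k\<in>Q. k \<noteq> p \<and> k \<noteq> r"
  using assms by (metis order_less_asym order_less_trans)

text \<open>Around a nonmember the tiles form a closed fan. At a bottom the smallest label gets the
  black tile and every other label the white tile towards its predecessor; at a top the largest
  label gets the black tile. Edges between two members rely on \<open>strip'\<close>, and the third
  alternative of the hypothesis admits such edges before any tile at them is known.\<close>

lemma ex_left_tile:
  assumes q: "q \<notin> Z" and s: "left_tile Z q t \<or> right_tile Z q t \<or> Z \<in> D \<and> insert q Z \<in> D" and b: "Z \<noteq> {1..<q}"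
  shows "\<exists>t. left_tile Z q t"
proof -
  consider (1) "Z \<in> D" "insert q Z \<in> D"
    | (2) "Z \<notin> D" "q \<in> up_labels D Z" "\<exists>i\<in>up_labels D Z. \<exists>k\<in>up_labels D Z. \<exists>j\<in>up_labels D Z. i < k \<and> k < j"
    | (3) "insert q Z \<notin> D" "q \<in> down_labels D (insert q Z)"
      "\<exists>i\<in>down_labels D (insert q Z). \<exists>k\<in>down_labels D (insert q Z). \<exists>j\<in>down_labels D (insert q Z). i < k \<and> k < j"
    using s edge_cases[OF q, of t] by metis
  then show ?thesis
  proof cases
    case 1
    have u: "q \<in> up_labels D Z" "q \<in> down_labels D (insert q Z)"
      unfolding up_labels_def down_labels_def using 1 q by auto
    from strip'[OF 1(1) u(1)] b consider r where "r \<in> up_labels D Z" "r < q"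
      | r where "r \<in> down_labels D (insert q Z)" "q < r" by blast
    then show ?thesis
    proof cases
      case r: 1
      obtain i where "adjacent (up_labels D Z) i q" by (rule ex_adjacent_below[OF finite_labels'(1) u(1) r])
      then have "left_tile Z q (Tile Z i q)" unfolding left_tile_def using white_tileI(1) 1 by simp
      then show ?thesis by blast
    next
      case r: 2
      obtain j where "adjacent (down_labels D (insert q Z)) q j" by (rule ex_adjacent_above[OF finite_labels'(2) u(2) r])
      then have "left_tile Z q (Tile (insert q Z - {q, j}) q j)"
        unfolding left_tile_def using white_tile_topI[of "insert q Z" q j] 1 by simp
      then show ?thesis by blast
    qed
  next
    case 2
    obtain i j where ij: "lens_labels (up_labels D Z) i j" using 2(3) lens_labels_three[OF finite_labels'(1)] by blast
    show ?thesis
    proof (cases "q = i")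
      case True
      then have "left_tile Z q (Tile Z i j)" unfolding left_tile_def using black_tileI[OF 2(1) ij] by simp
      then show ?thesis by blast
    next
      case False
      then have "i < q" "i \<in> up_labels D Z" using ij 2(2) unfolding lens_labels_def by force+
      then obtain p where p: "adjacent (up_labels D Z) p q"
        using ex_adjacent_below[OF finite_labels'(1) 2(2)] by blast
      obtain k where "k \<in> up_labels D Z" "k \<noteq> p" "k \<noteq> q" using third_label[OF 2(3)] by blast
      then have "left_tile Z q (Tile Z p q)" unfolding left_tile_def using white_tileI(2)[OF p] by simp
      then show ?thesis by blast
    qed
  next
    case 3
    let ?Y = "insert q Z"
    obtain i j where ij: "lens_labels (down_labels D ?Y) i j" using 3(3) lens_labels_three[OF finite_labels'(2)] by blast
    show ?thesis
    proof (cases "q = j")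
      case True
      then have "left_tile Z q (Tile (?Y - {i, j}) i j)" unfolding left_tile_def using black_tile_topI[OF 3(1) ij] by simp
      then show ?thesis by blast
    next
      case False
      then have "q < j" "j \<in> down_labels D ?Y" using ij 3(2) unfolding lens_labels_def by force+
      then obtain p where p: "adjacent (down_labels D ?Y) q p"
        using ex_adjacent_above[OF finite_labels'(2) 3(2)] by blast
      have "\<exists>k\<in>down_labels D ?Y. k \<noteq> q \<and> k \<noteq> p" using third_label[OF 3(3)] by blast
      then have "left_tile Z q (Tile (?Y - {q, p}) q p)" unfolding left_tile_def using white_tile_topI[OF p] by simp
      then show ?thesis by blast
    qed
  qed
qed

lemma ex_right_tile:
  assumes q: "q \<notin> Z" and s: "left_tile Z q t \<or> right_tile Z q t \<or> Z \<in> D \<and> insert q Z \<in> D" and b: "Z \<noteq> {Suc q..n}"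
  shows "\<exists>t. right_tile Z q t"
proof -
  consider (1) "Z \<in> D" "insert q Z \<in> D"
    | (2) "Z \<notin> D" "q \<in> up_labels D Z" "\<exists>i\<in>up_labels D Z. \<exists>k\<in>up_labels D Z. \<exists>j\<in>up_labels D Z. i < k \<and> k < j"
    | (3) "insert q Z \<notin> D" "q \<in> down_labels D (insert q Z)"
      "\<exists>i\<in>down_labels D (insert q Z). \<exists>k\<in>down_labels D (insert q Z). \<exists>j\<in>down_labels D (insert q Z). i < k \<and> k < j"
    using s edge_cases[OF q, of t] by metis
  then show ?thesis
  proof cases
    case 1
    have u: "q \<in> up_labels D Z" "q \<in> down_labels D (insert q Z)"
      unfolding up_labels_def down_labels_def using 1 q by auto
    from strip[OF 1(1) u(1)] b consider r where "r \<in> up_labels D Z" "q < r"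
      | r where "r \<in> down_labels D (insert q Z)" "r < q" by blast
    then show ?thesis
    proof cases
      case r: 1
      obtain j where "adjacent (up_labels D Z) q j" by (rule ex_adjacent_above[OF finite_labels'(1) u(1) r])
      then have "right_tile Z q (Tile Z q j)" unfolding right_tile_def using white_tileI(1) 1 by simp
      then show ?thesis by blast
    next
      case r: 2
      obtain i where "adjacent (down_labels D (insert q Z)) i q" by (rule ex_adjacent_below[OF finite_labels'(2) u(2) r])
      then have "right_tile Z q (Tile (insert q Z - {i, q}) i q)"
        unfolding right_tile_def using white_tile_topI[of "insert q Z" i q] 1 by simp
      then show ?thesis by blast
    qed
  next
    case 2
    obtain i j where ij: "lens_labels (up_labels D Z) i j" using 2(3) lens_labels_three[OF finite_labels'(1)] by blast
    show ?thesis
    proof (cases "q = j")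
      case True
      then have "right_tile Z q (Tile Z i j)" unfolding right_tile_def using black_tileI[OF 2(1) ij] by simp
      then show ?thesis by blast
    next
      case False
      then have "q < j" "j \<in> up_labels D Z" using ij 2(2) unfolding lens_labels_def by force+
      then obtain p where p: "adjacent (up_labels D Z) q p"
        using ex_adjacent_above[OF finite_labels'(1) 2(2)] by blast
      obtain k where "k \<in> up_labels D Z" "k \<noteq> q" "k \<noteq> p" using third_label[OF 2(3)] by blast
      then have "right_tile Z q (Tile Z q p)" unfolding right_tile_def using white_tileI(2)[OF p] by simp
      then show ?thesis by blast
    qed
  next
    case 3
    let ?Y = "insert q Z"
    obtain i j where ij: "lens_labels (down_labels D ?Y) i j" using 3(3) lens_labels_three[OF finite_labels'(2)] by blast
    show ?thesis
    proof (cases "q = i")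
      case True
      then have "right_tile Z q (Tile (?Y - {i, j}) i j)" unfolding right_tile_def using black_tile_topI[OF 3(1) ij] by simp
      then show ?thesis by blast
    next
      case False
      then have "i < q" "i \<in> down_labels D ?Y" using ij 3(2) unfolding lens_labels_def by force+
      then obtain p where p: "adjacent (down_labels D ?Y) p q"
        using ex_adjacent_below[OF finite_labels'(2) 3(2)] by blast
      have "\<exists>k\<in>down_labels D ?Y. k \<noteq> p \<and> k \<noteq> q" using third_label[OF 3(3)] by blast
      then have "right_tile Z q (Tile (?Y - {p, q}) p q)" unfolding right_tile_def using white_tile_topI[OF p] by simp
      then show ?thesis by blast
    qed
  qed
qed

lemma boundary_mem:
  assumes "q \<in> {1..n}"
  shows "{1..<q} \<in> D" "insert q {1..<q} \<in> D" "{Suc q..n} \<in> D" "insert q {Suc q..n} \<in> D"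
proof -
  have e: "{1..<q} = {1..q - 1}" "insert q {1..<q} = {1..q}" "insert q {Suc q..n} = {Suc (q - 1)..n}" using assms by auto
  have h: "q - 1 \<le> n" "q \<le> n" using assms by auto
  show "{1..<q} \<in> D" unfolding e(1) by (rule max_ws_collection_boundary(1)[OF max h(1)])
  show "insert q {1..<q} \<in> D" unfolding e(2) by (rule max_ws_collection_boundary(1)[OF max h(2)])
  show "{Suc q..n} \<in> D" by (rule max_ws_collection_boundary(2)[OF max h(2)])
  show "insert q {Suc q..n} \<in> D" unfolding e(3) by (rule max_ws_collection_boundary(2)[OF max h(1)])
qed

lemma no_left_tile_boundary:
  assumes q: "q \<in> {1..n}" shows "\<not> left_tile {1..<q} q t"
proof
  assume l: "left_tile {1..<q} q t"
  note m = boundary_mem[OF q]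
  have t: "t \<in> tiles" using side_cases[of q "{1..<q}" t] l by auto
  then have it: "is_tile n t" by (rule tiles_is_tile)
  have "t \<in> white_tiles" using l m black_tilesD(1,2)[of t] unfolding left_tile_def by auto
  then consider "base t = {1..<q}" "hi t = q" | "top_v t = insert q {1..<q}" "lo t = q"
    using l white_black_disjoint unfolding left_tile_def by blast
  then show False
  proof cases
    case 1 then show False using it tiles_simple(1)[OF t] unfolding is_tile_def by auto
  next
    case 2
    have "hi t \<in> insert q {1..<q}" using 2(1) unfolding top_v_def by auto
    then show False using tiles_labels(5)[OF t] 2(2) by auto
  qed
qed

lemma no_right_tile_boundary:
  assumes q: "q \<in> {1..n}" shows "\<not> right_tile {Suc q..n} q t"
proof
  assume l: "right_tile {Suc q..n} q t"
  note m = boundary_mem[OF q]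
  have t: "t \<in> tiles" using side_cases[of q "{Suc q..n}" t] l by auto
  then have it: "is_tile n t" by (rule tiles_is_tile)
  have "t \<in> white_tiles" using l m black_tilesD(1,2)[of t] unfolding right_tile_def by auto
  then consider "base t = {Suc q..n}" "lo t = q" | "top_v t = insert q {Suc q..n}" "hi t = q"
    using l white_black_disjoint unfolding right_tile_def by blast
  then show False
  proof cases
    case 1 then show False using it tiles_simple(2)[OF t] unfolding is_tile_def by auto
  next
    case 2
    have "lo t \<in> insert q {Suc q..n}" using 2(1) unfolding top_v_def by auto
    then show False using tiles_labels(5)[OF t] 2(2) by auto
  qed
qed

end

section \<open>Edge counts, terminal vertices and the spectrum\<close>

context full_structure
begin

text \<open>For \<open>n = 1\<close> the two boundary paths would share their only edge, which then
  has a tile on neither side.\<close>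

lemma left_boundary_ne_right_boundary:
  assumes "n \<ge> 2" "q \<in> {1..n}" shows "{1..<q} \<noteq> {Suc q..n}"
proof
  assume e: "{1..<q} = {Suc q..n}"
  show False
  proof (cases "q = 1")
    case True then show False using e assms by auto
  next
    case False
    then have "1 \<in> {1..<q}" using assms by auto
    then have "1 \<in> {Suc q..n}" using e by blast
    then show False using assms by simp
  qed
qed

lemma boundary_edgesE:
  assumes "e \<in> boundary_edges n"
  obtains q where "q \<in> {1..n}" "e = ({1..<q}, insert q {1..<q})"
  | q where "q \<in> {1..n}" "e = ({Suc q..n}, insert q {Suc q..n})"
proof -
  consider i where "i \<in> {1..n}" "e = ({1..i - 1}, {1..i})" | i where "i \<in> {1..n}" "e = ({i + 1..n}, {i..n})"
    using assms unfolding boundary_edges_def by blast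
  then show ?thesis
  proof cases
    case 1
    then have "{1..i - 1} = {1..<i}" "{1..i} = insert i {1..<i}" by auto
    with 1 show ?thesis using that(1) by simp
  next
    case 2
    then have "{i + 1..n} = {Suc i..n}" "{i..n} = insert i {Suc i..n}" by auto
    with 2 show ?thesis using that(2) by simp
  qed
qed

lemma boundary_edgesI:
  assumes "q \<in> {1..n}"
  shows "({1..<q}, insert q {1..<q}) \<in> boundary_edges n" "({Suc q..n}, insert q {Suc q..n}) \<in> boundary_edges n"
proof -
  have "{1..q - 1} = {1..<q}" "{1..q} = insert q {1..<q}" "{q + 1..n} = {Suc q..n}" "{q..n} = insert q {Suc q..n}"
    using assms by auto
  then show "({1..<q}, insert q {1..<q}) \<in> boundary_edges n" "({Suc q..n}, insert q {Suc q..n}) \<in> boundary_edges n"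
    using assms unfolding boundary_edges_def by (metis (mono_tags, lifting) UnI1 UnI2 mem_Collect_eq)+
qed

lemma tiles_at_edge:
  assumes "q \<notin> Z"
  shows "{t \<in> tiles. (Z, insert q Z) \<in> edges t} = {t. left_tile Z q t} \<union> {t. right_tile Z q t}"
  using side_edges_iff[OF assms] side_cases[OF assms] by blast

lemma card_boundary_edge:
  assumes n: "n \<ge> 2" and e: "e \<in> boundary_edges n"
  shows "card {t \<in> tiles. e \<in> edges t} = 1"
  using e
proof (cases rule: boundary_edgesE)
  case (1 q)
  have q: "q \<notin> {1..<q}" by simp
  obtain t where t: "right_tile {1..<q} q t"
    using ex_right_tile[OF q _ left_boundary_ne_right_boundary[OF n 1(1)]] boundary_mem(1,2)[OF 1(1)] by blast
  have "{t. left_tile {1..<q} q t} = {}" using no_left_tile_boundary[OF 1(1)] by blast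
  moreover have "{t. right_tile {1..<q} q t} = {t}"
    using t right_tile_unique[OF q _ t] by blast
  ultimately show ?thesis unfolding 1(2) tiles_at_edge[OF q] by (metis Un_empty_left is_singleton_altdef is_singletonI)
next
  case (2 q)
  have q: "q \<notin> {Suc q..n}" by simp
  obtain t where t: "left_tile {Suc q..n} q t"
    using ex_left_tile[OF q _ left_boundary_ne_right_boundary[OF n 2(1), symmetric]] boundary_mem(3,4)[OF 2(1)] by blast
  have "{t. right_tile {Suc q..n} q t} = {}" using no_right_tile_boundary[OF 2(1)] by blast
  moreover have "{t. left_tile {Suc q..n} q t} = {t}"
    using t left_tile_unique[OF q _ t] by blast
  ultimately show ?thesis unfolding 2(2) tiles_at_edge[OF q] by (metis Un_empty_right is_singleton_altdef is_singletonI)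
qed

lemma card_inner_edge:
  assumes e: "e \<in> (\<Union>t\<in>tiles. edges t) - boundary_edges n"
  shows "card {t \<in> tiles. e \<in> edges t} = 2"
proof -
  obtain t where t: "t \<in> tiles" "e \<in> edges t" using e by blast
  obtain Z q where Z: "e = (Z, insert q Z)" "q \<notin> Z" "left_tile Z q t \<or> right_tile Z q t"
    using edgesE[OF t] .
  have "snd e = left_v t \<or> snd e = right_v t \<or> snd e = top_v t" using t(2) unfolding edges_def by auto
  then have "snd e \<subseteq> top_v t" unfolding left_v_def right_v_def top_v_def by auto
  then have "q \<in> top_v t" using Z(1) by simp
  then have qn: "q \<in> {1..n}" using tiles_is_tile[OF t(1)] unfolding is_tile_def top_v_def by auto
  have "Z \<noteq> {1..<q}" "Z \<noteq> {Suc q..n}" using e Z(1) boundary_edgesI[OF qn] by auto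
  then obtain s r where s: "left_tile Z q s" and r: "right_tile Z q r"
    using ex_left_tile[OF Z(2)] ex_right_tile[OF Z(2)] Z(3) by metis
  have "{t. left_tile Z q t} = {s}" "{t. right_tile Z q t} = {r}"
    using s r left_tile_unique[OF Z(2) _ s] right_tile_unique[OF Z(2) _ r] by blast+
  moreover have "s \<noteq> r" using not_left_right[OF Z(2)] s r by blast
  ultimately show ?thesis unfolding Z(1) tiles_at_edge[OF Z(2)] by simp
qed

lemma not_both_terminal:
  assumes "X \<notin> D" "\<exists>i\<in>up_labels D X. \<exists>k\<in>up_labels D X. \<exists>j\<in>up_labels D X. i < k \<and> k < j"
    "\<exists>i\<in>down_labels D X. \<exists>k\<in>down_labels D X. \<exists>j\<in>down_labels D X. i < k \<and> k < j"
  shows False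
proof -
  obtain i j where ij: "i \<in> up_labels D X" "j \<in> up_labels D X" "i < j" using assms(2) by blast
  obtain k l where kl: "k \<in> down_labels D X" "l \<in> down_labels D X" "k < l" using assms(3) by blast
  show False using terminal[OF assms(1) ij(1,2) _ kl(1,2)] ij(3) kl(3) by simp
qed

lemma black_tiles_three:
  assumes "t \<in> black_tiles"
  shows "\<exists>i\<in>up_labels D (base t). \<exists>k\<in>up_labels D (base t). \<exists>j\<in>up_labels D (base t). i < k \<and> k < j"
    "\<exists>i\<in>down_labels D (top_v t). \<exists>k\<in>down_labels D (top_v t). \<exists>j\<in>down_labels D (top_v t). i < k \<and> k < j"
proof -
  show "\<exists>i\<in>up_labels D (base t). \<exists>k\<in>up_labels D (base t). \<exists>j\<in>up_labels D (base t). i < k \<and> k < j"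
    using lens_labels_three[OF finite_labels'(1), THEN iffD1] black_tilesD(3)[OF assms] by blast
  show "\<exists>i\<in>down_labels D (top_v t). \<exists>k\<in>down_labels D (top_v t). \<exists>j\<in>down_labels D (top_v t). i < k \<and> k < j"
    using lens_labels_three[OF finite_labels'(2), THEN iffD1] black_tilesD(4)[OF assms] by blast
qed

lemma black_tiles_eqI:
  assumes "s \<in> black_tiles" "t \<in> black_tiles" "base s = base t \<or> top_v s = top_v t"
  shows "s = t"
  using assms(3)
proof
  assume "base s = base t"
  then show ?thesis using lens_labels_unique black_tilesD(3) assms tile_eqI by metis
next
  assume e: "top_v s = top_v t"
  then have "lo s = lo t \<and> hi s = hi t" using lens_labels_unique black_tilesD(4) assms by metis
  moreover have "base u = top_v u - {lo u, hi u}" if "u \<in> black_tiles" for u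
    using tiles_simple(1,2)[of u] that unfolding top_v_def by auto
  ultimately show ?thesis using assms e tile_eqI by metis
qed

text \<open>A bottom of a black tile has three up-labels, hence at most one down-label; so it is no
  top of a black tile and no edge of a tile enters it. Middle vertices of tiles are members, whereas
  terminal vertices are not.\<close>

lemma T3: "tiling_T3 white_tiles black_tiles"
  unfolding tiling_T3_def
proof (intro ballI conjI impI)
  fix t assume t: "t \<in> black_tiles"
  note tD = black_tilesD(1,2)[OF t] and t3 = black_tiles_three[OF t]
  fix s assume s: "s \<in> black_tiles" "s \<noteq> t"
  note s3 = black_tiles_three[OF s(1)]
  have sl: "left_v s \<in> D" "right_v s \<in> D" using tiles_simple(3,4)[of s] s by auto
  have "base t \<noteq> top_v s" using not_both_terminal[OF tD(1) t3(1)] s3(2) by metis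
  moreover have "base t \<noteq> base s" using black_tiles_eqI s t by metis
  moreover have "base t \<noteq> left_v s" "base t \<noteq> right_v s" using tD(1) sl by metis+
  ultimately show "bot_v t \<notin> vertices s" unfolding vertices_def bot_v_def by simp
  have "top_v t \<noteq> base s" using not_both_terminal[OF tD(2) _ t3(2)] s3(1) by metis
  moreover have "top_v t \<noteq> top_v s" using black_tiles_eqI s t by metis
  moreover have "top_v t \<noteq> left_v s" "top_v t \<noteq> right_v s" using tD(2) sl by metis+
  ultimately show "top_v t \<notin> vertices s" unfolding vertices_def bot_v_def by simp
next
  fix t e assume t: "t \<in> black_tiles" and e: "e \<in> (\<Union>s\<in>tiles. edges s)"
  note tD = black_tilesD(1,2)[OF t] and t3 = black_tiles_three[OF t]
  obtain s where "s \<in> tiles" "e \<in> edges s" using e by blast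
  then obtain Z q where Z: "e = (Z, insert q Z)" "q \<notin> Z" "left_tile Z q s \<or> right_tile Z q s"
    by (rule edgesE)
  have "insert q Z \<noteq> base t"
  proof
    assume h: "insert q Z = base t"
    show False
    proof (rule edge_cases[OF Z(2,3)])
      assume "q \<in> up_labels D Z" then show False using labelsD(2) h tD by metis
    qed (use not_both_terminal[OF tD(1) t3(1)] h tD in auto)
  qed
  moreover have "Z \<noteq> top_v t"
  proof
    assume h: "Z = top_v t"
    show False
    proof (rule edge_cases[OF Z(2,3)])
      assume "q \<in> down_labels D (insert q Z)"
      then show False using labelsD(4)[of q D "insert q Z"] h tD Z(2) by simp
    qed (use not_both_terminal[OF tD(2) _ t3(2)] h tD in auto)
  qed
  ultimately show "case e of (X, Y) \<Rightarrow> (bot_v t \<in> {X, Y} \<longrightarrow> X = bot_v t) \<and> (top_v t \<in> {X, Y} \<longrightarrow> Y = top_v t)"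
    unfolding Z(1) bot_v_def by auto
qed

lemma vertices_of_tiles:
  assumes "t \<in> tiles" "X \<in> vertices t"
  shows "X \<in> D \<or> X \<in> terminal_vertices black_tiles"
proof -
  note tl = tiles_labels[OF assms(1)]
  have b: "base t \<in> D \<or> base t \<in> terminal_vertices black_tiles"
  proof (cases "t \<in> black_tiles")
    case True then show ?thesis unfolding terminal_vertices_def bot_v_def by blast
  next
    case False
    then have w: "t \<in> white_tiles" using assms by blast
    show ?thesis
    proof (cases "base t \<in> D")
      case nD: False
      then obtain k where "k \<in> up_labels D (base t)" "k \<noteq> lo t" "k \<noteq> hi t"
        using white_tilesD(1)[OF w] unfolding white_pair_def by blast
      then obtain i j where "lens_labels (up_labels D (base t)) i j"
        using three_distinct[OF tl(1,2) _ tl(5)] lens_labels_three[OF finite_labels'(1)] by blast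
      then have "Tile (base t) i j \<in> black_tiles" using black_tileI nD by blast
      then have "bot_v (Tile (base t) i j) \<in> terminal_vertices black_tiles" unfolding terminal_vertices_def by blast
      then show ?thesis unfolding bot_v_def by simp
    qed simp
  qed
  moreover have "top_v t \<in> D \<or> top_v t \<in> terminal_vertices black_tiles"
  proof (cases "t \<in> black_tiles")
    case True then show ?thesis unfolding terminal_vertices_def by blast
  next
    case False
    then have w: "t \<in> white_tiles" using assms by blast
    show ?thesis
    proof (cases "top_v t \<in> D")
      case nD: False
      then obtain k where "k \<in> down_labels D (top_v t)" "k \<noteq> lo t" "k \<noteq> hi t"
        using white_tilesD(2)[OF w] unfolding co_white_pair_def by blast
      then obtain i j where ij: "lens_labels (down_labels D (top_v t)) i j"
        using three_distinct[OF tl(3,4) _ tl(5)] lens_labels_three[OF finite_labels'(2)] by blast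
      have "top_v (Tile (top_v t - {i, j}) i j) \<in> terminal_vertices black_tiles"
        unfolding terminal_vertices_def using black_tile_topI(1)[OF nD ij] by blast
      then show ?thesis using black_tile_topI(2)[OF nD ij] by simp
    qed simp
  qed
  moreover have "X = base t \<or> X = top_v t \<or> X = left_v t \<or> X = right_v t"
    using assms(2) unfolding vertices_def bot_v_def by blast
  ultimately show ?thesis using tiles_simple(3,4)[OF assms(1)] by metis
qed

lemma side_vertices:
  assumes "q \<notin> Z" "left_tile Z q t \<or> right_tile Z q t" shows "Z \<in> vertices t \<and> insert q Z \<in> vertices t"
  using side_edges[OF assms] unfolding edges_def vertices_def by blast

text \<open>The empty set is on the boundary, and a set with a lower neighbour is on an edge between
  members. For the remaining sets \<open>inner\<close> supplies labels on both sides of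
  \<open>l\<close> at \<open>A - {l}\<close>, and these give a white tile with right vertex
  \<open>A\<close>.\<close>

lemma mem_covered:
  assumes n: "n \<ge> 2" and A: "A \<in> D"
  shows "\<exists>t\<in>tiles. A \<in> vertices t"
proof -
  have edge: "\<exists>t\<in>tiles. Z \<in> vertices t \<and> insert q Z \<in> vertices t" if q: "q \<notin> Z" "Z \<in> D" "insert q Z \<in> D" for Z q
  proof -
    have "q \<in> {1..n}" using q(3) sub by blast
    then have "Z \<noteq> {1..<q} \<or> Z \<noteq> {Suc q..n}" using left_boundary_ne_right_boundary[OF n] by blast
    then obtain t where t: "left_tile Z q t \<or> right_tile Z q t"
      using ex_left_tile[OF q(1)] ex_right_tile[OF q(1)] q(2,3) by blast
    show ?thesis using side_vertices[OF q(1) t] side_cases[OF q(1) t] by blast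
  qed
  show ?thesis
  proof (cases "A = {}")
    case True
    have "{1..<1::nat} = {}" "insert 1 {1..<1} = {1::nat}" by auto
    then show ?thesis using edge[of 1 "{}"] boundary_mem(1,2)[of 1] n True by auto
  next
    case ne: False
    show ?thesis
    proof (cases "down_labels D A = {}")
      case False
      then obtain k where k: "k \<in> down_labels D A" by blast
      have "insert k (A - {k}) = A" using labelsD(3)[OF k] by blast
      then show ?thesis using edge[of k "A - {k}"] labelsD(4)[OF k] A by auto
    next
      case True
      obtain l i j where l: "l \<in> A" "i \<in> up_labels D (A - {l})" "j \<in> up_labels D (A - {l})" "i < l" "l < j"
        using inner[OF A ne True] by blast
      let ?Q = "up_labels D (A - {l})"
      have il: "insert l (A - {l}) = A" using l(1) by blast
      have lQ: "l \<in> ?Q" unfolding up_labels_def using A il by simp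
      obtain p where p: "adjacent ?Q p l" by (rule ex_adjacent_below[OF finite_labels'(1) lQ l(2,4)])
      have "j \<noteq> p" "j \<noteq> l" using p l(5) unfolding adjacent_def by auto
      then have "Tile (A - {l}) p l \<in> white_tiles" using white_tileI(2)[OF p l(3)] by blast
      moreover have "A \<in> vertices (Tile (A - {l}) p l)" unfolding vertices_def right_v_def using il by simp
      ultimately show ?thesis by blast
    qed
  qed
qed

lemma spectrum_eq:
  assumes n: "n \<ge> 2" shows "D = spectrum white_tiles black_tiles"
proof -
  have "terminal_vertices black_tiles \<inter> D = {}"
    unfolding terminal_vertices_def bot_v_def using black_tilesD(1,2) by blast
  then show ?thesis unfolding spectrum_def using mem_covered[OF n] vertices_of_tiles by blast
qed

end

section \<open>Tiles in the plane\<close>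

lemma convex_hull_parallelogram:
  fixes p x y :: "'a::real_vector"
  shows "convex hull {p, p + x, p + y, p + x + y} =
    {p + u *\<^sub>R x + v *\<^sub>R y | u v. 0 \<le> u \<and> u \<le> 1 \<and> 0 \<le> v \<and> v \<le> 1}" (is "?H = ?P")
proof
  have "convex ?P"
  proof (rule convexI)
    fix z z' and a b :: real
    assume z: "z \<in> ?P" "z' \<in> ?P" and ab: "0 \<le> a" "0 \<le> b" "a + b = 1"
    obtain u v where u: "z = p + u *\<^sub>R x + v *\<^sub>R y" "0 \<le> u" "u \<le> 1" "0 \<le> v" "v \<le> 1" using z by blast
    obtain u' v' where u': "z' = p + u' *\<^sub>R x + v' *\<^sub>R y" "0 \<le> u'" "u' \<le> 1" "0 \<le> v'" "v' \<le> 1" using z by blast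
    have "a *\<^sub>R z + b *\<^sub>R z' = (a + b) *\<^sub>R p + (a * u + b * u') *\<^sub>R x + (a * v + b * v') *\<^sub>R y"
      unfolding u u' by (simp add: algebra_simps)
    moreover have "0 \<le> a * u + b * u'" "a * u + b * u' \<le> 1" "0 \<le> a * v + b * v'" "a * v + b * v' \<le> 1"
      using u u' ab convex_bound_le[of u 1 u' a b] convex_bound_le[of v 1 v' a b] by auto
    ultimately show "a *\<^sub>R z + b *\<^sub>R z' \<in> ?P" using ab(3) by (metis (mono_tags, lifting) mem_Collect_eq scaleR_one)
  qed
  moreover have "{p, p + x, p + y, p + x + y} \<subseteq> ?P"
  proof (intro insert_subsetI empty_subsetI)
    show "p \<in> ?P" by (rule CollectI, rule exI[of _ 0], rule exI[of _ 0]) simp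
    show "p + x \<in> ?P" by (rule CollectI, rule exI[of _ 1], rule exI[of _ 0]) simp
    show "p + y \<in> ?P" by (rule CollectI, rule exI[of _ 0], rule exI[of _ 1]) simp
    show "p + x + y \<in> ?P" by (rule CollectI, rule exI[of _ 1], rule exI[of _ 1]) simp
  qed
  ultimately show "?H \<subseteq> ?P" by (rule hull_minimal[rotated])
  show "?P \<subseteq> ?H"
  proof
    fix z assume "z \<in> ?P"
    then obtain u v where u: "z = p + u *\<^sub>R x + v *\<^sub>R y" "0 \<le> u" "u \<le> 1" "0 \<le> v" "v \<le> 1" by blast
    have c: "convex ?H" by (rule convex_convex_hull)
    have m: "p \<in> ?H" "p + x \<in> ?H" "p + y \<in> ?H" "p + x + y \<in> ?H" by (auto intro: hull_inc)
    have "(1 - u) *\<^sub>R p + u *\<^sub>R (p + x) \<in> ?H" "(1 - u) *\<^sub>R (p + y) + u *\<^sub>R (p + x + y) \<in> ?H"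
      using convexD[OF c] m u by simp_all
    then have "(1 - v) *\<^sub>R ((1 - u) *\<^sub>R p + u *\<^sub>R (p + x)) + v *\<^sub>R ((1 - u) *\<^sub>R (p + y) + u *\<^sub>R (p + x + y)) \<in> ?H"
      using convexD[OF c] u by simp
    moreover have "(1 - v) *\<^sub>R ((1 - u) *\<^sub>R p + u *\<^sub>R (p + x)) + v *\<^sub>R ((1 - u) *\<^sub>R (p + y) + u *\<^sub>R (p + x + y)) = z"
      unfolding u(1) by (simp add: algebra_simps)
    ultimately show "z \<in> ?H" by simp
  qed
qed

lemma pt_insert: "finite X \<Longrightarrow> q \<notin> X \<Longrightarrow> pt a (insert q X) = pt a X + xi a q"
  unfolding pt_def by (simp add: add.commute)

lemma convex_zonogon: "convex (zonogon n a)"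
proof (rule convexI)
  fix z z' and u v :: real
  assume z: "z \<in> zonogon n a" "z' \<in> zonogon n a" and uv: "0 \<le> u" "0 \<le> v" "u + v = 1"
  obtain l where l: "z = (\<Sum>i=1..n. l i *\<^sub>R xi a i)" "\<forall>i\<in>{1..n}. 0 \<le> l i \<and> l i \<le> 1"
    using z(1) unfolding zonogon_def by blast
  obtain l' where l': "z' = (\<Sum>i=1..n. l' i *\<^sub>R xi a i)" "\<forall>i\<in>{1..n}. 0 \<le> l' i \<and> l' i \<le> 1"
    using z(2) unfolding zonogon_def by blast
  have "u *\<^sub>R z + v *\<^sub>R z' = (\<Sum>i=1..n. (u * l i + v * l' i) *\<^sub>R xi a i)"
    unfolding l l' by (simp add: scaleR_sum_right sum.distrib algebra_simps)
  moreover have "0 \<le> u * l i + v * l' i \<and> u * l i + v * l' i \<le> 1" if "i \<in> {1..n}" for i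
    using l(2) l'(2) that uv convex_bound_le[of "l i" 1 "l' i" u v] by auto
  ultimately show "u *\<^sub>R z + v *\<^sub>R z' \<in> zonogon n a" unfolding zonogon_def
    by (intro CollectI exI[of _ "\<lambda>i. u * l i + v * l' i"]) simp
qed

lemma pt_in_zonogon:
  assumes "X \<subseteq> {1..n}" shows "pt a X \<in> zonogon n a"
proof -
  have "pt a X = (\<Sum>i\<in>{1..n} \<inter> X. xi a i)" unfolding pt_def using assms by (simp add: Int_absorb1)
  also have "\<dots> = (\<Sum>i=1..n. if i \<in> X then xi a i else 0)" by (simp add: sum.inter_restrict)
  also have "\<dots> = (\<Sum>i=1..n. (if i \<in> X then 1 else 0) *\<^sub>R xi a i)" by (rule sum.cong) auto
  finally show ?thesis unfolding zonogon_def
    by (intro CollectI exI[of _ "\<lambda>i. if i \<in> X then 1 else 0"]) simp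
qed

lemma generic_slopes_less: "generic_slopes n a \<Longrightarrow> i \<in> {1..n} \<Longrightarrow> j \<in> {1..n} \<Longrightarrow> i < j \<Longrightarrow> a i < a j"
  unfolding generic_slopes_def strict_mono_on_def by blast

lemma pt_inj:
  assumes a: "generic_slopes n a" and X: "X \<subseteq> {1..n}" and Y: "Y \<subseteq> {1..n}" and e: "pt a X = pt a Y"
  shows "X = Y"
proof -
  have *: "pt a Z = (\<Sum>i=1..n. of_int (if i \<in> Z then 1 else 0) *\<^sub>R xi a i)" if "Z \<subseteq> {1..n}" for Z
  proof -
    have "pt a Z = (\<Sum>i\<in>{1..n} \<inter> Z. xi a i)" unfolding pt_def using that by (simp add: Int_absorb1)
    also have "\<dots> = (\<Sum>i=1..n. if i \<in> Z then xi a i else 0)" by (simp add: sum.inter_restrict)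
    also have "\<dots> = (\<Sum>i=1..n. of_int (if i \<in> Z then 1 else 0) *\<^sub>R xi a i)" by (rule sum.cong) auto
    finally show ?thesis .
  qed
  have "(\<Sum>i=1..n. of_int (if i \<in> X then 1 else 0) *\<^sub>R xi a i) = (\<Sum>i=1..n. of_int (if i \<in> Y then 1 else 0) *\<^sub>R xi a i)"
    using e *[OF X] *[OF Y] by simp
  then have "\<forall>i\<in>{1..n}. (if i \<in> X then 1 else 0 :: int) = (if i \<in> Y then 1 else 0)"
    using a[unfolded generic_slopes_def, THEN conjunct2, rule_format,
      of "\<lambda>i. if i \<in> X then 1 else 0" "\<lambda>i. if i \<in> Y then 1 else 0"] by blast
  then have "i \<in> X \<longleftrightarrow> i \<in> Y" if "i \<in> {1..n}" for i using that by (auto split: if_splits)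
  then show ?thesis using X Y by blast
qed

text \<open>A linear functional that vanishes on \<open>xi a q\<close>, hence is constant along
  every edge labelled \<open>q\<close>; its sign distinguishes right from left of the edge.\<close>

definition side :: "(nat \<Rightarrow> real) \<Rightarrow> nat \<Rightarrow> real \<times> real \<Rightarrow> real" where
  "side a q p = fst p - a q * snd p"

lemma side_linear: "side a q (x + y) = side a q x + side a q y" "side a q (u *\<^sub>R x) = u * side a q x"
  unfolding side_def by (simp_all add: algebra_simps)

lemma side_xi: "side a q (xi a k) = a k - a q" unfolding side_def xi_def by simp

lemma interiors_disjoint_sides:
  assumes "S \<subseteq> {p. side a q p \<le> c}" "T \<subseteq> {p. side a q p \<ge> c}"
  shows "interior S \<inter> interior T = {}"
proof -
  have e: "side a q p = (1, - a q) \<bullet> p" for p unfolding side_def by (cases p) (simp add: inner_prod_def)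
  have ne: "(1, - a q) \<noteq> (0 :: real \<times> real)" by (simp add: zero_prod_def)
  have "interior S \<subseteq> {p. (1, - a q) \<bullet> p < c}"
    using interior_mono[OF assms(1)] interior_halfspace_le[OF ne, of c] unfolding e by blast
  moreover have "interior T \<subseteq> {p. (1, - a q) \<bullet> p > c}"
    using interior_mono[OF assms(2)] interior_halfspace_ge[OF ne, of c] unfolding e by blast
  ultimately show ?thesis by force
qed

locale plane_tile =
  fixes n :: nat and a :: "nat \<Rightarrow> real" and t :: tile
  assumes slopes_generic: "generic_slopes n a" and tile: "is_tile n t"
begin

lemma fin: "finite (base t)" using tile unfolding is_tile_def by (meson finite_Diff finite_atLeastAtMost finite_subset)

lemma labels: "lo t \<in> {1..n}" "hi t \<in> {1..n}" "lo t < hi t" "lo t \<notin> base t" "hi t \<notin> base t" "base t \<subseteq> {1..n}"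
  using tile unfolding is_tile_def by auto

lemma slopes: "a (lo t) < a (hi t)" using generic_slopes_less[OF slopes_generic labels(1-3)] .

lemma pts: "pt a (left_v t) = pt a (base t) + xi a (lo t)" "pt a (right_v t) = pt a (base t) + xi a (hi t)"
  "pt a (top_v t) = pt a (base t) + xi a (lo t) + xi a (hi t)"
  unfolding left_v_def right_v_def top_v_def using labels fin
  by (simp_all add: pt_insert insert_commute add_ac)

lemma region_eq: "region a t = {pt a (base t) + u *\<^sub>R xi a (lo t) + v *\<^sub>R xi a (hi t) | u v.
    0 \<le> u \<and> u \<le> 1 \<and> 0 \<le> v \<and> v \<le> 1}"
  unfolding region_def vertices_def bot_v_def using pts
  by (simp add: convex_hull_parallelogram[symmetric])

lemma interior_point:
  assumes "0 < u" "u < 1" "0 < v" "v < 1"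
  shows "pt a (base t) + u *\<^sub>R xi a (lo t) + v *\<^sub>R xi a (hi t) \<in> interior (region a t)"
proof -
  define d where "d = a (hi t) - a (lo t)"
  have d: "0 < d" unfolding d_def using slopes by simp
  \<comment> \<open>\<open>V\<close> and \<open>U\<close> are the coefficients in the directions
    \<open>hi t\<close> and \<open>lo t\<close>: each functional kills the other direction, and
    \<open>d\<close> is its value on its own direction, up to the sign in \<open>U\<close>.\<close>
  define V where "V p = side a (lo t) (p - pt a (base t)) / d" for p
  define U where "U p = - side a (hi t) (p - pt a (base t)) / d" for p
  let ?O = "{p. 0 < U p \<and> U p < 1 \<and> 0 < V p \<and> V p < 1}"
  have cont: "continuous_on UNIV U" "continuous_on UNIV V"
    unfolding U_def V_def side_def by (intro continuous_intros; use d in simp)+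
  have "open ?O" by (intro open_Collect_conj open_Collect_less continuous_intros cont)
  moreover have "?O \<subseteq> region a t"
  proof
    fix p assume "p \<in> ?O"
    then have p: "0 < U p" "U p < 1" "0 < V p" "V p < 1" by auto
    obtain x y where xy: "p - pt a (base t) = (x, y)" by (cases "p - pt a (base t)") auto
    have e: "U p * d = a (hi t) * y - x" "V p * d = x - a (lo t) * y"
      unfolding U_def V_def side_def xy using d by auto
    have s: "U p + V p = y"
    proof -
      have "(U p + V p) * d = U p * d + V p * d" by (rule distrib_right)
      also have "\<dots> = y * d" unfolding e by (simp add: d_def algebra_simps)
      finally have "(U p + V p) * d = y * d" .
      then show ?thesis using d by simp
    qed
    moreover have "U p * a (lo t) + V p * a (hi t) = x"
    proof -
      have "(U p * a (lo t) + V p * a (hi t)) * d = (U p * d) * a (lo t) + (V p * d) * a (hi t)" by (simp add: algebra_simps)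
      also have "\<dots> = x * d" unfolding e by (simp add: d_def algebra_simps)
      finally show ?thesis using d by simp
    qed
    ultimately have "U p *\<^sub>R xi a (lo t) + V p *\<^sub>R xi a (hi t) = p - pt a (base t)"
      unfolding xy xi_def by simp
    then have "p = pt a (base t) + U p *\<^sub>R xi a (lo t) + V p *\<^sub>R xi a (hi t)" by (simp add: algebra_simps)
    then show "p \<in> region a t" unfolding region_eq using p less_imp_le by blast
  qed
  ultimately have O: "?O \<subseteq> interior (region a t)" by (rule interior_maximal[rotated])
  let ?p = "pt a (base t) + u *\<^sub>R xi a (lo t) + v *\<^sub>R xi a (hi t)"
  have "?p - pt a (base t) = u *\<^sub>R xi a (lo t) + v *\<^sub>R xi a (hi t)" by simp
  then have "U ?p = u" "V ?p = v"
    unfolding U_def V_def using d by (simp_all add: side_linear side_xi d_def field_simps)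
  then show ?thesis using O assms by auto
qed

end

lemma xi_between:
  assumes "a i \<le> a k" "a k \<le> a j" "a i < a j"
  obtains m where "0 \<le> m" "m \<le> 1" "xi a k = m *\<^sub>R xi a i + (1 - m) *\<^sub>R xi a j"
    "a i < a k \<Longrightarrow> m < 1" "a k < a j \<Longrightarrow> 0 < m"
proof -
  define m where "m = (a j - a k) / (a j - a i)"
  have "m * (a j - a i) = a j - a k" unfolding m_def using assms(3) by simp
  then have "m * a i + (1 - m) * a j = a k" by (simp add: algebra_simps)
  then have "xi a k = m *\<^sub>R xi a i + (1 - m) *\<^sub>R xi a j" unfolding xi_def by simp
  then show ?thesis by (rule that[rotated 2]) (use assms in \<open>auto simp: m_def field_simps\<close>)
qed

lemma overlap_same_corner:
  assumes a: "generic_slopes n a" and s: "is_tile n s" and t: "is_tile n t"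
    and base: "base s = base t \<or> top_v s = top_v t"
    and lab: "lo s = lo t \<and> hi s \<le> hi t \<or> hi s = hi t \<and> lo t \<le> lo s"
  shows "overlap a s t"
proof -
  interpret s: plane_tile n a s using a s by unfold_locales
  interpret t: plane_tile n a t using a t by unfold_locales
  have le: "a i \<le> a j" if "i \<in> {1..n}" "j \<in> {1..n}" "i \<le> j" for i j
    using generic_slopes_less[OF a that(1,2)] that(3) by (cases "i = j") auto
  text \<open>Both parallelograms have the corner and one side at the corner in common, and the other
    side of the smaller one lies in the angle of the larger one.\<close>
  have "\<exists>u v u' v'. 0 < u \<and> u < 1 \<and> 0 < v \<and> v < 1 \<and> 0 < u' \<and> u' < 1 \<and> 0 < v' \<and> v' < 1 \<and>
    u *\<^sub>R xi a (lo s) + v *\<^sub>R xi a (hi s) = u' *\<^sub>R xi a (lo t) + v' *\<^sub>R xi a (hi t)"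
    using lab
  proof
    assume h: "lo s = lo t \<and> hi s \<le> hi t"
    \<comment> \<open>Half a step along the common side plus a quarter step along the other side of
      \<open>s\<close> keeps all coefficients strictly between \<open>0\<close> and
      \<open>1\<close>, also when expressed by the sides of \<open>t\<close>; this uses
      \<open>m < 1\<close>.\<close>
    obtain m where m: "0 \<le> m" "m \<le> 1" "xi a (hi s) = m *\<^sub>R xi a (lo t) + (1 - m) *\<^sub>R xi a (hi t)" "m < 1"
      using xi_between[of a "lo t" "hi s" "hi t"] s.slopes t.slopes h le[OF s.labels(2) t.labels(2)] by auto
    have "(1/2) *\<^sub>R xi a (lo s) + (1/4) *\<^sub>R xi a (hi s) = (1/2 + m/4) *\<^sub>R xi a (lo t) + ((1 - m)/4) *\<^sub>R xi a (hi t)"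
      unfolding m(3) using h by (simp add: xi_def field_simps)
    moreover have "0 < 1/2 + m/4" "1/2 + m/4 < 1" "0 < (1 - m)/4" "(1 - m)/4 < 1" using m by auto
    ultimately show ?thesis
      by - (rule exI[of _ "1/2"], rule exI[of _ "1/4"], rule exI[of _ "1/2 + m/4"], rule exI[of _ "(1 - m)/4"], simp)
  next
    assume h: "hi s = hi t \<and> lo t \<le> lo s"
    obtain m where m: "0 \<le> m" "m \<le> 1" "xi a (lo s) = m *\<^sub>R xi a (lo t) + (1 - m) *\<^sub>R xi a (hi t)" "0 < m"
      using xi_between[of a "lo t" "lo s" "hi t"] s.slopes t.slopes h le[OF t.labels(1) s.labels(1)] by auto
    have "(1/4) *\<^sub>R xi a (lo s) + (1/2) *\<^sub>R xi a (hi s) = (m/4) *\<^sub>R xi a (lo t) + (1/2 + (1 - m)/4) *\<^sub>R xi a (hi t)"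
      unfolding m(3) using h by (simp add: xi_def field_simps)
    moreover have "0 < m/4" "m/4 < 1" "0 < 1/2 + (1 - m)/4" "1/2 + (1 - m)/4 < 1" using m(1,2,4) by (simp_all add: field_simps)
    ultimately show ?thesis
      by - (rule exI[of _ "1/4"], rule exI[of _ "1/2"], rule exI[of _ "m/4"], rule exI[of _ "1/2 + (1 - m)/4"], simp)
  qed
  then obtain u v u' v' where u: "0 < u" "u < 1" "0 < v" "v < 1" "0 < u'" "u' < 1" "0 < v'" "v' < 1"
    and e: "u *\<^sub>R xi a (lo s) + v *\<^sub>R xi a (hi s) = u' *\<^sub>R xi a (lo t) + v' *\<^sub>R xi a (hi t)" by blast
  show ?thesis
    using base
  proof
    assume b: "base s = base t"
    have "pt a (base s) + u *\<^sub>R xi a (lo s) + v *\<^sub>R xi a (hi s) = pt a (base t) + u' *\<^sub>R xi a (lo t) + v' *\<^sub>R xi a (hi t)"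
      using e b by (simp add: add.assoc)
    then show ?thesis unfolding overlap_def using s.interior_point[of u v] t.interior_point[of u' v'] u by auto
  next
    assume b: "top_v s = top_v t"
    have r: "pt a (base w) + (1 - x) *\<^sub>R xi a (lo w) + (1 - y) *\<^sub>R xi a (hi w) =
      pt a (top_v w) - (x *\<^sub>R xi a (lo w) + y *\<^sub>R xi a (hi w))" if "plane_tile n a w" for w x y
      using plane_tile.pts(3)[OF that] by (simp add: algebra_simps)
    have "pt a (base s) + (1 - u) *\<^sub>R xi a (lo s) + (1 - v) *\<^sub>R xi a (hi s) =
      pt a (base t) + (1 - u') *\<^sub>R xi a (lo t) + (1 - v') *\<^sub>R xi a (hi t)"
      unfolding r[OF s.plane_tile_axioms] r[OF t.plane_tile_axioms] e b ..
    then show ?thesis unfolding overlap_def using s.interior_point[of "1 - u" "1 - v"] t.interior_point[of "1 - u'" "1 - v'"] u by auto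
  qed
qed

section \<open>Regions of adjacent tiles\<close>

context full_structure
begin

lemma T1:
  assumes n: "n \<ge> 2" and a: "generic_slopes n a"
  shows "tiling_T1 n a tiles"
  unfolding tiling_T1_def
proof (intro conjI ballI)
  fix t assume "t \<in> tiles"
  then interpret plane_tile n a t using a tiles_is_tile by unfold_locales
  have "v \<subseteq> {1..n}" if "v \<in> vertices t" for v
    using that labels unfolding vertices_def bot_v_def left_v_def right_v_def top_v_def by auto
  then show "region a t \<subseteq> zonogon n a"
    unfolding region_def by (intro hull_minimal convex_zonogon image_subsetI pt_in_zonogon)
next
  show "card {t \<in> tiles. e \<in> edges t} = 1" if "e \<in> boundary_edges n" for e
    using card_boundary_edge[OF n that] .
  show "card {t \<in> tiles. e \<in> edges t} = 2" if "e \<in> (\<Union>t\<in>tiles. edges t) - boundary_edges n" for e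
    using card_inner_edge[OF that] .
  show "inj_on (region a) tiles"
  proof (rule inj_onI)
    fix s t assume st: "s \<in> tiles" "t \<in> tiles" and e: "region a s = region a t"
    have snd: "snd (xi a i) = 1" for i unfolding xi_def by simp
    \<comment> \<open>The bottom and the top are the unique lowest and highest points of a region,
      so the region determines them and thereby the tile.\<close>
    have mn: "snd p \<ge> snd (pt a (base u))" "snd p \<le> snd (pt a (top_v u))"
      "snd p = snd (pt a (base u)) \<Longrightarrow> p = pt a (base u)" "snd p = snd (pt a (top_v u)) \<Longrightarrow> p = pt a (top_v u)"
      if u: "u \<in> tiles" "p \<in> region a u" for u p
    proof -
      interpret plane_tile n a u using a tiles_is_tile[OF u(1)] by unfold_locales
      obtain x y where x: "p = pt a (base u) + x *\<^sub>R xi a (lo u) + y *\<^sub>R xi a (hi u)" "0 \<le> x" "x \<le> 1" "0 \<le> y" "y \<le> 1"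
        using u(2) unfolding region_eq by blast
      show "snd p \<ge> snd (pt a (base u))" "snd p \<le> snd (pt a (top_v u))" unfolding x(1) pts(3) using x snd by auto
      show "p = pt a (base u)" if "snd p = snd (pt a (base u))"
      proof -
        have "x + y = 0" using that unfolding x(1) by (simp add: snd)
        then have "x = 0" "y = 0" using x by auto
        then show ?thesis unfolding x(1) by simp
      qed
      show "p = pt a (top_v u)" if "snd p = snd (pt a (top_v u))"
      proof -
        have "x + y = 2" using that unfolding x(1) pts(3) by (simp add: snd)
        then have "x = 1" "y = 1" using x by auto
        then show ?thesis unfolding x(1) pts(3) by simp
      qed
    qed
    have in_reg: "pt a (base u) \<in> region a u" "pt a (top_v u) \<in> region a u" for u
      unfolding region_def vertices_def bot_v_def by (auto intro: hull_inc)
    have "snd (pt a (base s)) = snd (pt a (base t))"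
      using mn(1)[OF st(1), of "pt a (base t)"] mn(1)[OF st(2), of "pt a (base s)"] in_reg e by force
    then have "pt a (base s) = pt a (base t)" using mn(3)[OF st(2), of "pt a (base s)"] in_reg e by auto
    moreover have "snd (pt a (top_v s)) = snd (pt a (top_v t))"
      using mn(2)[OF st(1), of "pt a (top_v t)"] mn(2)[OF st(2), of "pt a (top_v s)"] in_reg e by force
    then have "pt a (top_v s) = pt a (top_v t)" using mn(4)[OF st(2), of "pt a (top_v s)"] in_reg e by auto
    moreover have sb: "base u \<subseteq> {1..n}" "top_v u \<subseteq> {1..n}" if "u \<in> tiles" for u
      using tiles_is_tile[OF that] unfolding is_tile_def top_v_def by auto
    ultimately have be: "base s = base t" "top_v s = top_v t"
      using pt_inj[OF a sb(1)[OF st(1)] sb(1)[OF st(2)]] pt_inj[OF a sb(2)[OF st(1)] sb(2)[OF st(2)]] by auto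
    have d: "top_v u - base u = {lo u, hi u}" if "u \<in> tiles" for u
      using tiles_simple(1,2)[OF that] unfolding top_v_def by auto
    then have "{lo s, hi s} = {lo t, hi t}" using be st by metis
    then have "lo s = lo t \<and> hi s = hi t"
      using tiles_labels(5)[OF st(1)] tiles_labels(5)[OF st(2)] unfolding doubleton_eq_iff by auto
    then show "s = t" using be tile_eqI by blast
  qed
qed

lemma white_side:
  assumes a: "generic_slopes n a" and q: "q \<notin> Z" and t: "t \<in> white_tiles"
  shows "left_tile Z q t \<Longrightarrow> region a t \<subseteq> {p. side a q p \<le> side a q (pt a Z)}"
    "right_tile Z q t \<Longrightarrow> region a t \<subseteq> {p. side a q p \<ge> side a q (pt a Z)}"
proof -
  have tt: "t \<in> tiles" using t by blast
  interpret plane_tile n a t using a tiles_is_tile[OF tt] by unfold_locales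
  have nb: "t \<notin> black_tiles" using t white_black_disjoint unfolding disjoint_iff by metis
  have Z: "Z = top_v t - {q}" if "top_v t = insert q Z" using that q by auto
  have sg: "side a q (pt a (base t) + u *\<^sub>R xi a (lo t) + v *\<^sub>R xi a (hi t)) =
    side a q (pt a (base t)) + u * (a (lo t) - a q) + v * (a (hi t) - a q)" for u v
    by (simp add: side_linear side_xi)
  have pos: "0 \<le> u * (a (hi t) - a (lo t))" if "0 \<le> u" for u using that slopes by simp
  {
    assume "left_tile Z q t"
    then consider "base t = Z" "hi t = q" | "top_v t = insert q Z" "lo t = q" using nb unfolding left_tile_def by blast
    then show "region a t \<subseteq> {p. side a q p \<le> side a q (pt a Z)}"
    proof cases
      case 1
      have "side a q p \<le> side a q (pt a Z)" if p: "p \<in> region a t" for p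
      proof -
        obtain u v where p: "p = pt a (base t) + u *\<^sub>R xi a (lo t) + v *\<^sub>R xi a (hi t)" "0 \<le> u" "u \<le> 1" "0 \<le> v" "v \<le> 1"
          using p unfolding region_eq by blast
        have "side a q p = side a q (pt a (base t)) + u * (a (lo t) - a q) + v * (a (hi t) - a q)"
          unfolding p(1) by (rule sg)
        then show ?thesis using pos[OF p(2)] 1 by (simp add: algebra_simps)
      qed
      then show ?thesis by blast
    next
      case 2
      then have "side a q (pt a Z) = side a q (pt a (base t)) + (a (hi t) - a (lo t))"
        using Z tiles_simple(5)[OF tt] pts(2) by (simp add: side_linear side_xi)
      note z = this
      have le: "v * (a (hi t) - a (lo t)) \<le> a (hi t) - a (lo t)" if "v \<le> 1" for v
        using that slopes mult_right_mono[of v 1 "a (hi t) - a (lo t)"] by simp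
      have "side a q p \<le> side a q (pt a Z)" if p: "p \<in> region a t" for p
      proof -
        obtain u v where p: "p = pt a (base t) + u *\<^sub>R xi a (lo t) + v *\<^sub>R xi a (hi t)" "0 \<le> u" "u \<le> 1" "0 \<le> v" "v \<le> 1"
          using p unfolding region_eq by blast
        have "side a q p = side a q (pt a (base t)) + u * (a (lo t) - a q) + v * (a (hi t) - a q)"
          unfolding p(1) by (rule sg)
        then show ?thesis using z le[OF p(5)] 2 by (simp add: algebra_simps)
      qed
      then show ?thesis by blast
    qed
  }
  {
    assume "right_tile Z q t"
    then consider "base t = Z" "lo t = q" | "top_v t = insert q Z" "hi t = q" using nb unfolding right_tile_def by blast
    then show "region a t \<subseteq> {p. side a q p \<ge> side a q (pt a Z)}"
    proof cases
      case 1
      have "side a q p \<ge> side a q (pt a Z)" if p: "p \<in> region a t" for p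
      proof -
        obtain u v where p: "p = pt a (base t) + u *\<^sub>R xi a (lo t) + v *\<^sub>R xi a (hi t)" "0 \<le> u" "u \<le> 1" "0 \<le> v" "v \<le> 1"
          using p unfolding region_eq by blast
        have "side a q p = side a q (pt a (base t)) + u * (a (lo t) - a q) + v * (a (hi t) - a q)"
          unfolding p(1) by (rule sg)
        then show ?thesis using pos[OF p(4)] 1 by (simp add: algebra_simps)
      qed
      then show ?thesis by blast
    next
      case 2
      then have "side a q (pt a Z) = side a q (pt a (base t)) + (a (lo t) - a (hi t))"
        using Z tiles_simple(6)[OF tt] pts(1) by (simp add: side_linear side_xi)
      note z = this
      have le: "u * (a (hi t) - a (lo t)) \<le> a (hi t) - a (lo t)" if "u \<le> 1" for u
        using that slopes mult_right_mono[of u 1 "a (hi t) - a (lo t)"] by simp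
      have "side a q p \<ge> side a q (pt a Z)" if p: "p \<in> region a t" for p
      proof -
        obtain u v where p: "p = pt a (base t) + u *\<^sub>R xi a (lo t) + v *\<^sub>R xi a (hi t)" "0 \<le> u" "u \<le> 1" "0 \<le> v" "v \<le> 1"
          using p unfolding region_eq by blast
        have "side a q p = side a q (pt a (base t)) + u * (a (lo t) - a q) + v * (a (hi t) - a q)"
          unfolding p(1) by (rule sg)
        then show ?thesis using z le[OF p(3)] 2 by (simp add: algebra_simps)
      qed
      then show ?thesis by blast
    qed
  }
qed

lemma share_edgeE:
  assumes "share_edge s t" "s \<in> tiles" "t \<in> tiles" "s \<noteq> t"
  obtains Z q where "q \<notin> Z" "left_tile Z q s" "right_tile Z q t" | Z q where "q \<notin> Z" "left_tile Z q t" "right_tile Z q s"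
proof -
  obtain e where e: "e \<in> edges s" "e \<in> edges t" using assms(1) unfolding share_edge_def by blast
  obtain Z q where Z: "e = (Z, insert q Z)" "q \<notin> Z" "left_tile Z q s \<or> right_tile Z q s"
    by (rule edgesE[OF assms(2) e(1)])
  have "left_tile Z q t \<or> right_tile Z q t" using side_edges_iff[OF Z(2) assms(3)] e(2) Z(1) by blast
  moreover have "\<not> (left_tile Z q s \<and> left_tile Z q t)" "\<not> (right_tile Z q s \<and> right_tile Z q t)"
    using left_tile_unique[OF Z(2)] right_tile_unique[OF Z(2)] assms(4) by blast+
  ultimately consider "left_tile Z q s" "right_tile Z q t" | "left_tile Z q t" "right_tile Z q s" using Z(3) by blast
  then show ?thesis by cases (use that Z(2) in blast)+
qed

lemma T2:
  assumes a: "generic_slopes n a"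
  shows "tiling_T2 a white_tiles black_tiles"
  unfolding tiling_T2_def
proof (intro conjI ballI impI)
  fix s t assume s: "s \<in> white_tiles" "t \<in> white_tiles" "s \<noteq> t \<and> share_edge s t"
  have st: "s \<in> tiles" "t \<in> tiles" using s by auto
  show "\<not> overlap a s t"
    using s(3)[THEN conjunct2] st s(3)[THEN conjunct1]
  proof (cases rule: share_edgeE)
    case (1 Z q)
    then show ?thesis unfolding overlap_def
      using interiors_disjoint_sides[OF white_side(1)[OF a 1(1) s(1) 1(2)] white_side(2)[OF a 1(1) s(2) 1(3)]] by simp
  next
    case (2 Z q)
    then show ?thesis unfolding overlap_def
      using interiors_disjoint_sides[OF white_side(1)[OF a 2(1) s(2) 2(2)] white_side(2)[OF a 2(1) s(1) 2(3)]] by blast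
  qed
next
  fix s t assume s: "s \<in> white_tiles" "t \<in> black_tiles" "share_edge s t"
  have st: "s \<in> tiles" "t \<in> tiles" "s \<noteq> t" using s white_black_disjoint by auto
  have nb: "s \<notin> black_tiles" "t \<notin> white_tiles" using s white_black_disjoint by auto
  note tD = black_tilesD[OF s(2)]
  note is_t = tiles_is_tile[OF st(1)] tiles_is_tile[OF st(2)]
  have ext: "base s = base t \<Longrightarrow> lo t \<le> lo s \<and> hi s \<le> hi t" "top_v s = top_v t \<Longrightarrow> lo t \<le> lo s \<and> hi s \<le> hi t"
    using tD(3,4) tiles_labels[OF st(1)] unfolding lens_labels_def by auto
  \<comment> \<open>The common edge cannot be at the bottom of one tile and at the top of the other:
    both ends of a tile edge of this kind would be members, whereas terminal vertices are not. So
    the tiles share a bottom or a top, where the labels of the black tile are extreme.\<close>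
  have no: "\<not> (base s = Z \<and> top_v t = insert q Z \<and> (q = lo s \<or> q = hi s))"
    "\<not> (base t = Z \<and> top_v s = insert q Z \<and> (q = lo s \<or> q = hi s))" if "q \<notin> Z" for Z q
  proof -
    have "insert q Z \<in> D" if "base s = Z" "q = lo s \<or> q = hi s"
      using tiles_simple(3,4)[OF st(1)] that unfolding left_v_def right_v_def by auto
    then show "\<not> (base s = Z \<and> top_v t = insert q Z \<and> (q = lo s \<or> q = hi s))" using tD(2) by metis
    have "Z \<in> D" if "top_v s = insert q Z" "q = lo s \<or> q = hi s"
      using labelsD(4)[OF tiles_labels(3)[OF st(1)]] labelsD(4)[OF tiles_labels(4)[OF st(1)]] that \<open>q \<notin> Z\<close> by auto
    then show "\<not> (base t = Z \<and> top_v s = insert q Z \<and> (q = lo s \<or> q = hi s))" using tD(1) by metis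
  qed
  show "overlap a s t"
    using s(3) st
  proof (cases rule: share_edgeE)
    case (1 Z q)
    then have "(base s = base t \<or> top_v s = top_v t) \<and> hi s = hi t \<or> (base s = base t \<or> top_v s = top_v t) \<and> lo s = lo t"
      using nb no[OF 1(1)] unfolding left_tile_def right_tile_def by metis
    then show ?thesis using overlap_same_corner[OF a is_t] ext by metis
  next
    case (2 Z q)
    then have "(base s = base t \<or> top_v s = top_v t) \<and> hi s = hi t \<or> (base s = base t \<or> top_v s = top_v t) \<and> lo s = lo t"
      using nb no[OF 2(1)] unfolding left_tile_def right_tile_def by metis
    then show ?thesis using overlap_same_corner[OF a is_t] ext by metis
  qed
next
  fix s t assume s: "s \<in> black_tiles" "t \<in> black_tiles" "s \<noteq> t"
  show "\<not> share_edge s t"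
  proof
    assume "share_edge s t"
    then obtain e where e: "e \<in> edges s" "e \<in> edges t" unfolding share_edge_def by blast
    have st: "s \<in> tiles" "t \<in> tiles" using s by auto
    note D = tiles_simple(3,4)[OF st(1)] tiles_simple(3,4)[OF st(2)] black_tilesD(1,2)[OF s(1)] black_tilesD(1,2)[OF s(2)]
    have "base s \<noteq> base t" "top_v s \<noteq> top_v t" using black_tiles_eqI s by blast+
    then show False using e D unfolding edges_def bot_v_def by auto
  qed
qed

end

section \<open>Planar triangulations\<close>

text \<open>
  On a horizontal line the triangles cut out intervals whose left ends and right ends are the
  crossing points of the same edges, except for one boundary edge on either side; comparing the
  numbers of ends to the left of a point shows that the point is covered exactly once. Lines
  through a vertex are included by counting an edge as crossing if its lower end, but not its
  upper end, is on the line.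
\<close>
locale planar_triangulation =
  fixes Tr :: "('v \<times> 'v \<times> 'v) set" and px py :: "'v \<Rightarrow> real"
    and ymin ymax :: real and lft rgt :: "real \<Rightarrow> 'v \<times> 'v"
  fixes V E det crosses_down crosses_up
  defines "V \<equiv> {u. \<exists>v w. (u, v, w) \<in> Tr}"
    and "E \<equiv> {(u, v). \<exists>w. (u, v, w) \<in> Tr}"
    and "det \<equiv> \<lambda>u v w. (px v - px u) * (py w - py u) - (px w - px u) * (py v - py u)"
    and "crosses_down \<equiv> \<lambda>c (u, v). py v \<le> c \<and> c < py u"
    and "crosses_up \<equiv> \<lambda>c (u, v). py u \<le> c \<and> c < py v"
  assumes finite_Tr: "finite Tr"
    and rotate: "(u, v, w) \<in> Tr \<Longrightarrow> (v, w, u) \<in> Tr"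
    and ccw: "(u, v, w) \<in> Tr \<Longrightarrow> det u v w > 0"
    and apex_unique: "(u, v, w) \<in> Tr \<Longrightarrow> (u, v, w') \<in> Tr \<Longrightarrow> w = w'"
    and py_inj: "inj_on py V"
    and py_bounds: "z \<in> V \<Longrightarrow> ymin \<le> py z \<and> py z \<le> ymax"
    and lft: "ymin \<le> c \<Longrightarrow> c < ymax \<Longrightarrow>
      lft c \<in> E \<and> prod.swap (lft c) \<notin> E \<and> crosses_down c (lft c)"
    and lft_unique: "ymin \<le> c \<Longrightarrow> c < ymax \<Longrightarrow> e \<in> E \<Longrightarrow> prod.swap e \<notin> E \<Longrightarrow> crosses_down c e \<Longrightarrow> e = lft c"
    and rgt: "ymin \<le> c \<Longrightarrow> c < ymax \<Longrightarrow>
      rgt c \<in> E \<and> prod.swap (rgt c) \<notin> E \<and> crosses_up c (rgt c)"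
    and rgt_unique: "ymin \<le> c \<Longrightarrow> c < ymax \<Longrightarrow> e \<in> E \<Longrightarrow> prod.swap e \<notin> E \<Longrightarrow> crosses_up c e \<Longrightarrow> e = rgt c"
    and boundary_convex: "(u, v) \<in> E \<Longrightarrow> (v, u) \<notin> E \<Longrightarrow> z \<in> V \<Longrightarrow> det u v z \<ge> 0"
begin

section \<open>Barycentric weights on the triangles\<close>

definition inside :: "'v \<Rightarrow> 'v \<Rightarrow> 'v \<Rightarrow> ('v \<Rightarrow> real) \<Rightarrow> bool" where
  "inside u v w f \<longleftrightarrow> (u, v, w) \<in> Tr \<and> 0 \<le> f u \<and> 0 \<le> f v \<and> 0 \<le> f w \<and> f u + f v + f w = 1 \<and>
     (\<forall>z. z \<noteq> u \<and> z \<noteq> v \<and> z \<noteq> w \<longrightarrow> f z = 0)"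

text \<open>Points are represented by their weights on the vertices rather than by points of the
  plane, so that the same objects can be mapped to the plane and to the cube.\<close>

definition lifts :: "('v \<Rightarrow> real) set" where
  "lifts = {f. \<exists>u v w. inside u v w f}"

definition X :: "('v \<Rightarrow> real) \<Rightarrow> real" where "X f = (\<Sum>z\<in>V. f z * px z)"
definition Y :: "('v \<Rightarrow> real) \<Rightarrow> real" where "Y f = (\<Sum>z\<in>V. f z * py z)"

definition cut :: "real \<Rightarrow> 'v \<times> 'v \<Rightarrow> real" where
  "cut c = (\<lambda>(u, v). px u + (c - py u) * (px v - px u) / (py v - py u))"

lemma mem_V: "(u, v, w) \<in> Tr \<Longrightarrow> u \<in> V \<and> v \<in> V \<and> w \<in> V"
  using rotate unfolding V_def by blast

lemma finite_V: "finite V"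
proof -
  have "V \<subseteq> fst ` Tr" unfolding V_def by force
  then show ?thesis using finite_Tr finite_surj by blast
qed

lemma distinct: "(u, v, w) \<in> Tr \<Longrightarrow> u \<noteq> v \<and> v \<noteq> w \<and> u \<noteq> w"
  using ccw[of u v w] unfolding det_def by auto

lemma inside_rotate: "inside u v w f \<Longrightarrow> inside v w u f"
  unfolding inside_def using rotate by auto

lemma sum_supported:
  assumes t: "(u, v, w) \<in> Tr" and f: "\<And>z. z \<noteq> u \<Longrightarrow> z \<noteq> v \<Longrightarrow> z \<noteq> w \<Longrightarrow> f z = 0"
  shows "X f = f u * px u + f v * px v + f w * px w" "Y f = f u * py u + f v * py v + f w * py w"
proof -
  have "(\<Sum>z\<in>V. f z * g z) = f u * g u + f v * g v + f w * g w" for g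
  proof -
    have "(\<Sum>z\<in>V. f z * g z) = (\<Sum>z\<in>{u, v, w}. f z * g z)"
      by (rule sum.mono_neutral_right[OF finite_V]) (use mem_V[OF t] f in auto)
    also have "\<dots> = f u * g u + f v * g v + f w * g w" using distinct[OF t] by simp
    finally show ?thesis .
  qed
  then show "X f = f u * px u + f v * px v + f w * px w" "Y f = f u * py u + f v * py v + f w * py w"
    unfolding X_def Y_def by blast+
qed

lemma inside_XY:
  assumes "inside u v w f"
  shows "X f = f u * px u + f v * px v + f w * px w" "Y f = f u * py u + f v * py v + f w * py w"
  using sum_supported[of u v w f] assms unfolding inside_def by blast+

lemma same_triangle_inj:
  assumes f: "inside u v w f" and g: "inside u v w g" and XY: "X f = X g" "Y f = Y g"
  shows "f = g"
proof -
  have t: "(u, v, w) \<in> Tr" using f unfolding inside_def by blast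
  define b c where bc: "b = f v - g v" "c = f w - g w"
  have a: "f u - g u = - b - c" using f g unfolding inside_def bc by auto
  have x: "b * (px v - px u) + c * (px w - px u) = 0"
  proof -
    have "(f u - g u) * px u + b * px v + c * px w = 0"
      using XY(1) unfolding inside_XY(1)[OF f] inside_XY(1)[OF g] bc by (simp add: algebra_simps)
    then show ?thesis unfolding a by (simp add: algebra_simps)
  qed
  have y: "b * (py v - py u) + c * (py w - py u) = 0"
  proof -
    have "(f u - g u) * py u + b * py v + c * py w = 0"
      using XY(2) unfolding inside_XY(2)[OF f] inside_XY(2)[OF g] bc by (simp add: algebra_simps)
    then show ?thesis unfolding a by (simp add: algebra_simps)
  qed
  have "b * det u v w = (b * (px v - px u) + c * (px w - px u)) * (py w - py u)
      - (b * (py v - py u) + c * (py w - py u)) * (px w - px u)"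
    unfolding det_def by (simp add: algebra_simps)
  then have "b = 0" using x y ccw[OF t] by simp
  moreover have "c * det u v w = (b * (py v - py u) + c * (py w - py u)) * (px v - px u)
      - (b * (px v - px u) + c * (px w - px u)) * (py v - py u)"
    unfolding det_def by (simp add: algebra_simps)
  then have "c = 0" using x y ccw[OF t] by simp
  ultimately have "f u = g u" "f v = g v" "f w = g w" using a bc by auto
  then show ?thesis using f g unfolding inside_def by (metis ext)
qed

text \<open>Both sides are twice the signed area of the triangle formed by \<open>u\<close>,
  \<open>v\<close> and the point; replacing \<open>w\<close> by a point of weight \<open>f w\<close>
  scales \<open>det u v w\<close> by this weight.\<close>

lemma side_formula:
  assumes f: "inside u v w f" and ne: "py u \<noteq> py v"
  shows "(py u - py v) * (X f - cut (Y f) (u, v)) = f w * det u v w"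
proof -
  have fu: "f u = 1 - f v - f w" using f unfolding inside_def by auto
  have "(py u - py v) * (X f - cut (Y f) (u, v)) = (py u - py v) * (X f - px u) + (Y f - py u) * (px v - px u)"
    unfolding cut_def using ne by (simp add: field_simps)
  also have "\<dots> = f w * det u v w"
    unfolding inside_XY[OF f] det_def fu by (simp add: algebra_simps)
  finally show ?thesis .
qed

lemma edge_point:
  assumes t: "(u, v, w) \<in> Tr" and c: "py v \<le> c \<and> c \<le> py u \<or> py u \<le> c \<and> c \<le> py v" and ne: "py u \<noteq> py v"
  obtains f where "inside u v w f" "Y f = c" "X f = cut c (u, v)" "f w = 0"
proof -
  define s where "s = (c - py u) / (py v - py u)"
  have s: "0 \<le> s" "s \<le> 1" unfolding s_def using c ne by (auto simp: field_simps)
  define f where "f z = (if z = u then 1 - s else if z = v then s else 0)" for z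
  have i: "inside u v w f" unfolding inside_def f_def using t s distinct[OF t] by auto
  have d: "f u = 1 - s" "f v = s" "f w = 0" unfolding f_def using distinct[OF t] by auto
  have "s * (py v - py u) = c - py u" unfolding s_def using ne by simp
  then have "Y f = c" unfolding inside_XY[OF i] d by (simp add: algebra_simps)
  moreover have "cut c (u, v) = px u + s * (px v - px u)" unfolding cut_def s_def by simp
  then have "X f = cut c (u, v)" unfolding inside_XY[OF i] d by (simp add: algebra_simps)
  ultimately show ?thesis using that[OF i] d by blast
qed

lemma cut_swap: "cut c (prod.swap e) = cut c e" if "py (fst e) \<noteq> py (snd e)"
  using that unfolding cut_def by (cases e) (simp add: field_simps)

lemma E_I: "(u, v, w) \<in> Tr \<Longrightarrow> (u, v) \<in> E" unfolding E_def by blast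

section \<open>Crossings of a horizontal line\<close>

definition Down where "Down c = {e \<in> E. crosses_down c e}"
definition Up where "Up c = {e \<in> E. crosses_up c e}"

lemma finite_E: "finite E"
proof -
  have "E \<subseteq> (\<lambda>(u, v, w). (u, v)) ` Tr" unfolding E_def by force
  then show ?thesis using finite_Tr finite_surj by blast
qed

definition apex where "apex e = (THE w. (fst e, snd e, w) \<in> Tr)"

lemma apex: "(u, v, w) \<in> Tr \<Longrightarrow> apex (u, v) = w"
  unfolding apex_def using apex_unique by (auto intro: the_equality)

lemma E_apex: "e \<in> E \<Longrightarrow> (fst e, snd e, apex e) \<in> Tr"
  using apex unfolding E_def by fastforce

text \<open>The triangle to the right of a down-edge crossing the line at height \<open>c\<close> is left through \<open>across c e\<close>.\<close>
definition across where
  "across c e = (if py (apex e) \<le> c then (apex e, fst e) else (snd e, apex e))"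

definition across_back where
  "across_back c e = (if py (apex e) \<le> c then (snd e, apex e) else (apex e, fst e))"

lemma across_Up: "e \<in> Down c \<Longrightarrow> across c e \<in> Up c \<and> across_back c (across c e) = e"
proof -
  assume e: "e \<in> Down c"
  obtain u v where uv: "e = (u, v)" by (cases e) auto
  define w where "w = apex e"
  have t: "(u, v, w) \<in> Tr" using E_apex e uv unfolding Down_def w_def by auto
  have c: "py v \<le> c" "c < py u" using e uv unfolding Down_def crosses_down_def by auto
  note t' = rotate[OF t] rotate[OF rotate[OF t]]
  show ?thesis
  proof (cases "py w \<le> c")
    case True
    then have "across c e = (w, u)" unfolding across_def using w_def uv by simp
    moreover have "apex (w, u) = v" using apex[OF t'(2)] .
    ultimately show ?thesis using True c uv E_I[OF t'(2)] unfolding Up_def crosses_up_def across_back_def by simp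
  next
    case False
    then have "across c e = (v, w)" unfolding across_def using w_def uv by simp
    moreover have "apex (v, w) = u" using apex[OF t'(1)] .
    ultimately show ?thesis using False c uv E_I[OF t'(1)] unfolding Up_def crosses_up_def across_back_def by simp
  qed
qed

lemma across_back_Down: "e \<in> Up c \<Longrightarrow> across_back c e \<in> Down c \<and> across c (across_back c e) = e"
proof -
  assume e: "e \<in> Up c"
  obtain u v where uv: "e = (u, v)" by (cases e) auto
  define w where "w = apex e"
  have t: "(u, v, w) \<in> Tr" using E_apex e uv unfolding Up_def w_def by auto
  have c: "py u \<le> c" "c < py v" using e uv unfolding Up_def crosses_up_def by auto
  note t' = rotate[OF t] rotate[OF rotate[OF t]]
  show ?thesis
  proof (cases "py w \<le> c")
    case True
    then have "across_back c e = (v, w)" unfolding across_back_def using w_def uv by simp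
    moreover have "apex (v, w) = u" using apex[OF t'(1)] .
    ultimately show ?thesis using True c uv E_I[OF t'(1)] unfolding Down_def crosses_down_def across_def by simp
  next
    case False
    then have "across_back c e = (w, u)" unfolding across_back_def using w_def uv by simp
    moreover have "apex (w, u) = v" using apex[OF t'(2)] .
    ultimately show ?thesis using False c uv E_I[OF t'(2)] unfolding Down_def crosses_down_def across_def by simp
  qed
qed

lemma across_bij: "bij_betw (across c) (Down c) (Up c)"
  by (rule bij_betw_byWitness[of _ "across_back c"]) (use across_Up across_back_Down in auto)

lemma across_side:
  assumes d: "(u, v) \<in> Down c" and f: "inside u v w f" "Y f = c"
  shows "X f \<le> cut c (across c (u, v))"
proof -
  have c: "py v \<le> c" "c < py u" using d unfolding Down_def crosses_down_def by auto
  have t: "(u, v, w) \<in> Tr" using f unfolding inside_def by blast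
  have *: "X f \<le> cut c (p, q)" if i: "inside p q r f" and lt: "py p < py q" for p q r
  proof -
    have "(py p - py q) * (X f - cut c (p, q)) = f r * det p q r" using side_formula[OF i] lt f(2) by simp
    moreover have "0 \<le> f r * det p q r" using i ccw[of p q r] unfolding inside_def by simp
    ultimately have "0 \<le> (py p - py q) * (X f - cut c (p, q))" by simp
    then show ?thesis using lt by (auto simp: zero_le_mult_iff)
  qed
  show ?thesis
  proof (cases "py w \<le> c")
    case True
    then show ?thesis unfolding across_def
      using apex[OF t] c *[OF inside_rotate[OF inside_rotate[OF f(1)]]] by simp
  next
    case False
    then show ?thesis unfolding across_def using apex[OF t] c *[OF inside_rotate[OF f(1)]] by simp
  qed
qed

lemma down_side:
  assumes d: "(u, v) \<in> Down c" and f: "inside u v w f" "Y f = c"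
  shows "cut c (u, v) \<le> X f" "f w > 0 \<Longrightarrow> cut c (u, v) < X f" "f w = 0 \<Longrightarrow> X f = cut c (u, v)"
proof -
  have c: "py u - py v > 0" using d unfolding Down_def crosses_down_def by auto
  have dt: "det u v w > 0" using ccw f unfolding inside_def by blast
  have e: "(py u - py v) * (X f - cut c (u, v)) = f w * det u v w" using side_formula[OF f(1)] c f(2) by simp
  have "0 \<le> f w" using f unfolding inside_def by simp
  then have "0 \<le> (py u - py v) * (X f - cut c (u, v))" unfolding e using dt by simp
  then show "cut c (u, v) \<le> X f" using c by (simp add: zero_le_mult_iff)
  show "cut c (u, v) < X f" if "f w > 0"
  proof -
    have "0 < (py u - py v) * (X f - cut c (u, v))" unfolding e using dt that by simp
    then show ?thesis using c by (simp add: zero_less_mult_iff)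
  qed
  show "X f = cut c (u, v)" if "f w = 0" using e that c by simp
qed

lemma cut_across_le: "e \<in> Down c \<Longrightarrow> cut c e \<le> cut c (across c e)"
proof -
  assume e: "e \<in> Down c"
  obtain u v where uv: "e = (u, v)" by (cases e) auto
  have t: "(u, v, apex e) \<in> Tr" using E_apex e uv unfolding Down_def by auto
  have c: "py v \<le> c" "c < py u" using e uv unfolding Down_def crosses_down_def by auto
  obtain f where f: "inside u v (apex e) f" "Y f = c" "X f = cut c (u, v)" using edge_point[OF t, of c] c by auto
  then show ?thesis using across_side[of u v c, OF _ f(1,2)] e uv by simp
qed

lemma slab_point:
  assumes e: "e \<in> Down c" and x: "cut c e \<le> x" "x \<le> cut c (across c e)"
  obtains f where "inside (fst e) (snd e) (apex e) f" "X f = x" "Y f = c"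
proof -
  obtain u v where uv: "e = (u, v)" by (cases e) auto
  define w where "w = apex e"
  have t: "(u, v, w) \<in> Tr" using E_apex e uv unfolding Down_def w_def by auto
  have c: "py v \<le> c" "c < py u" using e uv unfolding Down_def crosses_down_def by auto
  obtain f where f: "inside u v w f" "Y f = c" "X f = cut c e" using edge_point[OF t, of c] c uv by auto
  obtain g where g: "inside u v w g" "Y g = c" "X g = cut c (across c e)"
  proof (cases "py w \<le> c")
    case True
    have "across c e = (w, u)" unfolding across_def using w_def uv True by simp
    moreover obtain g where "inside w u v g" "Y g = c" "X g = cut c (w, u)"
      using edge_point[OF rotate[OF rotate[OF t]], of c] c True by auto
    ultimately show ?thesis using that inside_rotate by metis
  next
    case False
    have "across c e = (v, w)" unfolding across_def using w_def uv False by simp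
    moreover obtain g where "inside v w u g" "Y g = c" "X g = cut c (v, w)"
      using edge_point[OF rotate[OF t], of c] c False by auto
    ultimately show ?thesis using that inside_rotate by metis
  qed
  have "\<exists>s. 0 \<le> s \<and> s \<le> 1 \<and> x = (1 - s) * cut c e + s * cut c (across c e)"
  proof (cases "cut c e = cut c (across c e)")
    case True then show ?thesis using x by (intro exI[of _ 0]) auto
  next
    case False
    then have lt: "cut c e < cut c (across c e)" using x by simp
    define s where "s = (x - cut c e) / (cut c (across c e) - cut c e)"
    have "0 \<le> s" "s \<le> 1" unfolding s_def using x lt by (auto simp: field_simps)
    moreover have "s * (cut c (across c e) - cut c e) = x - cut c e" unfolding s_def using lt by simp
    then have "x = (1 - s) * cut c e + s * cut c (across c e)" by (simp add: algebra_simps)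
    ultimately show ?thesis by blast
  qed
  then obtain s where s: "0 \<le> s" "s \<le> 1" "x = (1 - s) * cut c e + s * cut c (across c e)" by blast
  define h where "h z = (1 - s) * f z + s * g z" for z
  have "h u + h v + h w = (1 - s) * (f u + f v + f w) + s * (g u + g v + g w)" unfolding h_def by (simp add: algebra_simps)
  then have h: "inside u v w h" using f(1) g(1) s(1,2) unfolding inside_def by (simp add: h_def)
  have "X h = (1 - s) * X f + s * X g"
    unfolding inside_XY[OF h] inside_XY[OF f(1)] inside_XY[OF g(1)] h_def by (simp add: algebra_simps)
  moreover have "Y h = (1 - s) * Y f + s * Y g"
    unfolding inside_XY[OF h] inside_XY[OF f(1)] inside_XY[OF g(1)] h_def by (simp add: algebra_simps)
  ultimately show ?thesis using that[of h] h s(3) f g uv w_def by (simp add: algebra_simps)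
qed

context
  fixes c :: real
  assumes c: "ymin \<le> c" "c < ymax"
begin

text \<open>An edge shared by two triangles is run through in opposite directions, down in the right
  one and up in the left one. Only the two boundary edges that meet the line have no
  partner.\<close>

lemma Up_Down: "Up c = prod.swap ` (Down c - {lft c}) \<union> {rgt c}" "rgt c \<notin> prod.swap ` (Down c - {lft c})" "lft c \<in> Down c"
proof -
  have sw: "crosses_up c (prod.swap e) \<longleftrightarrow> crosses_down c e" for e
    unfolding crosses_up_def crosses_down_def by (cases e) auto
  have sw': "crosses_down c (prod.swap e) \<longleftrightarrow> crosses_up c e" for e
    unfolding crosses_up_def crosses_down_def by (cases e) auto
  note l = lft[OF c] and r = rgt[OF c]
  show "lft c \<in> Down c" unfolding Down_def using l by blast
  show "rgt c \<notin> prod.swap ` (Down c - {lft c})"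
  proof
    assume "rgt c \<in> prod.swap ` (Down c - {lft c})"
    then obtain e where "e \<in> E" "rgt c = prod.swap e" unfolding Down_def by blast
    then show False using r by simp
  qed
  show "Up c = prod.swap ` (Down c - {lft c}) \<union> {rgt c}"
  proof (intro subset_antisym subsetI)
    fix e assume e: "e \<in> Up c"
    show "e \<in> prod.swap ` (Down c - {lft c}) \<union> {rgt c}"
    proof (cases "prod.swap e \<in> E")
      case True
      then have "prod.swap e \<in> Down c" using e sw' unfolding Up_def Down_def by blast
      moreover have "prod.swap e \<noteq> lft c" using l e unfolding Up_def by (metis (no_types, lifting) mem_Collect_eq swap_swap)
      moreover have "e = prod.swap (prod.swap e)" by simp
      ultimately show ?thesis by blast
    next
      case False
      then show ?thesis using rgt_unique[OF c] e unfolding Up_def by blast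
    qed
  next
    fix e assume "e \<in> prod.swap ` (Down c - {lft c}) \<union> {rgt c}"
    then show "e \<in> Up c"
    proof
      assume "e \<in> prod.swap ` (Down c - {lft c})"
      then obtain d where d: "d \<in> Down c" "d \<noteq> lft c" "e = prod.swap d" by blast
      then have "prod.swap d \<in> E" using lft_unique[OF c] unfolding Down_def by blast
      then show ?thesis using d sw unfolding Up_def Down_def by blast
    next
      assume "e \<in> {rgt c}" then show ?thesis unfolding Up_def using r by blast
    qed
  qed
qed

text \<open>The intervals are half-open, so those containing \<open>x\<close> are counted by the
  left ends below \<open>x\<close> minus the right ends below \<open>x\<close>. Reversing edges
  matches right ends with left ends, and only the two boundary crossings survive.\<close>

lemma count:
  "int (card {e \<in> Down c. cut c e < x \<and> x \<le> cut c (across c e)}) =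
    (if cut c (lft c) < x then 1 else 0) - (if cut c (rgt c) < x then 1 else 0)"
proof -
  have fD: "finite (Down c)" unfolding Down_def using finite_E by simp
  let ?A = "{e \<in> Down c. cut c e < x}" and ?B = "{e \<in> Down c. cut c (across c e) < x}"
  have BA: "?B \<subseteq> ?A"
  proof
    fix e assume "e \<in> ?B"
    then show "e \<in> ?A" using cut_across_le[of e c] by auto
  qed
  have "{e \<in> Down c. cut c e < x \<and> x \<le> cut c (across c e)} = ?A - ?B" by auto
  then have 1: "int (card {e \<in> Down c. cut c e < x \<and> x \<le> cut c (across c e)}) = int (card ?A) - int (card ?B)"
    using card_Diff_subset[OF finite_subset[OF BA] BA] card_mono[OF _ BA] fD by (simp add: of_nat_diff)
  have "bij_betw (across c) ?B {e \<in> Up c. cut c e < x}"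
    using across_bij[of c] unfolding bij_betw_def inj_on_def by blast
  then have 2: "card ?B = card {e \<in> Up c. cut c e < x}" by (rule bij_betw_same_card)
  have ne: "cut c (prod.swap e) = cut c e" if "e \<in> Down c" for e
    using that cut_swap[of e] unfolding Down_def crosses_down_def by (cases e) auto
  let ?C = "{e \<in> Down c - {lft c}. cut c e < x}"
  have "{e \<in> Up c. cut c e < x} = prod.swap ` ?C \<union> (if cut c (rgt c) < x then {rgt c} else {})"
    unfolding Up_Down(1) using ne by auto
  moreover have "(prod.swap ` ?C) \<inter> (if cut c (rgt c) < x then {rgt c} else {}) = {}" using Up_Down(2) by auto
  ultimately have "card {e \<in> Up c. cut c e < x} = card (prod.swap ` ?C) + card (if cut c (rgt c) < x then {rgt c} else {})"
    using card_Un_disjoint[of "prod.swap ` ?C" "if cut c (rgt c) < x then {rgt c} else {}"] fD by simp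
  moreover have "card (prod.swap ` ?C) = card ?C" by (rule card_image) (simp add: inj_on_def)
  moreover have "card ?A = card ?C + (if cut c (lft c) < x then 1 else 0)"
  proof (cases "cut c (lft c) < x")
    case True
    then have "?A = insert (lft c) ?C" using Up_Down(3) by auto
    then show ?thesis using fD True by simp
  next
    case False
    then have "?A = ?C" by auto
    then show ?thesis using False by simp
  qed
  ultimately show ?thesis using 1 2 by simp
qed

lemma slab_unique:
  assumes "d \<in> Down c" "cut c d < x" "x \<le> cut c (across c d)" "e \<in> Down c" "cut c e < x" "x \<le> cut c (across c e)"
  shows "d = e" "cut c (lft c) < x"
proof -
  let ?S = "{e \<in> Down c. cut c e < x \<and> x \<le> cut c (across c e)}"
  have f: "finite ?S" unfolding Down_def using finite_E by simp
  have "int (card ?S) \<le> 1" unfolding count by simp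
  then have "card ?S \<le> 1" by simp
  then have "\<forall>a\<in>?S. \<forall>b\<in>?S. a = b" using card_le_Suc0_iff_eq[OF f] by simp
  moreover have "d \<in> ?S" "e \<in> ?S" using assms by auto
  ultimately show "d = e" by blast
  have "?S \<noteq> {}" using \<open>d \<in> ?S\<close> by blast
  then have "card ?S > 0" using f by (meson card_gt_0_iff)
  then have "int (card ?S) > 0" by simp
  then show "cut c (lft c) < x" unfolding count by (auto split: if_splits)
qed

lemma slab_exists:
  assumes "cut c (lft c) \<le> x" "x \<le> cut c (rgt c)"
  shows "\<exists>f\<in>lifts. X f = x \<and> Y f = c"
proof -
  have "\<exists>e\<in>Down c. cut c e \<le> x \<and> x \<le> cut c (across c e)"
  proof (cases "cut c (lft c) < x")
    case True
    have "int (card {e \<in> Down c. cut c e < x \<and> x \<le> cut c (across c e)}) = 1"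
      unfolding count using True assms by simp
    then have "{e \<in> Down c. cut c e < x \<and> x \<le> cut c (across c e)} \<noteq> {}" by (metis card.empty of_nat_0 zero_neq_one)
    then show ?thesis by force
  next
    case False
    then show ?thesis using Up_Down(3) cut_across_le[OF Up_Down(3)] assms by (intro bexI[of _ "lft c"]) auto
  qed
  then obtain e where e: "e \<in> Down c" "cut c e \<le> x" "x \<le> cut c (across c e)" by blast
  obtain f where "inside (fst e) (snd e) (apex e) f" "X f = x" "Y f = c" by (rule slab_point[OF e])
  then show ?thesis unfolding lifts_def by blast
qed

end

section \<open>Every point is covered only once\<close>

definition vertex_lift where "vertex_lift f \<longleftrightarrow> (\<exists>z. f z = 1)"

lemma crossing:
  assumes f: "inside u v w f" and nv: "\<not> vertex_lift f"
  obtains u' v' w' where "inside u' v' w' f" "(u', v') \<in> Down (Y f)"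
proof -
  have t: "(u, v, w) \<in> Tr" using f unfolding inside_def by blast
  have s: "f u + f v + f w = 1" "0 \<le> f u" "0 \<le> f v" "0 \<le> f w" using f unfolding inside_def by auto
  have n1: "f u \<noteq> 1" "f v \<noteq> 1" "f w \<noteq> 1" using nv unfolding vertex_lift_def by auto
  have d: "py u \<noteq> py v" "py v \<noteq> py w" "py u \<noteq> py w"
    using py_inj mem_V[OF t] distinct[OF t] unfolding inj_on_def by blast+
  let ?c = "Y f"
  have Yf: "?c = f u * py u + f v * py v + f w * py w" using inside_XY(2)[OF f] .
  have e: "f u * (py u - ?c) + f v * (py v - ?c) + f w * (py w - ?c) = 0"
  proof -
    have "f u * (py u - ?c) + f v * (py v - ?c) + f w * (py w - ?c) =
      f u * py u + f v * py v + f w * py w - (f u + f v + f w) * ?c" by (simp add: algebra_simps)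
    then show ?thesis using s(1) Yf by simp
  qed
  have above: "?c < py u \<or> ?c < py v \<or> ?c < py w"
  proof (rule ccontr)
    assume "\<not> ?thesis"
    then have le: "py u - ?c \<le> 0" "py v - ?c \<le> 0" "py w - ?c \<le> 0" by auto
    then have "f u * (py u - ?c) \<le> 0" "f v * (py v - ?c) \<le> 0" "f w * (py w - ?c) \<le> 0"
      using s by (simp_all add: mult_nonneg_nonpos)
    then have "f u * (py u - ?c) = 0" "f v * (py v - ?c) = 0" "f w * (py w - ?c) = 0" using e by linarith+
    then have "f u = 0 \<or> py u = ?c" "f v = 0 \<or> py v = ?c" "f w = 0 \<or> py w = ?c" by auto
    then show False using d s n1 by auto
  qed
  have below: "py u \<le> ?c \<or> py v \<le> ?c \<or> py w \<le> ?c"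
  proof (rule ccontr)
    assume "\<not> ?thesis"
    then have gt: "py u - ?c > 0" "py v - ?c > 0" "py w - ?c > 0" by auto
    then have "0 \<le> f u * (py u - ?c)" "0 \<le> f v * (py v - ?c)" "0 \<le> f w * (py w - ?c)" using s by simp_all
    then have "f u * (py u - ?c) = 0" "f v * (py v - ?c) = 0" "f w * (py w - ?c) = 0" using e by linarith+
    then show False using gt s by auto
  qed
  have D: "(x, y) \<in> Down ?c" if "(x, y, z) \<in> Tr" "?c < py x" "py y \<le> ?c" for x y z
    unfolding Down_def crosses_down_def using that E_I by auto
  note r = rotate[OF t] rotate[OF rotate[OF t]]
  note fr = inside_rotate[OF f] inside_rotate[OF inside_rotate[OF f]]
  consider "?c < py u \<and> py v \<le> ?c" | "?c < py v \<and> py w \<le> ?c" | "?c < py w \<and> py u \<le> ?c"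
    using above below by linarith
  then show ?thesis
    by cases (use that[OF f] that[OF fr(1)] that[OF fr(2)] D[OF t] D[OF r(1)] D[OF r(2)] in auto)
qed

lemma Down_range: "(u, v) \<in> Down c \<Longrightarrow> ymin \<le> c \<and> c < ymax"
proof -
  assume d: "(u, v) \<in> Down c"
  then obtain w where "(u, v, w) \<in> Tr" unfolding Down_def E_def by blast
  then have "u \<in> V" "v \<in> V" using mem_V by auto
  then show ?thesis using py_bounds d unfolding Down_def crosses_down_def by fastforce
qed

text \<open>A point on the down-edge itself is missing from the half-open interval of its triangle.
  Unless the edge is on the left boundary, the same weights belong to the triangle across the edge,
  and there the point is the right end of the interval.\<close>

lemma nonvertex_cases:
  assumes f: "inside u v w f" and nv: "\<not> vertex_lift f" and d: "(u, v) \<in> Down (Y f)"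
  obtains (boundary) "inside (fst (lft (Y f))) (snd (lft (Y f))) (apex (lft (Y f))) f" "X f = cut (Y f) (lft (Y f))"
  | (slab) e where "e \<in> Down (Y f)" "inside (fst e) (snd e) (apex e) f" "cut (Y f) e < X f"
    "X f \<le> cut (Y f) (across (Y f) e)"
proof -
  let ?c = "Y f"
  have c: "ymin \<le> ?c" "?c < ymax" using Down_range[OF d] by auto
  have t: "(u, v, w) \<in> Tr" using f unfolding inside_def by blast
  have s: "f u + f v + f w = 1" "0 \<le> f u" "0 \<le> f v" "0 \<le> f w" using f unfolding inside_def by auto
  have n1: "f u \<noteq> 1" "f v \<noteq> 1" "f w \<noteq> 1" using nv unfolding vertex_lift_def by auto
  show ?thesis
  proof (cases "f w = 0")
    case False
    then have "cut ?c (u, v) < X f" using down_side(2)[OF d f] s by simp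
    moreover have "X f \<le> cut ?c (across ?c (u, v))" using across_side[OF d f refl] .
    ultimately show ?thesis using slab[OF d] apex[OF t] f by simp
  next
    case True
    have uv: "f u > 0" "f v > 0" using s n1 True by auto
    have x: "X f = cut ?c (u, v)" using down_side(3)[OF d f refl True] .
    show ?thesis
    proof (cases "(u, v) = lft ?c")
      case True
      then show ?thesis using boundary f x apex[OF t] by (metis fst_conv snd_conv)
    next
      case False
      then have "(v, u) \<in> E" using lft_unique[OF c, of "(u, v)"] d unfolding Down_def by auto
      then obtain w' where t': "(v, u, w') \<in> Tr" unfolding E_def by blast
      have cc: "py v \<le> ?c" "?c < py u" using d unfolding Down_def crosses_down_def by auto
      have vu: "(v, u) \<in> Up ?c" unfolding Up_def crosses_up_def using E_I[OF t'] cc by auto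
      have sw: "cut ?c (v, u) = cut ?c (u, v)" using cut_swap[of "(u, v)"] cc by simp
      have f': "inside v u w' f"
      proof -
        have "f z = 0" if "z \<noteq> v" "z \<noteq> u" for z using f that True unfolding inside_def by (cases "z = w") auto
        moreover have "f w' = 0" using calculation[of w'] distinct[OF t'] by auto
        ultimately show ?thesis unfolding inside_def using t' s True by auto
      qed
      note fr = inside_rotate[OF f'] inside_rotate[OF inside_rotate[OF f']]
      note tr = rotate[OF t'] rotate[OF rotate[OF t']]
      have e: "across_back ?c (v, u) \<in> Down ?c" "across ?c (across_back ?c (v, u)) = (v, u)"
        using across_back_Down[OF vu] by auto
      show ?thesis
      proof (cases "py w' \<le> ?c")
        case w': True
        then have ab: "across_back ?c (v, u) = (u, w')" unfolding across_back_def using apex[OF t'] by simp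
        show ?thesis
          by (rule slab[of "(u, w')"])
            (use e ab fr(1) apex[OF tr(1)] down_side(2)[OF _ fr(1) refl] uv x sw in auto)
      next
        case w': False
        then have ab: "across_back ?c (v, u) = (w', v)" unfolding across_back_def using apex[OF t'] by simp
        show ?thesis
          by (rule slab[of "(w', v)"])
            (use e ab fr(2) apex[OF tr(2)] down_side(2)[OF _ fr(2) refl] uv x sw in auto)
      qed
    qed
  qed
qed

lemma nonvertex_inj:
  assumes f: "f \<in> lifts" "\<not> vertex_lift f" and g: "g \<in> lifts" "\<not> vertex_lift g"
    and XY: "X f = X g" "Y f = Y g"
  shows "f = g"
proof -
  obtain u v w where f': "inside u v w f" "(u, v) \<in> Down (Y f)"
    using f crossing unfolding lifts_def by blast
  obtain u' v' w' where g': "inside u' v' w' g" "(u', v') \<in> Down (Y g)"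
    using g crossing unfolding lifts_def by blast
  have c: "ymin \<le> Y f" "Y f < ymax" using Down_range[OF f'(2)] by auto
  from f'(1) f(2) f'(2) show ?thesis
  proof (cases rule: nonvertex_cases)
    case fb: boundary
    from g'(1) g(2) g'(2) show ?thesis
    proof (cases rule: nonvertex_cases)
      case boundary
      then show ?thesis using same_triangle_inj fb XY by metis
    next
      case (slab e)
      note e = slab(1,3,4)[folded XY]
      show ?thesis using slab_unique(2)[OF c e e] fb(2) by simp
    qed
  next
    case fs: (slab d)
    from g'(1) g(2) g'(2) show ?thesis
    proof (cases rule: nonvertex_cases)
      case boundary
      then show ?thesis using slab_unique(2)[OF c fs(1,3,4) fs(1,3,4)] XY by simp
    next
      case (slab e)
      have "d = e" using slab_unique(1)[OF c fs(1,3,4) slab(1,3,4)[folded XY]] .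
      then show ?thesis using same_triangle_inj fs(2) slab(2) XY by blast
    qed
  qed
qed

lemma two_positive:
  assumes g: "inside u v w g" and nv: "\<not> vertex_lift g"
  obtains u' v' w' where "inside u' v' w' g" "g u' > 0" "g v' > 0"
proof -
  have s: "g u + g v + g w = 1" "0 \<le> g u" "0 \<le> g v" "0 \<le> g w" using g unfolding inside_def by auto
  have "g u \<noteq> 1" "g v \<noteq> 1" "g w \<noteq> 1" using nv unfolding vertex_lift_def by auto
  with s consider "g u > 0 \<and> g v > 0" | "g v > 0 \<and> g w > 0" | "g w > 0 \<and> g u > 0" by fastforce
  then show ?thesis
    by cases (use that[OF g] that[OF inside_rotate[OF g]] that[OF inside_rotate[OF inside_rotate[OF g]]] in blast)+
qed

text \<open>Twice the signed area of the triangle formed by \<open>u\<close>, \<open>v\<close> and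
  the image of \<open>h\<close>; up to the factor \<open>det u v w\<close>, it is a barycentric
  coordinate of this image.\<close>

definition area where "area u v h = (px v - px u) * (Y h - py u) - (X h - px u) * (py v - py u)"

lemma area_inside:
  assumes h: "inside p q r h" shows "area u v h = h p * det u v p + h q * det u v q + h r * det u v r"
proof -
  have e: "h p = 1 - h q - h r" using h unfolding inside_def by auto
  show ?thesis unfolding area_def inside_XY[OF h] det_def e by (simp add: algebra_simps)
qed

text \<open>If \<open>g\<close> lies on the edge from \<open>u\<close> to \<open>v\<close> and
  \<open>h\<close> beyond it, the triangle on the other side of the edge is taken. On a boundary
  edge this does not occur, because all vertices lie on its inner side.\<close>

lemma facing_triangle:
  assumes g: "inside u v w g" "g u > 0" "g v > 0" and h: "inside p q r h"
  obtains u' v' w' where "inside u' v' w' g" "g u' > 0" "g v' > 0" "g w' > 0 \<or> area u' v' h \<ge> 0"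
proof (cases "g w > 0 \<or> area u v h \<ge> 0")
  case True then show ?thesis using that g by blast
next
  case False
  have w0: "g w = 0" using False g unfolding inside_def by auto
  have t: "(u, v, w) \<in> Tr" using g unfolding inside_def by blast
  have "(v, u) \<in> E"
  proof (rule ccontr)
    assume "(v, u) \<notin> E"
    then have "det u v z \<ge> 0" if "z \<in> V" for z using boundary_convex[OF E_I[OF t]] that by blast
    moreover have "p \<in> V" "q \<in> V" "r \<in> V" using mem_V h unfolding inside_def by blast+
    ultimately have "area u v h \<ge> 0" unfolding area_inside[OF h] using h unfolding inside_def by simp
    then show False using False by blast
  qed
  then obtain w' where t': "(v, u, w') \<in> Tr" unfolding E_def by blast
  have z: "g z = 0" if "z \<noteq> v" "z \<noteq> u" for z using g that w0 unfolding inside_def by (cases "z = w") auto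
  have "g w' = 0" using z[of w'] distinct[OF t'] by auto
  then have "inside v u w' g" unfolding inside_def using t' z g(1) w0 unfolding inside_def by auto
  moreover have "area v u h = - area u v h" unfolding area_def by (simp add: algebra_simps)
  ultimately show ?thesis using that[of v u w'] g False by auto
qed

lemma eventually_pos_comb:
  fixes a b :: real assumes "a > 0"
  shows "\<forall>\<^sub>F s in at_right 0. 0 < (1 - s) * a + s * b"
proof (rule order_tendstoD(1))
  show "((\<lambda>s. (1 - s) * a + s * b) \<longlongrightarrow> (1 - 0) * a + 0 * b) (at_right 0)" by (intro tendsto_intros)
qed (use assms in simp)

text \<open>Both points are moved slightly towards the centroid \<open>h\<close> of a triangle at
  the vertex \<open>z\<close>. The moved points have equal images and are no vertices, so their
  weights agree by \<open>nonvertex_inj\<close>. Hence \<open>z\<close> is a corner of the other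
  triangle, and within one triangle the images already determine the weights.\<close>

lemma vertex_nonvertex:
  assumes f: "f \<in> lifts" "vertex_lift f" and g: "g \<in> lifts" "\<not> vertex_lift g"
    and XY: "X f = X g" "Y f = Y g"
  shows False
proof -
  obtain z where z: "f z = 1" using f unfolding vertex_lift_def by blast
  obtain p q r where "inside p q r f" using f unfolding lifts_def by blast
  moreover from this have "z = p \<or> z = q \<or> z = r" using z unfolding inside_def by (metis zero_neq_one)
  ultimately obtain q r where fi: "inside z q r f" using inside_rotate by metis
  have tz: "(z, q, r) \<in> Tr" using fi unfolding inside_def by blast
  have fz: "f y = (if y = z then 1 else 0)" for y
  proof -
    have "f q = 0" "f r = 0" using fi z unfolding inside_def by auto
    then show ?thesis using fi z unfolding inside_def by (cases "y = q"; cases "y = r") auto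
  qed
  define h where "h y = (if y = z \<or> y = q \<or> y = r then 1/3 else 0 :: real)" for y
  have h: "inside z q r h" unfolding inside_def h_def using tz distinct[OF tz] by auto
  obtain u0 v0 w0 where "inside u0 v0 w0 g" using g unfolding lifts_def by blast
  then obtain u1 v1 w1 where "inside u1 v1 w1 g" "g u1 > 0" "g v1 > 0" using two_positive g(2) by metis
  then obtain u v w where gi: "inside u v w g" "g u > 0" "g v > 0" "g w > 0 \<or> area u v h \<ge> 0"
    using facing_triangle[OF _ _ _ h] by metis
  have t: "(u, v, w) \<in> Tr" using gi unfolding inside_def by blast
  define d where "d = det u v w"
  have d: "d > 0" unfolding d_def using ccw[OF t] .
  \<comment> \<open>Barycentric coordinates of \<open>h\<close> with respect to \<open>u\<close>,
    \<open>v\<close>, \<open>w\<close>; they may be negative, since \<open>h\<close> need not lie in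
    this triangle.\<close>
  define bu bv bw where b: "bu = area v w h / d" "bv = area w u h / d" "bw = area u v h / d"
  have b1: "bu + bv + bw = 1"
  proof -
    have "area v w h + area w u h + area u v h = d" unfolding area_def d_def det_def by (simp add: algebra_simps)
    then show ?thesis unfolding b using d by (simp add: add_divide_distrib[symmetric])
  qed
  have bx: "bu * px u + bv * px v + bw * px w = X h"
  proof -
    have "area v w h * px u + area w u h * px v + area u v h * px w = X h * d"
      unfolding area_def d_def det_def by (simp add: algebra_simps)
    then show ?thesis unfolding b using d by (simp add: field_simps)
  qed
  have bY: "bu * py u + bv * py v + bw * py w = Y h"
  proof -
    have "area v w h * py u + area w u h * py v + area u v h * py w = Y h * d"
      unfolding area_def d_def det_def by (simp add: algebra_simps)
    then show ?thesis unfolding b using d by (simp add: field_simps)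
  qed
  have "\<forall>\<^sub>F s in at_right 0. 0 < s \<and> s < 1 \<and> 0 < (1 - s) * g u + s * bu \<and> 0 < (1 - s) * g v + s * bv \<and>
    0 \<le> (1 - s) * g w + s * bw"
  proof -
    have 1: "\<forall>\<^sub>F s::real in at_right 0. s \<in> {0<..<1}" by (rule eventually_at_right_real) simp
    have "\<forall>\<^sub>F s in at_right 0. 0 \<le> (1 - s) * g w + s * bw"
    proof (cases "g w > 0")
      case True
      show ?thesis by (rule eventually_mono[OF eventually_pos_comb[OF True, of bw]]) simp
    next
      case False
      then have "bw \<ge> 0" "g w = 0" using gi d unfolding b inside_def by auto
      then show ?thesis by (intro eventually_mono[OF 1]) simp
    qed
    then show ?thesis using 1 eventually_pos_comb[OF gi(2), of bu] eventually_pos_comb[OF gi(3), of bv]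
      by eventually_elim auto
  qed
  \<comment> \<open>For small \<open>s\<close> the two positive weights stay positive. The third one
    may start at \<open>0\<close>, and then the choice of the facing triangle prevents it from
    becoming negative.\<close>
  then obtain s where s: "0 < s" "s < 1" "0 < (1 - s) * g u + s * bu" "0 < (1 - s) * g v + s * bv"
    "0 \<le> (1 - s) * g w + s * bw"
    using eventually_happens'[OF trivial_limit_at_right_real] by blast
  define F where "F y = (1 - s) * f y + s * h y" for y
  define G where "G y = (if y = u then (1 - s) * g u + s * bu else if y = v then (1 - s) * g v + s * bv
    else if y = w then (1 - s) * g w + s * bw else 0)" for y
  have dz: "z \<noteq> q" "z \<noteq> r" "q \<noteq> r" using distinct[OF tz] by auto
  have Fv: "F z = 1 - 2 * s / 3" "F q = s / 3" "F r = s / 3" "\<And>y. y \<noteq> z \<Longrightarrow> y \<noteq> q \<Longrightarrow> y \<noteq> r \<Longrightarrow> F y = 0"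
    unfolding F_def h_def fz using dz by (auto simp: field_simps)
  have Fi: "inside z q r F" unfolding inside_def Fv using tz s Fv(4) by (auto simp: field_simps)
  have Fn: "\<not> vertex_lift F"
  proof
    assume "vertex_lift F"
    then obtain y where "F y = 1" unfolding vertex_lift_def by blast
    then show False using Fv s by (cases "y = z"; cases "y = q"; cases "y = r") auto
  qed
  have duv: "u \<noteq> v" "v \<noteq> w" "u \<noteq> w" using distinct[OF t] by auto
  have Gv: "G u = (1 - s) * g u + s * bu" "G v = (1 - s) * g v + s * bv" "G w = (1 - s) * g w + s * bw"
    "\<And>y. y \<noteq> u \<Longrightarrow> y \<noteq> v \<Longrightarrow> y \<noteq> w \<Longrightarrow> G y = 0"
    unfolding G_def using duv by auto
  have G1: "G u + G v + G w = 1"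
  proof -
    have "G u + G v + G w = (1 - s) * (g u + g v + g w) + s * (bu + bv + bw)" unfolding Gv by (simp add: algebra_simps)
    then show ?thesis using b1 gi(1) unfolding inside_def by simp
  qed
  have Gi: "inside u v w G" unfolding inside_def using t G1 Gv s by auto
  have Gn: "\<not> vertex_lift G"
  proof
    assume "vertex_lift G"
    then obtain y where y: "G y = 1" unfolding vertex_lift_def by blast
    have pos: "G u > 0" "G v > 0" "G w \<ge> 0" using s Gv by auto
    show False using y pos G1 Gv(4)[of y] by (cases "y = u"; cases "y = v"; cases "y = w") auto
  qed
  have "X F = (1 - s) * X f + s * X h" "Y F = (1 - s) * Y f + s * Y h"
    unfolding inside_XY[OF Fi] inside_XY[OF fi] inside_XY[OF h] F_def by (simp_all add: algebra_simps)
  moreover have "X G = (1 - s) * X g + s * X h" "Y G = (1 - s) * Y g + s * Y h"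
    unfolding inside_XY[OF Gi] inside_XY[OF gi(1)] bx[symmetric] bY[symmetric] Gv by (simp_all add: algebra_simps)
  ultimately have "F = G" using nonvertex_inj[OF _ Fn _ Gn] Fi Gi XY unfolding lifts_def by force
  then have "G z \<noteq> 0" using Fv(1) s by auto
  then have "z = u \<or> z = v \<or> z = w" using Gv(4) by blast
  then have "inside u v w f" unfolding inside_def using t fz duv by auto
  then have "f = g" using same_triangle_inj gi(1) XY by blast
  then show False using f g by simp
qed

lemma lifts_inj:
  assumes f: "f \<in> lifts" and g: "g \<in> lifts" and XY: "X f = X g" "Y f = Y g"
  shows "f = g"
proof (cases "vertex_lift f \<and> vertex_lift g")
  case False
  then show ?thesis using nonvertex_inj vertex_nonvertex f g XY by metis
next
  case True
  have *: "\<exists>z\<in>V. f = (\<lambda>y. if y = z then 1 else 0) \<and> Y f = py z" if f: "f \<in> lifts" "vertex_lift f" for f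
  proof -
    obtain z where z: "f z = 1" using f unfolding vertex_lift_def by blast
    obtain p q r where "inside p q r f" using f unfolding lifts_def by blast
    moreover from this have "z = p \<or> z = q \<or> z = r" using z unfolding inside_def by (metis zero_neq_one)
    ultimately obtain q r where fi: "inside z q r f" using inside_rotate by metis
    have qr: "f q = 0" "f r = 0" using fi z unfolding inside_def by auto
    then have "f y = (if y = z then 1 else 0)" for y
      using fi z unfolding inside_def by (cases "y = q"; cases "y = r") auto
    moreover have "Y f = py z" using inside_XY(2)[OF fi] z qr by simp
    moreover have "z \<in> V" using fi mem_V unfolding inside_def by blast
    ultimately show ?thesis by blast
  qed
  obtain z where z: "z \<in> V" "f = (\<lambda>y. if y = z then 1 else 0)" "Y f = py z" using *[OF f] True by blast
  obtain z' where z': "z' \<in> V" "g = (\<lambda>y. if y = z' then 1 else 0)" "Y g = py z'" using *[OF g] True by blast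
  have "z = z'" using z z' XY py_inj unfolding inj_on_def by metis
  then show ?thesis using z z' by simp
qed

lemma compact_simplex: "compact {(a, b, c). 0 \<le> a \<and> 0 \<le> b \<and> 0 \<le> c \<and> a + b + c = (1 :: real)}"
proof -
  have "{(a, b, c). 0 \<le> a \<and> 0 \<le> b \<and> 0 \<le> c \<and> a + b + c = (1 :: real)} =
    cbox (0, 0, 0) (1, 1, 1) \<inter> {p. fst p + fst (snd p) + snd (snd p) = 1}"
    by (auto simp: cbox_Pair_eq)
  moreover have "closed {p :: real \<times> real \<times> real. fst p + fst (snd p) + snd (snd p) = 1}"
    by (intro closed_Collect_eq continuous_intros)
  ultimately show ?thesis by (simp add: compact_Int_closed)
qed

text \<open>The set \<open>S\<close> pairs the plane image of each lift with its cube image. It is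
  compact, as a finite union of images of simplices, and both projections are continuous and
  injective on it, so both images are homeomorphic to \<open>S\<close>.\<close>

theorem lifts_homeomorphic_disc:
  fixes ind :: "'v \<Rightarrow> nat \<Rightarrow> real"
  defines "\<phi> \<equiv> \<lambda>f k. \<Sum>z\<in>V. f z * ind z k"
  assumes inj: "\<And>f g. f \<in> lifts \<Longrightarrow> g \<in> lifts \<Longrightarrow> \<phi> f = \<phi> g \<Longrightarrow> f = g"
    and P: "(\<lambda>f. (X f, Y f)) ` lifts = P" "convex P" "interior P \<noteq> {}"
  shows "(\<phi> ` lifts) homeomorphic cball (0 :: real \<times> real) 1"
proof -
  define S where "S = (\<lambda>f. ((X f, Y f), \<phi> f)) ` lifts"
  let ?\<Delta> = "{(a, b, c). 0 \<le> a \<and> 0 \<le> b \<and> 0 \<le> c \<and> a + b + c = (1 :: real)}"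
  define m where "m = (\<lambda>(u, v, w) (a :: real, b :: real, c :: real).
    ((a * px u + b * px v + c * px w, a * py u + b * py v + c * py w), \<lambda>k. a * ind u k + b * ind v k + c * ind w k))"
  have \<phi>: "\<phi> f = (\<lambda>k. f u * ind u k + f v * ind v k + f w * ind w k)" if f: "inside u v w f" for u v w f
  proof
    fix k
    have t: "(u, v, w) \<in> Tr" using f unfolding inside_def by blast
    have "\<phi> f k = (\<Sum>z\<in>{u, v, w}. f z * ind z k)" unfolding \<phi>_def
      by (rule sum.mono_neutral_right[OF finite_V]) (use mem_V[OF t] f in \<open>auto simp: inside_def\<close>)
    then show "\<phi> f k = f u * ind u k + f v * ind v k + f w * ind w k" using distinct[OF t] by simp
  qed
  have "S = (\<Union>t\<in>Tr. m t ` ?\<Delta>)"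
  proof (intro subset_antisym subsetI)
    fix x assume "x \<in> S"
    then obtain f u v w where f: "inside u v w f" "x = ((X f, Y f), \<phi> f)" unfolding S_def lifts_def by blast
    have "x = m (u, v, w) (f u, f v, f w)" unfolding f(2) inside_XY[OF f(1)] \<phi>[OF f(1)] m_def by simp
    moreover have "(f u, f v, f w) \<in> ?\<Delta>" "(u, v, w) \<in> Tr" using f unfolding inside_def by auto
    ultimately show "x \<in> (\<Union>t\<in>Tr. m t ` ?\<Delta>)" by blast
  next
    fix x assume "x \<in> (\<Union>t\<in>Tr. m t ` ?\<Delta>)"
    then obtain u v w a b c where t: "(u, v, w) \<in> Tr" "0 \<le> a" "0 \<le> b" "0 \<le> c" "a + b + c = 1" "x = m (u, v, w) (a, b, c)"
      by auto
    define f where "f z = (if z = u then a else if z = v then b else if z = w then c else 0)" for z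
    have f: "f u = a" "f v = b" "f w = c" unfolding f_def using distinct[OF t(1)] by auto
    have i: "inside u v w f" unfolding inside_def using t f by (auto simp: f_def)
    then have "x = ((X f, Y f), \<phi> f)" unfolding t(6) inside_XY[OF i] \<phi>[OF i] m_def f by simp
    then show "x \<in> S" unfolding S_def lifts_def using i by blast
  qed
  moreover have "compact (m t ` ?\<Delta>)" for t
  proof (rule compact_continuous_image[OF _ compact_simplex])
    obtain u v w where t: "t = (u, v, w)" by (cases t) auto
    show "continuous_on ?\<Delta> (m t)" unfolding t m_def case_prod_unfold fst_conv snd_conv
      by (intro continuous_on_Pair continuous_on_coordinatewise_then_product continuous_intros)
  qed
  ultimately have S: "compact S" using finite_Tr by (simp add: compact_UN)
  have "fst ` S = P" unfolding S_def P(1)[symmetric] image_image by simp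
  moreover have "inj_on fst S" unfolding S_def inj_on_def using lifts_inj by auto
  ultimately have h1: "S homeomorphic P"
    by (rule homeomorphic_compact[OF S continuous_on_fst[OF continuous_on_id]])
  have "snd ` S = \<phi> ` lifts" unfolding S_def image_image by simp
  moreover have "inj_on snd S" unfolding S_def inj_on_def using inj by auto
  ultimately have h2: "S homeomorphic (\<phi> ` lifts)"
    by (rule homeomorphic_compact[OF S continuous_on_snd[OF continuous_on_id]])
  have "compact P" using homeomorphic_compactness[OF h1] S by simp
  then have "P homeomorphic cball (0 :: real \<times> real) 1"
    using homeomorphic_convex_compact_cball[OF P(2) _ P(3)] by simp
  then show ?thesis using h1 h2 homeomorphic_sym homeomorphic_trans by metis
qed

end

section \<open>The disc formed by the tiles\<close>

definition three :: "nat set \<Rightarrow> bool" where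
  "three Q \<longleftrightarrow> (\<exists>i\<in>Q. \<exists>k\<in>Q. \<exists>j\<in>Q. i < k \<and> k < j)"

text \<open>Three labels are used instead of all of them, so that the centroid has denominator
  \<open>3\<close> for every number of labels and the coefficients become base \<open>4\<close>
  digits. Which inner label is chosen does not matter.\<close>

definition corner :: "nat set \<Rightarrow> nat set" where
  "corner Q = {Min Q, Max Q, (SOME k. k \<in> Q \<and> Min Q < k \<and> k < Max Q)}"

lemma cornerE:
  assumes "finite Q" "three Q"
  obtains i k j where "corner Q = {i, k, j}" "i < k" "k < j" "i \<in> Q" "k \<in> Q" "j \<in> Q" "lens_labels Q i j"
proof -
  obtain i k j where "i \<in> Q" "k \<in> Q" "j \<in> Q" "i < k" "k < j" using assms(2) unfolding three_def by blast
  then have l: "lens_labels Q (Min Q) (Max Q)" using lens_labels_MinMax[OF assms(1)] by blast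
  then have "\<exists>k. k \<in> Q \<and> Min Q < k \<and> k < Max Q" unfolding lens_labels_def by blast
  define m where "m = (SOME k. k \<in> Q \<and> Min Q < k \<and> k < Max Q)"
  have "m \<in> Q \<and> Min Q < m \<and> m < Max Q" unfolding m_def by (rule someI_ex) fact
  moreover have "corner Q = {Min Q, m, Max Q}" unfolding corner_def m_def by auto
  ultimately show ?thesis using that l unfolding lens_labels_def by blast
qed

text \<open>Up to a positive factor a summand is the signed area of the parabola point of
  \<open>m\<close> against the chord from \<open>i\<close> to \<open>j\<close>, which is negative
  only for \<open>m\<close> strictly between them. Adjacent labels exclude this, and one of the
  three corners differs from both.\<close>

lemma corner_adjacent:
  assumes Q: "finite Q" "three Q" and a: "adjacent Q i j"
  shows "0 < (\<Sum>m\<in>corner Q. ((4::real)^i - 4^m) * (4^j - 4^m))"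
proof -
  obtain p k q where c: "corner Q = {p, k, q}" "p < k" "k < q" "p \<in> Q" "k \<in> Q" "q \<in> Q" by (rule cornerE[OF Q])
  have ij: "i < j" using a unfolding adjacent_def by blast
  have pos: "0 < ((4::real)^i - 4^m) * (4^j - 4^m)" if "m \<in> Q" "m \<noteq> i" "m \<noteq> j" for m
  proof -
    have "m < i \<or> j < m" using a that unfolding adjacent_def by (metis linorder_cases)
    then show ?thesis
    proof
      assume "m < i"
      then have "(4::real)^m < 4^i" "(4::real)^m < 4^j" using ij by auto
      then show ?thesis by simp
    next
      assume "j < m"
      then have "(4::real)^i < 4^m" "(4::real)^j < 4^m" using ij by auto
      then show ?thesis by (intro mult_neg_neg) auto
    qed
  qed
  have nn: "0 \<le> ((4::real)^i - 4^m) * (4^j - 4^m)" if "m \<in> corner Q" for m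
    using pos[of m] that c by (cases "m = i"; cases "m = j") auto
  have "\<exists>m\<in>corner Q. m \<noteq> i \<and> m \<noteq> j" unfolding c(1) using c(2,3) ij
    by (metis insert_iff order_less_irrefl order_less_trans)
  then obtain m where m: "m \<in> corner Q" "m \<noteq> i" "m \<noteq> j" by blast
  then have "0 < ((4::real)^i - 4^m) * (4^j - 4^m)" using pos c by auto
  then show ?thesis using sum_pos2[of "corner Q" m "\<lambda>m. ((4::real)^i - 4^m) * (4^j - 4^m)"] m nn c(1) by auto
qed

text \<open>The extreme labels are corners and contribute \<open>0\<close>; the inner corner lies on
  the other side of the chord. This sign is what turns the black tile over.\<close>

lemma corner_lens:
  assumes Q: "finite Q" "three Q" and a: "lens_labels Q i j"
  shows "(\<Sum>m\<in>corner Q. ((4::real)^i - 4^m) * (4^j - 4^m)) < 0"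
proof -
  obtain p k q where c: "corner Q = {p, k, q}" "p < k" "k < q" "lens_labels Q p q" by (rule cornerE[OF Q])
  have e: "p = i" "q = j" using lens_labels_unique[OF c(4) a] by auto
  have "(4::real)^i < 4^k" "(4::real)^k < 4^j" using c e by auto
  then have "((4::real)^i - 4^k) * (4^j - 4^k) < 0" by (intro mult_neg_pos) auto
  then show ?thesis unfolding c(1) using c(2,3) e by simp
qed

lemma base4_unique:
  fixes d d' :: "nat \<Rightarrow> nat"
  assumes "\<And>i. d i \<le> 3" "\<And>i. d' i \<le> 3" "(\<Sum>i=1..n. d i * 4^i) = (\<Sum>i=1..n. d' i * 4^i)" "i \<in> {1..n}"
  shows "d i = d' i"
proof -
  have lt: "(\<Sum>i=1..n. d i * 4^i) < 4^Suc n" if "\<And>i. d i \<le> 3" for d :: "nat \<Rightarrow> nat" and n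
  proof (induction n)
    case (Suc n)
    have "(\<Sum>i=1..Suc n. d i * 4^i) = (\<Sum>i=1..n. d i * 4^i) + d (Suc n) * 4^Suc n" by simp
    also have "\<dots> < 4^Suc n + 3 * 4^Suc n" using Suc that[of "Suc n"] by (intro add_less_le_mono mult_right_mono) auto
    finally show ?case by simp
  qed simp
  show ?thesis using assms(3,4)
  proof (induction n)
    case (Suc n)
    have e: "(\<Sum>i=1..n. d i * 4^i) + d (Suc n) * 4^Suc n = (\<Sum>i=1..n. d' i * 4^i) + d' (Suc n) * 4^Suc n"
      using Suc.prems(1) by simp
    have "d (Suc n) = ((\<Sum>i=1..n. d i * 4^i) + d (Suc n) * 4^Suc n) div 4^Suc n"
      using lt[of d n, OF assms(1)] by simp
    also have "\<dots> = ((\<Sum>i=1..n. d' i * 4^i) + d' (Suc n) * 4^Suc n) div 4^Suc n" unfolding e ..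
    also have "\<dots> = d' (Suc n)" using lt[of d' n, OF assms(2)] by simp
    finally have top: "d (Suc n) = d' (Suc n)" .
    show ?case
    proof (cases "i = Suc n")
      case False
      then show ?thesis using Suc.IH Suc.prems(2) e top by auto
    qed (simp add: top)
  qed simp
qed

section \<open>Coordinates of the vertices and orientation of the half-tiles\<close>

context full_structure
begin

text \<open>
  The disc is drawn with the generators \<open>(16^i, 4^i)\<close>, which lie on a parabola, so that the sets
  \<open>insert i X\<close> with fixed \<open>X\<close> are in convex position. A terminal vertex is moved into the convex
  hull of its neighbours, namely to the centroid of three of them. Up to the factor \<open>1 / 3\<close> the
  coefficients are then base \<open>4\<close> digits, and all vertices have different heights.
\<close>
definition digit :: "nat set \<Rightarrow> nat \<Rightarrow> nat" where
  "digit z i =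
     (if z \<in> D then if i \<in> z then 3 else 0
      else if three (up_labels D z) then if i \<in> z then 3 else if i \<in> corner (up_labels D z) then 1 else 0
      else if i \<notin> z then 0 else if i \<in> corner (down_labels D z) then 2 else 3)"

definition pos :: "(nat \<Rightarrow> real) \<Rightarrow> nat set \<Rightarrow> real" where
  "pos g z = (\<Sum>i=1..n. real (digit z i) * g i) / 3"

abbreviation "px \<equiv> pos (\<lambda>i. 4^i * 4^i)"
abbreviation "py \<equiv> pos (\<lambda>i. 4^i)"

lemma digit_le: "digit z i \<le> 3" unfolding digit_def by simp

text \<open>Digits of elements are \<open>2\<close> or \<open>3\<close>, all others \<open>0\<close>
  or \<open>1\<close>, so a set can be read off from its digits even if it has been moved.\<close>

lemma digit_mem: "2 \<le> digit z i \<longleftrightarrow> i \<in> z" unfolding digit_def by auto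

lemma corner_subset: "finite Q \<Longrightarrow> three Q \<Longrightarrow> corner Q \<subseteq> Q"
  by (rule cornerE) auto

lemma pos_mem:
  assumes "z \<in> D" shows "pos g z = (\<Sum>i\<in>z. g i)"
proof -
  have z: "z \<subseteq> {1..n}" using sub assms by blast
  have "(\<Sum>i=1..n. real (digit z i) * g i) = (\<Sum>i=1..n. if i \<in> z then 3 * g i else 0)"
    by (rule sum.cong) (use assms in \<open>auto simp: digit_def\<close>)
  also have "\<dots> = (\<Sum>i\<in>z. 3 * g i)" using z by (simp add: sum.inter_restrict[symmetric] Int_absorb1)
  finally show ?thesis unfolding pos_def by (simp add: sum_distrib_left[symmetric])
qed

lemma pos_bottom:
  assumes z: "z \<notin> D" "three (up_labels D z)"
  shows "pos g z = (\<Sum>i\<in>z. g i) + (\<Sum>i\<in>corner (up_labels D z). g i) / 3"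
proof -
  let ?c = "corner (up_labels D z)"
  have c: "?c \<subseteq> up_labels D z" using corner_subset[OF finite_labels'(1) z(2)] .
  have c1: "?c \<subseteq> {1..n}" using c up_labels_subset[OF sub] by blast
  obtain q where "q \<in> up_labels D z" using z(2) unfolding three_def by blast
  then have zn: "z \<subseteq> {1..n}" using labelsD(2) sub by blast
  have cz: "i \<notin> z" if "i \<in> ?c" for i using that c labelsD(1) by blast
  have "(\<Sum>i=1..n. real (digit z i) * g i) = (\<Sum>i=1..n. (if i \<in> z then 3 * g i else 0) + (if i \<in> ?c then g i else 0))"
    by (rule sum.cong) (use z cz in \<open>auto simp: digit_def\<close>)
  also have "\<dots> = (\<Sum>i\<in>z. 3 * g i) + (\<Sum>i\<in>?c. g i)"
    using zn c1 by (simp add: sum.distrib sum.inter_restrict[symmetric] Int_absorb1)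
  finally show ?thesis unfolding pos_def by (simp add: sum_distrib_left[symmetric] add_divide_distrib)
qed

lemma not_three_up: "z \<notin> D \<Longrightarrow> three (down_labels D z) \<Longrightarrow> \<not> three (up_labels D z)"
  using not_both_terminal unfolding three_def by blast

lemma pos_top:
  assumes z: "z \<notin> D" "three (down_labels D z)"
  shows "pos g z = (\<Sum>i\<in>z. g i) - (\<Sum>i\<in>corner (down_labels D z). g i) / 3"
proof -
  let ?c = "corner (down_labels D z)"
  have c: "?c \<subseteq> down_labels D z" using corner_subset[OF finite_labels'(2) z(2)] .
  have cz: "?c \<subseteq> z" using c labelsD(3) by blast
  obtain i j where "i \<in> down_labels D z" "j \<in> down_labels D z" "i \<noteq> j"
    using z(2) unfolding three_def by (metis order_less_irrefl)
  then have zn: "z \<subseteq> {1..n}" using down_labels_two_subset[OF sub] by blast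
  have c1: "?c \<subseteq> {1..n}" using cz zn by blast
  have "(\<Sum>i=1..n. real (digit z i) * g i) = (\<Sum>i=1..n. (if i \<in> z then 3 * g i else 0) - (if i \<in> ?c then g i else 0))"
    by (rule sum.cong) (use z cz not_three_up[OF z] in \<open>auto simp: digit_def\<close>)
  also have "\<dots> = (\<Sum>i\<in>z. 3 * g i) - (\<Sum>i\<in>?c. g i)"
    using zn c1 by (simp add: sum_subtractf sum.inter_restrict[symmetric] Int_absorb1)
  finally show ?thesis unfolding pos_def by (simp add: sum_distrib_left[symmetric] diff_divide_distrib)
qed

lemma tile_sums:
  assumes t: "t \<in> tiles"
  shows "pos g (left_v t) = (\<Sum>i\<in>base t. g i) + g (lo t)" "pos g (right_v t) = (\<Sum>i\<in>base t. g i) + g (hi t)"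
    "(\<Sum>i\<in>top_v t. g i) = (\<Sum>i\<in>base t. g i) + g (lo t) + g (hi t)"
proof -
  note s = tiles_simple[OF t] and lt = tiles_labels(5)[OF t]
  have f: "finite (base t)" using ws_collection_finite_member[OF ws s(3)] unfolding left_v_def by simp
  show "pos g (left_v t) = (\<Sum>i\<in>base t. g i) + g (lo t)" "pos g (right_v t) = (\<Sum>i\<in>base t. g i) + g (hi t)"
    unfolding pos_mem[OF s(3)] pos_mem[OF s(4)] unfolding left_v_def right_v_def using s f by simp_all
  show "(\<Sum>i\<in>top_v t. g i) = (\<Sum>i\<in>base t. g i) + g (lo t) + g (hi t)"
    unfolding top_v_def using s f lt by simp
qed

definition turn :: "nat set \<Rightarrow> nat set \<Rightarrow> nat set \<Rightarrow> real" where
  "turn u v w = (px v - px u) * (py w - py u) - (px w - px u) * (py v - py u)"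

text \<open>The signed area against a fixed chord is an affine function of the third point, so its
  value at the centroid is the mean of its values at the three corners.\<close>

lemma corner_expand:
  assumes "finite Q" "three Q"
  shows "(\<Sum>m\<in>corner Q. (a - 4^m) * (b - 4^m)) / 3 =
    a * b - (a + b) * ((\<Sum>m\<in>corner Q. 4^m) / 3) + (\<Sum>m\<in>corner Q. (4::real)^m * 4^m) / 3"
proof -
  obtain p k q where c: "corner Q = {p, k, q}" "p < k" "k < q" by (rule cornerE[OF assms])
  then have d: "p \<noteq> k" "k \<noteq> q" "p \<noteq> q" by auto
  show ?thesis unfolding c(1) using d by (simp add: field_simps)
qed

lemma white_three:
  assumes "t \<in> white_tiles"
  shows "base t \<notin> D \<Longrightarrow> three (up_labels D (base t))" "top_v t \<notin> D \<Longrightarrow> three (down_labels D (top_v t))"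
proof -
  note tl = tiles_labels[of t]
  show "three (up_labels D (base t))" if "base t \<notin> D"
    using white_tilesD(1)[OF assms] that three_distinct[of "lo t" "up_labels D (base t)" "hi t"] tl assms
    unfolding white_pair_def three_def by blast
  show "three (down_labels D (top_v t))" if "top_v t \<notin> D"
    using white_tilesD(2)[OF assms] that three_distinct[of "lo t" "down_labels D (top_v t)" "hi t"] tl assms
    unfolding co_white_pair_def three_def by blast
qed

lemma black_three:
  assumes "t \<in> black_tiles"
  shows "three (up_labels D (base t))" "three (down_labels D (top_v t))"
  using black_tiles_three[OF assms] unfolding three_def .

text \<open>\<open>(dx, dy)\<close> is the displacement of the bottom. The second factor on the
  right is affine in it: it equals \<open>a * b\<close> without displacement, and it is the mean
  over the corners in \<open>corner_expand\<close> if the bottom was moved to the centroid.\<close>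

lemma turn_base:
  assumes t: "t \<in> tiles"
  defines "a \<equiv> (4::real)^lo t" and "b \<equiv> (4::real)^hi t"
    and "dx \<equiv> px (base t) - (\<Sum>i\<in>base t. 4^i * 4^i)" and "dy \<equiv> py (base t) - (\<Sum>i\<in>base t. 4^i)"
  shows "turn (base t) (right_v t) (left_v t) = (b - a) * (a * b - (a + b) * dy + dx)"
proof -
  have e: "px (base t) = (\<Sum>i\<in>base t. 4^i * 4^i) + dx" "py (base t) = (\<Sum>i\<in>base t. 4^i) + dy"
    unfolding dx_def dy_def by auto
  show ?thesis unfolding turn_def tile_sums(1,2)[OF t] e a_def b_def by (simp add: algebra_simps)
qed

lemma turn_top:
  assumes t: "t \<in> tiles"
  defines "a \<equiv> (4::real)^lo t" and "b \<equiv> (4::real)^hi t"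
    and "dx \<equiv> (\<Sum>i\<in>top_v t. 4^i * 4^i) - px (top_v t)" and "dy \<equiv> (\<Sum>i\<in>top_v t. 4^i) - py (top_v t)"
  shows "turn (top_v t) (left_v t) (right_v t) = (b - a) * (a * b - (a + b) * dy + dx)"
proof -
  have e: "px (top_v t) = (\<Sum>i\<in>base t. 4^i * 4^i) + a * a + b * b - dx" "py (top_v t) = (\<Sum>i\<in>base t. 4^i) + a + b - dy"
    unfolding dx_def dy_def tile_sums(3)[OF t] a_def b_def by auto
  show ?thesis unfolding turn_def tile_sums(1,2)[OF t] e unfolding a_def b_def by (simp add: algebra_simps)
qed

lemma turn_swap: "turn u w v = - turn u v w" unfolding turn_def by (simp add: algebra_simps)

lemma turn_rotate: "turn v w u = turn u v w" unfolding turn_def by (simp add: algebra_simps)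

lemma turn_white:
  assumes w: "t \<in> white_tiles"
  shows "turn (base t) (right_v t) (left_v t) > 0" "turn (top_v t) (left_v t) (right_v t) > 0"
proof -
  have t: "t \<in> tiles" using w by blast
  have ba: "(4::real)^hi t - 4^lo t > 0" using tiles_labels(5)[OF t] by simp
  show "turn (base t) (right_v t) (left_v t) > 0"
  proof (cases "base t \<in> D")
    case True
    then show ?thesis unfolding turn_base[OF t] pos_mem[OF True] using ba by simp
  next
    case False
    note th = white_three(1)[OF w False]
    have "0 < (\<Sum>m\<in>corner (up_labels D (base t)). ((4::real)^lo t - 4^m) * (4^hi t - 4^m))"
      by (rule corner_adjacent[OF finite_labels'(1) th white_tilesD(3)[OF w]])
    then show ?thesis unfolding turn_base[OF t] pos_bottom[OF False th]
      using corner_expand[OF finite_labels'(1) th, of "4^lo t" "4^hi t"] ba by simp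
  qed
  show "turn (top_v t) (left_v t) (right_v t) > 0"
  proof (cases "top_v t \<in> D")
    case True
    then show ?thesis unfolding turn_top[OF t] pos_mem[OF True] using ba by simp
  next
    case False
    note th = white_three(2)[OF w False]
    have "0 < (\<Sum>m\<in>corner (down_labels D (top_v t)). ((4::real)^lo t - 4^m) * (4^hi t - 4^m))"
      by (rule corner_adjacent[OF finite_labels'(2) th white_tilesD(4)[OF w]])
    then show ?thesis unfolding turn_top[OF t] pos_top[OF False th]
      using corner_expand[OF finite_labels'(2) th, of "4^lo t" "4^hi t"] ba by simp
  qed
qed

lemma turn_black:
  assumes w: "t \<in> black_tiles"
  shows "turn (base t) (left_v t) (right_v t) > 0" "turn (top_v t) (right_v t) (left_v t) > 0"
proof -
  have t: "t \<in> tiles" using w by blast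
  have ba: "(4::real)^hi t - 4^lo t > 0" using tiles_labels(5)[OF t] by simp
  note th = black_three[OF w] and nD = black_tilesD(1,2)[OF w]
  have "(\<Sum>m\<in>corner (up_labels D (base t)). ((4::real)^lo t - 4^m) * (4^hi t - 4^m)) < 0"
    by (rule corner_lens[OF finite_labels'(1) th(1) black_tilesD(3)[OF w]])
  then have neg: "4^lo t * 4^hi t - (4^lo t + 4^hi t) * ((\<Sum>m\<in>corner (up_labels D (base t)). 4^m) / 3)
      + (\<Sum>m\<in>corner (up_labels D (base t)). (4::real)^m * 4^m) / 3 < 0"
    using corner_expand[OF finite_labels'(1) th(1), of "4^lo t" "4^hi t"] by linarith
  have "turn (base t) (right_v t) (left_v t) < 0" unfolding turn_base[OF t] pos_bottom[OF nD(1) th(1)]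
    using mult_pos_neg[OF ba neg] by simp
  then show "turn (base t) (left_v t) (right_v t) > 0" using turn_swap[of "base t" "left_v t" "right_v t"] by linarith
  have "(\<Sum>m\<in>corner (down_labels D (top_v t)). ((4::real)^lo t - 4^m) * (4^hi t - 4^m)) < 0"
    by (rule corner_lens[OF finite_labels'(2) th(2) black_tilesD(4)[OF w]])
  then have neg: "4^lo t * 4^hi t - (4^lo t + 4^hi t) * ((\<Sum>m\<in>corner (down_labels D (top_v t)). 4^m) / 3)
      + (\<Sum>m\<in>corner (down_labels D (top_v t)). (4::real)^m * 4^m) / 3 < 0"
    using corner_expand[OF finite_labels'(2) th(2), of "4^lo t" "4^hi t"] by linarith
  have "turn (top_v t) (left_v t) (right_v t) < 0" unfolding turn_top[OF t] pos_top[OF nD(2) th(2)]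
    using mult_pos_neg[OF ba neg] by simp
  then show "turn (top_v t) (right_v t) (left_v t) > 0" using turn_swap[of "top_v t" "left_v t" "right_v t"] by linarith
qed

lemma py_inj: "inj_on py (Pow {1..n})"
proof (rule inj_onI)
  fix z z' assume z: "z \<in> Pow {1..n}" "z' \<in> Pow {1..n}" and e: "py z = py z'"
  have "real (\<Sum>i=1..n. digit z i * 4^i) = real (\<Sum>i=1..n. digit z' i * 4^i)" using e unfolding pos_def by simp
  then have "(\<Sum>i=1..n. digit z i * 4^i) = (\<Sum>i=1..n. digit z' i * 4^i)" by (simp only: of_nat_eq_iff)
  then have d: "digit z i = digit z' i" if "i \<in> {1..n}" for i
    using base4_unique[of "digit z" "digit z'" n i] digit_le that by blast
  have "i \<in> z \<longleftrightarrow> i \<in> z'" if "i \<in> {1..n}" for i using d[OF that] digit_mem[of z i] digit_mem[of z' i] by simp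
  then show "z = z'" using z by blast
qed

end

section \<open>The half-tiles as a triangulation\<close>

context full_structure
begin

definition disc_left :: "tile \<Rightarrow> nat set" where
  "disc_left t = (if t \<in> white_tiles then left_v t else right_v t)"

definition disc_right :: "tile \<Rightarrow> nat set" where
  "disc_right t = (if t \<in> white_tiles then right_v t else left_v t)"

text \<open>The two halves of a tile, cut along its horizontal diagonal, in counterclockwise order
  and with all three rotations.\<close>
definition tile_triangles :: "tile \<Rightarrow> (nat set \<times> nat set \<times> nat set) set" where
  "tile_triangles t =
     {(base t, disc_right t, disc_left t), (disc_right t, disc_left t, base t), (disc_left t, base t, disc_right t),
      (top_v t, disc_left t, disc_right t), (disc_left t, disc_right t, top_v t), (disc_right t, top_v t, disc_left t)}"

definition triangles :: "(nat set \<times> nat set \<times> nat set) set" where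
  "triangles = (\<Union>t\<in>tiles. tile_triangles t)"

lemma finite_triangles: "finite triangles"
  unfolding triangles_def tile_triangles_def using finite_tiles by auto

lemma triangles_rotate: "(u, v, w) \<in> triangles \<Longrightarrow> (v, w, u) \<in> triangles"
  unfolding triangles_def tile_triangles_def by auto

lemma triangles_ccw:
  assumes "(u, v, w) \<in> triangles" shows "turn u v w > 0"
proof -
  obtain t where t: "t \<in> tiles" "(u, v, w) \<in> tile_triangles t" using assms unfolding triangles_def by blast
  have b: "turn (base t) (disc_right t) (disc_left t) > 0" "turn (top_v t) (disc_left t) (disc_right t) > 0"
    unfolding disc_left_def disc_right_def using turn_white[of t] turn_black[of t] t(1) by auto
  have "turn (disc_right t) (disc_left t) (base t) > 0" "turn (disc_left t) (base t) (disc_right t) > 0"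
    "turn (disc_left t) (disc_right t) (top_v t) > 0" "turn (disc_right t) (top_v t) (disc_left t) > 0"
    using b turn_rotate[of "disc_right t" "disc_left t" "base t"] turn_rotate[of "disc_left t" "base t" "disc_right t"]
      turn_rotate[of "disc_left t" "disc_right t" "top_v t"] turn_rotate[of "disc_right t" "top_v t" "disc_left t"]
    by linarith+
  with b t(2) show ?thesis unfolding tile_triangles_def by auto
qed

lemma disc_sides:
  assumes "t \<in> tiles"
  shows "disc_left t = left_v t \<and> disc_right t = right_v t \<or> disc_left t = right_v t \<and> disc_right t = left_v t"
  unfolding disc_left_def disc_right_def by auto

lemma tile_inserts:
  assumes t: "t \<in> tiles"
  shows "left_v t = insert (lo t) (base t)" "right_v t = insert (hi t) (base t)"
    "top_v t = insert (hi t) (left_v t)" "top_v t = insert (lo t) (right_v t)"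
    "lo t \<notin> base t" "hi t \<notin> base t" "hi t \<notin> left_v t" "lo t \<notin> right_v t"
  using tiles_simple[OF t] tiles_labels(5)[OF t] unfolding left_v_def right_v_def top_v_def by auto

lemma insert_eq_insert: "q \<notin> Z \<Longrightarrow> h \<notin> Z \<Longrightarrow> insert q Z = insert h Z \<longleftrightarrow> q = h" by auto

lemma left_tile_iff:
  assumes q: "q \<notin> Z" and t: "t \<in> tiles"
  shows "left_tile Z q t \<longleftrightarrow> Z = base t \<and> insert q Z = disc_right t \<or> Z = disc_right t \<and> insert q Z = top_v t"
proof -
  note i = tile_inserts[OF t]
  have hi: "base t = Z \<and> hi t = q \<longleftrightarrow> Z = base t \<and> insert q Z = right_v t"
    and lo: "base t = Z \<and> lo t = q \<longleftrightarrow> Z = base t \<and> insert q Z = left_v t"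
    unfolding i(1,2) using q i(5,6) insert_eq_insert by metis+
  have tlo: "top_v t = insert q Z \<and> lo t = q \<longleftrightarrow> Z = right_v t \<and> insert q Z = top_v t"
    using q i(4,8) by (metis insert_eq_insert insert_ident)
  have thi: "top_v t = insert q Z \<and> hi t = q \<longleftrightarrow> Z = left_v t \<and> insert q Z = top_v t"
    using q i(3,7) by (metis insert_eq_insert insert_ident)
  show ?thesis
  proof (cases "t \<in> white_tiles")
    case True
    then have "t \<notin> black_tiles" using white_black_disjoint by auto
    then show ?thesis unfolding left_tile_def disc_right_def using True hi tlo by simp
  next
    case False
    then show ?thesis unfolding left_tile_def disc_right_def using t lo thi by simp
  qed
qed

lemma right_tile_iff:
  assumes q: "q \<notin> Z" and t: "t \<in> tiles"
  shows "right_tile Z q t \<longleftrightarrow> Z = base t \<and> insert q Z = disc_left t \<or> Z = disc_left t \<and> insert q Z = top_v t"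
proof -
  note i = tile_inserts[OF t]
  have hi: "base t = Z \<and> hi t = q \<longleftrightarrow> Z = base t \<and> insert q Z = right_v t"
    and lo: "base t = Z \<and> lo t = q \<longleftrightarrow> Z = base t \<and> insert q Z = left_v t"
    unfolding i(1,2) using q i(5,6) insert_eq_insert by metis+
  have tlo: "top_v t = insert q Z \<and> lo t = q \<longleftrightarrow> Z = right_v t \<and> insert q Z = top_v t"
    using q i(4,8) by (metis insert_eq_insert insert_ident)
  have thi: "top_v t = insert q Z \<and> hi t = q \<longleftrightarrow> Z = left_v t \<and> insert q Z = top_v t"
    using q i(3,7) by (metis insert_eq_insert insert_ident)
  show ?thesis
  proof (cases "t \<in> white_tiles")
    case True
    then have "t \<notin> black_tiles" using white_black_disjoint by auto
    then show ?thesis unfolding right_tile_def disc_left_def using True lo thi by simp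
  next
    case False
    then show ?thesis unfolding right_tile_def disc_left_def using t hi tlo by simp
  qed
qed

lemma disc_inserts:
  assumes t: "t \<in> tiles"
  obtains p r where "p \<notin> base t" "r \<notin> base t" "p \<noteq> r" "disc_left t = insert p (base t)" "disc_right t = insert r (base t)"
    "top_v t = insert r (disc_left t)" "top_v t = insert p (disc_right t)" "{p, r} = {lo t, hi t}"
proof -
  note i = tile_inserts[OF t]
  have ne: "lo t \<noteq> hi t" using tiles_labels(5)[OF t] by simp
  from disc_sides[OF t] show ?thesis
  proof
    assume "disc_left t = left_v t \<and> disc_right t = right_v t"
    then show ?thesis using that[of "lo t" "hi t"] i ne by simp
  next
    assume "disc_left t = right_v t \<and> disc_right t = left_v t"
    then show ?thesis using that[of "hi t" "lo t"] i ne by (simp add: insert_commute)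
  qed
qed

text \<open>With the interior always on the left, a tile edge is run through upwards in the tile on
  its left and downwards in the tile on its right; the remaining triangle edges are the two
  directions of a diagonal.\<close>

lemma triangle_cases:
  assumes "(u, v, w) \<in> triangles"
  obtains (up) q t where "v = insert q u" "q \<notin> u" "left_tile u q t" "w = disc_left t"
  | (down) q t where "u = insert q v" "q \<notin> v" "right_tile v q t" "w = disc_right t"
  | (leftwards) t where "t \<in> tiles" "u = disc_right t" "v = disc_left t" "w = base t"
  | (rightwards) t where "t \<in> tiles" "u = disc_left t" "v = disc_right t" "w = top_v t"
proof -
  obtain t where t: "t \<in> tiles" "(u, v, w) \<in> tile_triangles t" using assms unfolding triangles_def by blast
  obtain p r where pr: "p \<notin> base t" "r \<notin> base t" "p \<noteq> r" "disc_left t = insert p (base t)" "disc_right t = insert r (base t)"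
    "top_v t = insert r (disc_left t)" "top_v t = insert p (disc_right t)" using disc_inserts[OF t(1)] .
  have n: "r \<notin> disc_left t" "p \<notin> disc_right t" using pr by auto
  consider "u = base t" "v = disc_right t" "w = disc_left t" | "u = disc_right t" "v = disc_left t" "w = base t"
    | "u = disc_left t" "v = base t" "w = disc_right t" | "u = top_v t" "v = disc_left t" "w = disc_right t"
    | "u = disc_left t" "v = disc_right t" "w = top_v t" | "u = disc_right t" "v = top_v t" "w = disc_left t"
    using t(2) unfolding tile_triangles_def by auto
  then show ?thesis
  proof cases
    case 1 then show ?thesis using up[of r t] left_tile_iff[of r "base t" t] pr t by auto
  next
    case 2 then show ?thesis using leftwards t by blast
  next
    case 3 then show ?thesis using down[of p t] right_tile_iff[of p "base t" t] pr t by auto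
  next
    case 4 then show ?thesis using down[of r t] right_tile_iff[of r "disc_left t" t] pr n t by auto
  next
    case 5 then show ?thesis using rightwards t by blast
  next
    case 6 then show ?thesis using up[of p t] left_tile_iff[of p "disc_right t" t] pr n t by auto
  qed
qed

lemma triangles_up: "q \<notin> Z \<Longrightarrow> left_tile Z q t \<Longrightarrow> (Z, insert q Z, disc_left t) \<in> triangles"
proof -
  assume q: "q \<notin> Z" "left_tile Z q t"
  then have t: "t \<in> tiles" using side_cases by blast
  have "(Z, insert q Z, disc_left t) \<in> tile_triangles t"
    using left_tile_iff[OF q(1) t] q(2) unfolding tile_triangles_def by auto
  then show ?thesis unfolding triangles_def using t by blast
qed

lemma triangles_down: "q \<notin> Z \<Longrightarrow> right_tile Z q t \<Longrightarrow> (insert q Z, Z, disc_right t) \<in> triangles"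
proof -
  assume q: "q \<notin> Z" "right_tile Z q t"
  then have t: "t \<in> tiles" using side_cases by blast
  have "(insert q Z, Z, disc_right t) \<in> tile_triangles t"
    using right_tile_iff[OF q(1) t] q(2) unfolding tile_triangles_def by auto
  then show ?thesis unfolding triangles_def using t by blast
qed

text \<open>Tile edges join comparable sets and diagonals incomparable ones, so an edge of one sort
  is never mistaken for one of the other.\<close>

lemma disc_incomparable:
  assumes "t \<in> tiles" shows "\<not> disc_left t \<subseteq> disc_right t" "\<not> disc_right t \<subseteq> disc_left t"
proof -
  obtain p r where pr: "p \<notin> base t" "r \<notin> base t" "p \<noteq> r" "disc_left t = insert p (base t)" "disc_right t = insert r (base t)"
    using disc_inserts[OF assms] .
  then show "\<not> disc_left t \<subseteq> disc_right t" "\<not> disc_right t \<subseteq> disc_left t" by auto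
qed

text \<open>The intersection and the union of the two middle vertices are the bottom and the
  top.\<close>

lemma tile_of_diagonal:
  assumes s: "s \<in> tiles" and t: "t \<in> tiles" and e: "{disc_left s, disc_right s} = {disc_left t, disc_right t}"
  shows "s = t"
proof -
  have b: "base u = disc_left u \<inter> disc_right u" "top_v u = disc_left u \<union> disc_right u" "top_v u - base u = {lo u, hi u}"
    if u: "u \<in> tiles" for u
  proof -
    obtain p r where pr: "p \<notin> base u" "r \<notin> base u" "p \<noteq> r" "disc_left u = insert p (base u)" "disc_right u = insert r (base u)"
      "top_v u = insert r (disc_left u)" "{p, r} = {lo u, hi u}" using disc_inserts[OF u] by metis
    then show "base u = disc_left u \<inter> disc_right u" "top_v u = disc_left u \<union> disc_right u" by auto
    show "top_v u - base u = {lo u, hi u}" unfolding pr(7)[symmetric] pr(6,4) using pr(1,2) by auto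
  qed
  have "disc_left s = disc_left t \<and> disc_right s = disc_right t \<or> disc_left s = disc_right t \<and> disc_right s = disc_left t"
    using e unfolding doubleton_eq_iff by blast
  then have be: "base s = base t" "top_v s = top_v t"
    unfolding b(1)[OF s] b(1)[OF t] b(2)[OF s] b(2)[OF t] by auto
  then have "{lo s, hi s} = {lo t, hi t}" using b(3)[OF s] b(3)[OF t] by simp
  then have "lo s = lo t \<and> hi s = hi t"
    using tiles_labels(5)[OF s] tiles_labels(5)[OF t] unfolding doubleton_eq_iff by auto
  then show ?thesis using be tile_eqI by blast
qed

lemma apex_up:
  assumes "(Z, insert q Z, w) \<in> triangles" "q \<notin> Z"
  shows "\<exists>t. left_tile Z q t \<and> w = disc_left t"
  using assms(1)
proof (cases rule: triangle_cases)
  case (up q' t)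
  then have "q' = q" using assms(2) insert_eq_insert by metis
  then show ?thesis using up by blast
next
  case (down q' t)
  then show ?thesis using assms(2) by blast
next
  case (leftwards t)
  then show ?thesis using disc_incomparable(2)[OF leftwards(1)] by blast
next
  case (rightwards t)
  then show ?thesis using disc_incomparable(1)[OF rightwards(1)] by blast
qed

lemma apex_down:
  assumes "(insert q Z, Z, w) \<in> triangles" "q \<notin> Z"
  shows "\<exists>t. right_tile Z q t \<and> w = disc_right t"
  using assms(1)
proof (cases rule: triangle_cases)
  case (down q' t)
  then have "q' = q" using assms(2) insert_eq_insert by metis
  then show ?thesis using down by blast
next
  case (up q' t)
  then show ?thesis using assms(2) by blast
next
  case (leftwards t)
  then show ?thesis using disc_incomparable(1)[OF leftwards(1)] by blast
next
  case (rightwards t)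
  then show ?thesis using disc_incomparable(2)[OF rightwards(1)] by blast
qed

lemma apex_unique:
  assumes 1: "(u, v, w) \<in> triangles" and 2: "(u, v, w') \<in> triangles" shows "w = w'"
  using 1
proof (cases rule: triangle_cases)
  case (up q t)
  obtain t' where "left_tile u q t'" "w' = disc_left t'" using apex_up[of u q w'] 2 up by blast
  then show ?thesis using left_tile_unique[OF up(2) up(3)] up(4) by blast
next
  case (down q t)
  obtain t' where "right_tile v q t'" "w' = disc_right t'" using apex_down[of q v w'] 2 down by blast
  then show ?thesis using right_tile_unique[OF down(2) down(3)] down(4) by blast
next
  case (leftwards t)
  note inc = disc_incomparable[OF leftwards(1)]
  from 2 show ?thesis
  proof (cases rule: triangle_cases)
    case (up q s) then show ?thesis using inc leftwards by blast
  next
    case (down q s) then show ?thesis using inc leftwards by blast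
  next
    case l: (leftwards s)
    then have "s = t" using tile_of_diagonal leftwards by metis
    then show ?thesis using l leftwards by simp
  next
    case l: (rightwards s)
    then have "s = t" using tile_of_diagonal[of s t] leftwards by auto
    then show ?thesis using l leftwards inc by auto
  qed
next
  case (rightwards t)
  note inc = disc_incomparable[OF rightwards(1)]
  from 2 show ?thesis
  proof (cases rule: triangle_cases)
    case (up q s) then show ?thesis using inc rightwards by blast
  next
    case (down q s) then show ?thesis using inc rightwards by blast
  next
    case l: (rightwards s)
    then have "s = t" using tile_of_diagonal rightwards by metis
    then show ?thesis using l rightwards by simp
  next
    case l: (leftwards s)
    then have "s = t" using tile_of_diagonal[of s t] rightwards by auto
    then show ?thesis using l rightwards inc by auto
  qed
qed

definition tri_edges :: "(nat set \<times> nat set) set" where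
  "tri_edges = {(u, v). \<exists>w. (u, v, w) \<in> triangles}"

definition tri_vertices :: "nat set set" where
  "tri_vertices = {u. \<exists>v w. (u, v, w) \<in> triangles}"

lemma tri_edges_up: "q \<notin> Z \<Longrightarrow> (Z, insert q Z) \<in> tri_edges \<longleftrightarrow> (\<exists>t. left_tile Z q t)"
  unfolding tri_edges_def using apex_up triangles_up by blast

lemma tri_edges_down: "q \<notin> Z \<Longrightarrow> (insert q Z, Z) \<in> tri_edges \<longleftrightarrow> (\<exists>t. right_tile Z q t)"
  unfolding tri_edges_def using apex_down triangles_down by blast

lemma tri_vertices_eq: "tri_vertices = (\<Union>t\<in>tiles. vertices t)"
proof -
  have "{u. \<exists>v w. (u, v, w) \<in> tile_triangles t} = vertices t" if "t \<in> tiles" for t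
  proof -
    have e: "{u. \<exists>v w. (u, v, w) \<in> tile_triangles t} = {base t, disc_left t, disc_right t, top_v t}"
      unfolding tile_triangles_def by auto
    show ?thesis unfolding e vertices_def bot_v_def using disc_sides[OF that]
      by (elim disjE conjE) (simp_all add: insert_commute)
  qed
  then show ?thesis unfolding tri_vertices_def triangles_def by blast
qed

lemma tri_vertices_subset: "z \<in> tri_vertices \<Longrightarrow> z \<subseteq> {1..n}"
proof -
  assume "z \<in> tri_vertices"
  then obtain t where t: "t \<in> tiles" "z \<in> vertices t" unfolding tri_vertices_eq by blast
  have "z \<subseteq> top_v t" using t(2) unfolding vertices_def bot_v_def left_v_def right_v_def top_v_def by auto
  moreover have "top_v t \<subseteq> {1..n}" using tiles_is_tile[OF t(1)] unfolding is_tile_def top_v_def by auto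
  ultimately show ?thesis by blast
qed

lemma side_label_range: "q \<notin> Z \<Longrightarrow> left_tile Z q t \<or> right_tile Z q t \<Longrightarrow> q \<in> {1..n}"
proof -
  assume q: "q \<notin> Z" "left_tile Z q t \<or> right_tile Z q t"
  then have "insert q Z \<in> tri_vertices" unfolding tri_vertices_eq using side_vertices[OF q] side_cases[OF q] by blast
  then show ?thesis using tri_vertices_subset by blast
qed

lemma boundary_tri_edges:
  assumes "(u, v) \<in> tri_edges" "(v, u) \<notin> tri_edges"
  obtains (right) q where "q \<in> {1..n}" "u = {Suc q..n}" "v = insert q {Suc q..n}"
  | (left) q where "q \<in> {1..n}" "v = {1..<q}" "u = insert q {1..<q}"
proof -
  obtain w where "(u, v, w) \<in> triangles" using assms(1) unfolding tri_edges_def by blast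
  then show ?thesis
  proof (cases rule: triangle_cases)
    case (up q t)
    then have "\<not> (\<exists>t. right_tile u q t)" using assms(2) tri_edges_down[OF up(2)] by simp
    then have "u = {Suc q..n}" using ex_right_tile[OF up(2)] up(3) by blast
    then show ?thesis using right side_label_range[OF up(2)] up by blast
  next
    case (down q t)
    then have "\<not> (\<exists>t. left_tile v q t)" using assms(2) tri_edges_up[OF down(2)] by simp
    then have "v = {1..<q}" using ex_left_tile[OF down(2)] down(3) by blast
    then show ?thesis using left side_label_range[OF down(2)] down by blast
  next
    case (leftwards t)
    have "(v, u, top_v t) \<in> triangles" unfolding triangles_def tile_triangles_def using leftwards by blast
    then show ?thesis using assms(2) unfolding tri_edges_def by blast
  next
    case (rightwards t)
    have "(v, u, base t) \<in> triangles" unfolding triangles_def tile_triangles_def using rightwards by blast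
    then show ?thesis using assms(2) unfolding tri_edges_def by blast
  qed
qed

lemma boundary_tri_edges_mem:
  assumes n: "n \<ge> 2" and q: "q \<in> {1..n}"
  shows "(insert q {1..<q}, {1..<q}) \<in> tri_edges" "({1..<q}, insert q {1..<q}) \<notin> tri_edges"
    "({Suc q..n}, insert q {Suc q..n}) \<in> tri_edges" "(insert q {Suc q..n}, {Suc q..n}) \<notin> tri_edges"
proof -
  have m: "q \<notin> {1..<q}" "q \<notin> {Suc q..n}" by auto
  note b = boundary_mem[OF q] and ne = left_boundary_ne_right_boundary[OF n q]
  show "(insert q {1..<q}, {1..<q}) \<in> tri_edges"
    unfolding tri_edges_down[OF m(1)] using ex_right_tile[OF m(1) _ ne] b by blast
  show "({1..<q}, insert q {1..<q}) \<notin> tri_edges"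
    unfolding tri_edges_up[OF m(1)] using no_left_tile_boundary[OF q] by blast
  show "({Suc q..n}, insert q {Suc q..n}) \<in> tri_edges"
    unfolding tri_edges_up[OF m(2)] using ex_left_tile[OF m(2) _ ne[symmetric]] b by blast
  show "(insert q {Suc q..n}, {Suc q..n}) \<notin> tri_edges"
    unfolding tri_edges_down[OF m(2)] using no_right_tile_boundary[OF q] by blast
qed

end

lemma ex_step:
  fixes f :: "nat \<Rightarrow> real"
  assumes "f 0 \<le> c" "c < f n" shows "\<exists>k<n. f k \<le> c \<and> c < f (Suc k)"
  using assms(2)
proof (induction n)
  case (Suc n)
  show ?case
  proof (cases "c < f n")
    case True
    then obtain k where "k < n" "f k \<le> c \<and> c < f (Suc k)" using Suc.IH by blast
    then show ?thesis using less_SucI by blast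
  next
    case False
    then show ?thesis using Suc.prems by (intro exI[of _ n]) simp
  qed
qed (use assms(1) in simp)

section \<open>The zonogon of the drawing and its boundary\<close>

context full_structure
begin

definition lin :: "(nat \<Rightarrow> real) \<Rightarrow> (nat \<Rightarrow> real) \<Rightarrow> real" where
  "lin g l = (\<Sum>i=1..n. l i * g i)"

definition unit_box :: "(nat \<Rightarrow> real) set" where
  "unit_box = {l. \<forall>i\<in>{1..n}. 0 \<le> l i \<and> l i \<le> 1}"

abbreviation "lx \<equiv> lin (\<lambda>i. 4^i * 4^i)"
abbreviation "ly \<equiv> lin (\<lambda>i. 4^i)"

definition disc_image :: "(real \<times> real) set" where
  "disc_image = (\<lambda>l. (lx l, ly l)) ` unit_box"

lemma pos_lin: "pos g z = lin g (\<lambda>i. real (digit z i) / 3)" "(\<lambda>i. real (digit z i) / 3) \<in> unit_box"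
proof -
  show "pos g z = lin g (\<lambda>i. real (digit z i) / 3)" unfolding pos_def lin_def by (simp add: sum_divide_distrib)
  show "(\<lambda>i. real (digit z i) / 3) \<in> unit_box" unfolding unit_box_def using digit_le[of z] by auto
qed

lemma pos_mem_lin:
  assumes "z \<in> D" shows "pos g z = lin g (\<lambda>i. if i \<in> z then 1 else 0)"
proof -
  have z: "z \<subseteq> {1..n}" using sub assms by blast
  have "lin g (\<lambda>i. if i \<in> z then 1 else 0) = (\<Sum>i=1..n. if i \<in> z then g i else 0)"
    unfolding lin_def by (rule sum.cong) auto
  also have "\<dots> = (\<Sum>i\<in>z. g i)" using z by (simp add: sum.inter_restrict[symmetric] Int_absorb1)
  finally show ?thesis using pos_mem[OF assms] by simp
qed

lemma pos_insert:
  assumes "Z \<in> D" "insert q Z \<in> D" "q \<notin> Z" shows "pos g (insert q Z) = pos g Z + g q"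
  using ws_collection_finite_member[OF ws assms(1)] assms(3) unfolding pos_mem[OF assms(1)] pos_mem[OF assms(2)] by simp

text \<open>After taking out positive factors, the expression is a sum of terms
  \<open>(l i - c) * (4^i - G)\<close>, where \<open>c\<close> indicates membership in
  \<open>u\<close>. Since \<open>u\<close> contains exactly the labels with
  \<open>4^i \<le> G\<close>, both factors of a term have the same sign.\<close>

lemma left_boundary_side:
  assumes q: "q \<in> {1..n}" and l: "l \<in> unit_box"
  defines "u \<equiv> insert q {1..<q}" and "v \<equiv> {1..<q}"
  shows "0 \<le> (px v - px u) * (ly l - py u) - (lx l - px u) * (py v - py u)"
proof -
  note b = boundary_mem[OF q]
  define G where "G = (4::real)^q"
  have G: "G > 0" unfolding G_def by simp
  have e: "px v - px u = - (G * G)" "py v - py u = - G"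
    unfolding u_def v_def G_def using pos_insert[OF b(1,2)] by auto
  have "lx l - px u - G * (ly l - py u) = (\<Sum>i=1..n. (l i - (if i \<in> u then 1 else 0)) * (4^i * 4^i) - G * ((l i - (if i \<in> u then 1 else 0)) * 4^i))"
    unfolding u_def pos_mem_lin[OF b(2)] lin_def sum_subtractf left_diff_distrib right_diff_distrib sum_distrib_left by simp
  also have "\<dots> \<ge> 0"
  proof (rule sum_nonneg)
    fix i assume i: "i \<in> {1..n}"
    have li: "0 \<le> l i" "l i \<le> 1" using l i unfolding unit_box_def by auto
    have r: "(l i - (if i \<in> u then 1 else 0)) * (4^i * 4^i) - G * ((l i - (if i \<in> u then 1 else 0)) * 4^i)
      = 4^i * ((l i - (if i \<in> u then 1 else 0)) * (4^i - G))" by (simp add: algebra_simps)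
    have "0 \<le> (l i - (if i \<in> u then 1 else 0)) * (4^i - G)"
    proof (cases "i \<le> q")
      case True
      then have "i \<in> u" "(4::real)^i \<le> G" unfolding u_def G_def using i by auto
      then show ?thesis using li by (simp add: mult_nonpos_nonpos)
    next
      case False
      then have "i \<notin> u" "G \<le> (4::real)^i" unfolding u_def G_def by auto
      then show ?thesis using li by simp
    qed
    then show "0 \<le> (l i - (if i \<in> u then 1 else 0)) * (4^i * 4^i) - G * ((l i - (if i \<in> u then 1 else 0)) * 4^i)"
      unfolding r by simp
  qed
  finally have nn: "0 \<le> lx l - px u - G * (ly l - py u)" .
  have "(px v - px u) * (ly l - py u) - (lx l - px u) * (py v - py u) = G * (lx l - px u - G * (ly l - py u))"
    unfolding e by (simp add: algebra_simps)
  then show ?thesis using nn G by simp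
qed

lemma right_boundary_side:
  assumes q: "q \<in> {1..n}" and l: "l \<in> unit_box"
  defines "u \<equiv> {Suc q..n}" and "v \<equiv> insert q {Suc q..n}"
  shows "0 \<le> (px v - px u) * (ly l - py u) - (lx l - px u) * (py v - py u)"
proof -
  note b = boundary_mem[OF q]
  define G where "G = (4::real)^q"
  have G: "G > 0" unfolding G_def by simp
  have e: "px v - px u = G * G" "py v - py u = G"
    unfolding u_def v_def G_def using pos_insert[OF b(3,4)] by auto
  have "G * (ly l - py u) - (lx l - px u) = (\<Sum>i=1..n. G * ((l i - (if i \<in> u then 1 else 0)) * 4^i) - (l i - (if i \<in> u then 1 else 0)) * (4^i * 4^i))"
    unfolding u_def pos_mem_lin[OF b(3)] lin_def sum_subtractf left_diff_distrib right_diff_distrib sum_distrib_left by simp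
  also have "\<dots> \<ge> 0"
  proof (rule sum_nonneg)
    fix i assume i: "i \<in> {1..n}"
    have li: "0 \<le> l i" "l i \<le> 1" using l i unfolding unit_box_def by auto
    have r: "G * ((l i - (if i \<in> u then 1 else 0)) * 4^i) - (l i - (if i \<in> u then 1 else 0)) * (4^i * 4^i)
      = 4^i * ((l i - (if i \<in> u then 1 else 0)) * (G - 4^i))" by (simp add: algebra_simps)
    have "0 \<le> (l i - (if i \<in> u then 1 else 0)) * (G - 4^i)"
    proof (cases "i \<le> q")
      case True
      then have "i \<notin> u" "(4::real)^i \<le> G" unfolding u_def G_def using i by auto
      then show ?thesis using li by simp
    next
      case False
      then have "i \<in> u" "G \<le> (4::real)^i" unfolding u_def G_def using i by auto
      then show ?thesis using li by (simp add: mult_nonpos_nonpos)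
    qed
    then show "0 \<le> G * ((l i - (if i \<in> u then 1 else 0)) * 4^i) - (l i - (if i \<in> u then 1 else 0)) * (4^i * 4^i)"
      unfolding r by simp
  qed
  finally have nn: "0 \<le> G * (ly l - py u) - (lx l - px u)" .
  have "(px v - px u) * (ly l - py u) - (lx l - px u) * (py v - py u) = G * (G * (ly l - py u) - (lx l - px u))"
    unfolding e by (simp add: algebra_simps)
  then show ?thesis using nn G by simp
qed

definition crosses_down :: "real \<Rightarrow> nat set \<times> nat set \<Rightarrow> bool" where
  "crosses_down c = (\<lambda>(u, v). py v \<le> c \<and> c < py u)"

definition crosses_up :: "real \<Rightarrow> nat set \<times> nat set \<Rightarrow> bool" where
  "crosses_up c = (\<lambda>(u, v). py u \<le> c \<and> c < py v)"

definition left_edge :: "real \<Rightarrow> nat set \<times> nat set" where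
  "left_edge c = (THE e. e \<in> tri_edges \<and> prod.swap e \<notin> tri_edges \<and> crosses_down c e)"

definition right_edge :: "real \<Rightarrow> nat set \<times> nat set" where
  "right_edge c = (THE e. e \<in> tri_edges \<and> prod.swap e \<notin> tri_edges \<and> crosses_up c e)"

abbreviation "height \<equiv> py {1..n}"

lemma py_initial: "k \<le> n \<Longrightarrow> py {1..k} = (\<Sum>i=1..k. 4^i)"
  using pos_mem[OF max_ws_collection_boundary(1)[OF max]] by blast

lemma py_final: "k \<le> n \<Longrightarrow> py {Suc k..n} = (\<Sum>i=Suc k..n. 4^i)"
  using pos_mem[OF max_ws_collection_boundary(2)[OF max]] by blast

text \<open>The left boundary passes the heights \<open>f 0\<close>, ..., \<open>f n\<close> in
  increasing order, so \<open>c\<close> lies in exactly one of the half-open steps. Right boundary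
  edges are directed upwards and do not compete.\<close>

lemma ex1_left_edge:
  assumes n: "n \<ge> 2" and c: "0 \<le> c" "c < height"
  shows "\<exists>!e. e \<in> tri_edges \<and> prod.swap e \<notin> tri_edges \<and> crosses_down c e"
proof -
  define f where "f k = (\<Sum>i=1..k. (4::real)^i)" for k
  have mono: "f k \<le> f k'" if "k \<le> k'" for k k' unfolding f_def by (rule sum_mono2) (use that in auto)
  have fq: "py {1..<q} = f (q - 1)" "py (insert q {1..<q}) = f q" if "q \<in> {1..n}" for q
  proof -
    have e: "{1..<q} = {1..q - 1}" "insert q {1..<q} = {1..q}" using that by auto
    have "q - 1 \<le> n" "q \<le> n" using that by auto
    then show "py {1..<q} = f (q - 1)" "py (insert q {1..<q}) = f q"
      unfolding e(2) unfolding e(1) f_def by (simp_all only: py_initial)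
  qed
  have "f 0 \<le> c" "c < f n" using c py_initial[of n] unfolding f_def by auto
  then obtain k where k: "k < n" "f k \<le> c" "c < f (Suc k)" using ex_step by blast
  have q: "Suc k \<in> {1..n}" using k by simp
  show ?thesis
  proof (rule ex1I[of _ "(insert (Suc k) {1..<Suc k}, {1..<Suc k})"])
    show "(insert (Suc k) {1..<Suc k}, {1..<Suc k}) \<in> tri_edges \<and>
      prod.swap (insert (Suc k) {1..<Suc k}, {1..<Suc k}) \<notin> tri_edges \<and> crosses_down c (insert (Suc k) {1..<Suc k}, {1..<Suc k})"
      using boundary_tri_edges_mem(1,2)[OF n q] fq[OF q] k unfolding crosses_down_def by simp
    fix e assume e: "e \<in> tri_edges \<and> prod.swap e \<notin> tri_edges \<and> crosses_down c e"
    obtain u v where uv: "e = (u, v)" by (cases e) auto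
    have uv': "(u, v) \<in> tri_edges" "(v, u) \<notin> tri_edges" using e uv by auto
    then show "e = (insert (Suc k) {1..<Suc k}, {1..<Suc k})"
    proof (cases rule: boundary_tri_edges)
      case (right q)
      have "py v = py u + 4^q" unfolding right using pos_insert[OF boundary_mem(3,4)[OF right(1)]] by simp
      then have "py u < py v" by simp
      then show ?thesis using e uv unfolding crosses_down_def by simp
    next
      case (left q)
      have r: "f (q - 1) \<le> c" "c < f q" using e uv left fq[OF left(1)] unfolding crosses_down_def by auto
      have "q = Suc k"
      proof (rule ccontr)
        assume "q \<noteq> Suc k"
        then consider "q \<le> k" | "Suc k \<le> q - 1" by linarith
        then show False using r k mono[of q k] mono[of "Suc k" "q - 1"] by cases auto
      qed
      then show ?thesis using uv left by simp
    qed
  qed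
qed

lemma ex1_right_edge:
  assumes n: "n \<ge> 2" and c: "0 \<le> c" "c < height"
  shows "\<exists>!e. e \<in> tri_edges \<and> prod.swap e \<notin> tri_edges \<and> crosses_up c e"
proof -
  \<comment> \<open>\<open>f k\<close> is the height after \<open>k\<close> steps from the bottom
    along the right boundary, where the largest labels are added before the smaller ones.\<close>
  define f where "f k = (\<Sum>i=Suc (n - k)..n. (4::real)^i)" for k
  define h where "h q = (\<Sum>i=Suc q..n. (4::real)^i)" for q
  have mono: "h k' \<le> h k" if "k \<le> k'" for k k' unfolding h_def by (rule sum_mono2) (use that in auto)
  have fq: "py {Suc q..n} = h q" "py (insert q {Suc q..n}) = h (q - 1)" if "q \<in> {1..n}" for q
  proof -
    have e: "insert q {Suc q..n} = {Suc (q - 1)..n}" using that by auto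
    have "q - 1 \<le> n" "q \<le> n" using that by auto
    then show "py {Suc q..n} = h q" "py (insert q {Suc q..n}) = h (q - 1)" unfolding e h_def by (simp_all only: py_final)
  qed
  have "f 0 \<le> c" "c < f n" using c py_initial[of n] unfolding f_def by auto
  then obtain k where k: "k < n" "f k \<le> c" "c < f (Suc k)" using ex_step by blast
  define p where "p = n - k"
  have q: "p \<in> {1..n}" using k unfolding p_def by simp
  have p: "h p \<le> c" "c < h (p - 1)" using k unfolding f_def h_def p_def by (auto simp: Suc_diff_Suc)
  show ?thesis
  proof (rule ex1I[of _ "({Suc p..n}, insert p {Suc p..n})"])
    show "({Suc p..n}, insert p {Suc p..n}) \<in> tri_edges \<and>
      prod.swap ({Suc p..n}, insert p {Suc p..n}) \<notin> tri_edges \<and> crosses_up c ({Suc p..n}, insert p {Suc p..n})"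
      using boundary_tri_edges_mem(3,4)[OF n q] fq[OF q] p unfolding crosses_up_def by simp
    fix e assume e: "e \<in> tri_edges \<and> prod.swap e \<notin> tri_edges \<and> crosses_up c e"
    obtain u v where uv: "e = (u, v)" by (cases e) auto
    have uv': "(u, v) \<in> tri_edges" "(v, u) \<notin> tri_edges" using e uv by auto
    then show "e = ({Suc p..n}, insert p {Suc p..n})"
    proof (cases rule: boundary_tri_edges)
      case (left q)
      have "py u = py v + 4^q" unfolding left using pos_insert[OF boundary_mem(1,2)[OF left(1)]] by simp
      then have "py v < py u" by simp
      then show ?thesis using e uv unfolding crosses_up_def by simp
    next
      case (right q)
      have r: "h q \<le> c" "c < h (q - 1)" using e uv right fq[OF right(1)] unfolding crosses_up_def by auto
      have "q = p"
      proof (rule ccontr)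
        assume "q \<noteq> p"
        then consider "q \<le> p - 1" | "p \<le> q - 1" using q right(1) by force
        then show False using r p mono[of q "p - 1"] mono[of p "q - 1"] by cases auto
      qed
      then show ?thesis using uv right by simp
    qed
  qed
qed

lemma planar_triangles:
  assumes n: "n \<ge> 2"
  shows "planar_triangulation triangles px py 0 height left_edge right_edge"
proof (unfold_locales, unfold tri_vertices_def[symmetric] tri_edges_def[symmetric] turn_def[symmetric]
    crosses_down_def[symmetric] crosses_up_def[symmetric])
  show "finite triangles" by (rule finite_triangles)
  show "(v, w, u) \<in> triangles" if "(u, v, w) \<in> triangles" for u v w using triangles_rotate[OF that] .
  show "0 < turn u v w" if "(u, v, w) \<in> triangles" for u v w using triangles_ccw[OF that] .
  show "w = w'" if "(u, v, w) \<in> triangles" "(u, v, w') \<in> triangles" for u v w w' using apex_unique[OF that] .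
  show "inj_on py tri_vertices" by (rule inj_on_subset[OF py_inj]) (use tri_vertices_subset in blast)
  show "0 \<le> py z \<and> py z \<le> height" if "z \<in> tri_vertices" for z
  proof -
    have b: "0 \<le> real (digit z i) / 3 \<and> real (digit z i) / 3 \<le> 1" for i using digit_le[of z i] by auto
    have "py z \<le> (\<Sum>i=1..n. 1 * 4^i)" unfolding pos_lin(1) lin_def by (intro sum_mono mult_right_mono) (use b in auto)
    moreover have "0 \<le> py z" unfolding pos_def by (simp add: sum_nonneg)
    ultimately show ?thesis using py_initial[of n] by simp
  qed
  show "left_edge c \<in> tri_edges \<and> prod.swap (left_edge c) \<notin> tri_edges \<and> crosses_down c (left_edge c)"
    if "0 \<le> c" "c < height" for c
    unfolding left_edge_def by (rule theI'[OF ex1_left_edge[OF n that]])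
  show "e = left_edge c" if "0 \<le> c" "c < height" "e \<in> tri_edges" "prod.swap e \<notin> tri_edges" "crosses_down c e" for c e
    unfolding left_edge_def by (rule the1_equality[OF ex1_left_edge[OF n that(1,2)], symmetric]) (use that in blast)
  show "right_edge c \<in> tri_edges \<and> prod.swap (right_edge c) \<notin> tri_edges \<and> crosses_up c (right_edge c)"
    if "0 \<le> c" "c < height" for c
    unfolding right_edge_def by (rule theI'[OF ex1_right_edge[OF n that]])
  show "e = right_edge c" if "0 \<le> c" "c < height" "e \<in> tri_edges" "prod.swap e \<notin> tri_edges" "crosses_up c e" for c e
    unfolding right_edge_def by (rule the1_equality[OF ex1_right_edge[OF n that(1,2)], symmetric]) (use that in blast)
  show "0 \<le> turn u v z" if "(u, v) \<in> tri_edges" "(v, u) \<notin> tri_edges" "z \<in> tri_vertices" for u v z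
    using that(1,2)
  proof (cases rule: boundary_tri_edges)
    case (right q)
    show ?thesis unfolding turn_def pos_lin(1)[of _ z] right using right_boundary_side[OF right(1) pos_lin(2)] .
  next
    case (left q)
    show ?thesis unfolding turn_def pos_lin(1)[of _ z] left using left_boundary_side[OF left(1) pos_lin(2)] .
  qed
qed

lemma convex_disc_image: "convex disc_image"
proof (rule convexI)
  fix z z' and u v :: real
  assume z: "z \<in> disc_image" "z' \<in> disc_image" and uv: "0 \<le> u" "0 \<le> v" "u + v = 1"
  obtain l where l: "z = (lx l, ly l)" "l \<in> unit_box" using z(1) unfolding disc_image_def by blast
  obtain l' where l': "z' = (lx l', ly l')" "l' \<in> unit_box" using z(2) unfolding disc_image_def by blast
  have s: "u * lin g l + v * lin g l' = lin g (\<lambda>i. u * l i + v * l' i)" for g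
    unfolding lin_def by (simp add: sum_distrib_left sum.distrib algebra_simps)
  have "u *\<^sub>R z + v *\<^sub>R z' = (lx (\<lambda>i. u * l i + v * l' i), ly (\<lambda>i. u * l i + v * l' i))"
    unfolding l l' using s by simp
  moreover have "(\<lambda>i. u * l i + v * l' i) \<in> unit_box"
    unfolding unit_box_def
  proof (intro CollectI ballI)
    fix i assume "i \<in> {1..n}"
    then show "0 \<le> u * l i + v * l' i \<and> u * l i + v * l' i \<le> 1"
      using l(2) l'(2) uv convex_bound_le[of "l i" 1 "l' i" u v] unfolding unit_box_def by auto
  qed
  ultimately show "u *\<^sub>R z + v *\<^sub>R z' \<in> disc_image" unfolding disc_image_def by blast
qed

lemma interior_disc_image: "n \<ge> 2 \<Longrightarrow> interior disc_image \<noteq> {}"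
proof
  assume n: "n \<ge> 2" and e: "interior disc_image = {}"
  obtain a b where ab: "a \<noteq> 0" "disc_image \<subseteq> {x. a \<bullet> x = b}"
    by (rule empty_interior_subset_hyperplane[OF convex_disc_image e])
  have single: "lin g (\<lambda>i. if i = k then 1 else 0) = g k" if "k \<in> {1..n}" for g k
  proof -
    have "lin g (\<lambda>i. if i = k then 1 else 0) = (\<Sum>i=1..n. if i = k then g i else 0)"
      unfolding lin_def by (rule sum.cong) auto
    then show ?thesis using that by simp
  qed
  have m0: "(0, 0) \<in> disc_image"
    unfolding disc_image_def unit_box_def by (rule image_eqI[of _ _ "\<lambda>_. 0"]) (auto simp: lin_def)
  have mk: "(4^k * 4^k, 4^k) \<in> disc_image" if "k \<in> {1..n}" for k
    unfolding disc_image_def unit_box_def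
    by (rule image_eqI[of _ _ "\<lambda>i. if i = k then 1 else 0"]) (use single[OF that] in auto)
  have b0: "b = 0" using ab(2) m0 by (auto simp: inner_prod_def)
  \<comment> \<open>Two generators and the origin are not collinear, so no line contains the
    image.\<close>
  have "(16, 4) \<in> disc_image" "(256, 16) \<in> disc_image" using mk[of 1] mk[of 2] n by auto
  then have "fst a * 16 + snd a * 4 = 0" "fst a * 256 + snd a * 16 = 0"
    using ab(2) b0 by (auto simp: inner_prod_def)
  then have "fst a = 0" "snd a = 0" by auto
  then show False using ab(1) by (simp add: prod_eq_iff)
qed

end

section \<open>Weights recovered from points of the cube\<close>

context full_structure
begin

text \<open>The corners of a square satisfy bottom plus top equals left plus right, so weights on
  all four are not unique. Requiring that the bottom or the top has weight \<open>0\<close>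
  normalizes them and says that the point lies in one of the two half-tiles.\<close>

definition tile_lift :: "tile \<Rightarrow> (nat set \<Rightarrow> real) \<Rightarrow> bool" where
  "tile_lift t f \<longleftrightarrow> t \<in> tiles \<and> (\<forall>z. 0 \<le> f z) \<and> (\<forall>z. z \<notin> vertices t \<longrightarrow> f z = 0) \<and>
     f (base t) + f (left_v t) + f (right_v t) + f (top_v t) = 1 \<and> (f (base t) = 0 \<or> f (top_v t) = 0)"

lemma vertices_distinct:
  assumes "t \<in> tiles"
  shows "distinct [base t, left_v t, right_v t, top_v t]"
proof -
  note i = tile_inserts[OF assms]
  have ne: "lo t \<noteq> hi t" using tiles_labels(5)[OF assms] by simp
  have "base t \<noteq> left_v t" "base t \<noteq> right_v t" "left_v t \<noteq> top_v t" "right_v t \<noteq> top_v t"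
    using i by (metis insertI1)+
  moreover have "base t \<noteq> top_v t" "left_v t \<noteq> right_v t" using i ne by (metis insertI1 insertI2, metis insertE insertI1)
  ultimately show ?thesis by simp
qed

lemma sum_vertices:
  fixes f :: "nat set \<Rightarrow> real"
  assumes "t \<in> tiles"
  shows "(\<Sum>z\<in>vertices t. f z) = f (base t) + f (left_v t) + f (right_v t) + f (top_v t)"
  unfolding vertices_def bot_v_def using vertices_distinct[OF assms] by (simp add: add.assoc)

definition point :: "(nat set \<Rightarrow> real) \<Rightarrow> nat \<Rightarrow> real" where
  "point f k = (\<Sum>z\<in>tri_vertices. f z * indicator z k)"

lemma finite_tri_vertices: "finite tri_vertices"
  unfolding tri_vertices_eq vertices_def using finite_tiles by simp

lemma point_tile:
  assumes "tile_lift t f"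
  shows "point f k = f (base t) * indicator (base t) k + f (left_v t) * indicator (left_v t) k
    + f (right_v t) * indicator (right_v t) k + f (top_v t) * indicator (top_v t) k"
proof -
  have t: "t \<in> tiles" using assms unfolding tile_lift_def by blast
  have "point f k = (\<Sum>z\<in>vertices t. f z * indicator z k)" unfolding point_def
    by (rule sum.mono_neutral_right[OF finite_tri_vertices])
      (use t assms in \<open>auto simp: tri_vertices_eq tile_lift_def\<close>)
  then show ?thesis using sum_vertices[OF t] by simp
qed

lemma indicator_tile:
  assumes "t \<in> tiles"
  shows "indicator (base t) k + indicator (top_v t) k = (indicator (left_v t) k + indicator (right_v t) k :: real)"
proof -
  note i = tile_inserts[OF assms]
  have ne: "lo t \<noteq> hi t" using tiles_labels(5)[OF assms] by simp
  have e: "top_v t = insert (hi t) (insert (lo t) (base t))" using i(1,3) by simp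
  show ?thesis unfolding e i(1,2) using i(5,6) ne
    by (cases "k = lo t"; cases "k = hi t"; cases "k \<in> base t") (auto simp: indicator_def)
qed

text \<open>The positive and the negative part of \<open>x - z\<close> are summed separately. In two
  coordinates the larger of the two sums is a hexagonal norm, and its unit ball is the union of the
  six triangles at a vertex when squares are cut along horizontal diagonals; hence
  \<open>1 - max\<close> is the hat function of \<open>z\<close>.\<close>

definition excess :: "(nat \<Rightarrow> real) \<Rightarrow> nat set \<Rightarrow> real" where
  "excess x z = (\<Sum>k=1..n. max 0 (x k - indicator z k))"

definition deficit :: "(nat \<Rightarrow> real) \<Rightarrow> nat set \<Rightarrow> real" where
  "deficit x z = (\<Sum>k=1..n. max 0 (indicator z k - x k))"

text \<open>The weights of a lift can be read off from its point in the cube, without knowing the tile.\<close>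
lemma lift_weight:
  assumes tl: "tile_lift t f" and z: "z \<in> tri_vertices"
  shows "f z = max 0 (1 - max (excess (point f) z) (deficit (point f) z))"
proof -
  have t: "t \<in> tiles" using tl unfolding tile_lift_def by blast
  note i = tile_inserts[OF t]
  define B l r Y where v: "B = base t" "l = left_v t" "r = right_v t" "Y = top_v t"
  define p q where pq: "p = lo t" "q = hi t"
  have ne: "p \<noteq> q" unfolding pq using tiles_labels(5)[OF t] by simp
  have s: "l = insert p B" "r = insert q B" "Y = insert q (insert p B)" "p \<notin> B" "q \<notin> B"
    unfolding v pq using i by simp_all
  have nn: "0 \<le> f z" for z using tl unfolding tile_lift_def by blast
  have one: "f B + f l + f r + f Y = 1" "f B = 0 \<or> f Y = 0" using tl unfolding tile_lift_def v by auto
  define x where "x = point f"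
  have xk: "x k = f B * indicator B k + f l * indicator l k + f r * indicator r k + f Y * indicator Y k" for k
    unfolding x_def v using point_tile[OF tl] .
  define a b where ab: "a = f l + f Y" "b = f r + f Y"
  have xp: "x p = a" "x q = b" unfolding xk ab s using s(4,5) ne by auto
  have x1: "x k = 1" if "k \<in> B" for k
  proof -
    have "k \<in> l" "k \<in> r" "k \<in> Y" using that s by auto
    then show ?thesis unfolding xk using that one by simp
  qed
  have x0: "x k = 0" if "k \<notin> Y" for k unfolding xk using that s by (auto simp: indicator_def)
  have bounds: "0 \<le> a" "a \<le> 1" "0 \<le> b" "b \<le> 1" unfolding ab using nn[of B] nn[of l] nn[of r] nn[of Y] one(1) by auto
  have zn: "z \<subseteq> {1..n}" using tri_vertices_subset[OF z] .
  have "Y \<in> tri_vertices" unfolding tri_vertices_eq v vertices_def using t by blast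
  then have Yn: "Y \<subseteq> {1..n}" by (rule tri_vertices_subset)
  have pqn: "p \<in> {1..n}" "q \<in> {1..n}" "B \<subseteq> {1..n}" using Yn s by auto
  have vt: "vertices t = {B, l, r, Y}" unfolding vertices_def bot_v_def v ..
  have big: "f z = max 0 (1 - max (excess x z) (deficit x z))"
    if "z \<notin> vertices t" "1 \<le> excess x z \<or> 1 \<le> deficit x z"
  proof -
    have "f z = 0" using that(1) tl unfolding tile_lift_def by blast
    then show ?thesis using that(2) by auto
  qed
  show ?thesis
  \<comment> \<open>On \<open>B\<close> the point has coordinates \<open>1\<close>, outside
    \<open>Y\<close> coordinates \<open>0\<close>. If \<open>z\<close> does not lie between
    \<open>B\<close> and \<open>Y\<close>, one coordinate differs by \<open>1\<close> and the
    formula gives \<open>0\<close>, as it should.\<close>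
  proof (cases "B \<subseteq> z")
    case False
    then obtain k where k: "k \<in> B" "k \<notin> z" by blast
    then have kn: "k \<in> {1..n}" using pqn by blast
    have "max 0 (x k - indicator z k) \<le> excess x z"
      unfolding excess_def by (rule member_le_sum[OF kn]) auto
    then have "1 \<le> excess x z" using x1[OF k(1)] k(2) by simp
    moreover have "z \<notin> vertices t" unfolding vt s using False by auto
    ultimately show ?thesis using big unfolding x_def by blast
  next
    case Bz: True
    show ?thesis
    proof (cases "z \<subseteq> Y")
      case False
      then obtain k where k: "k \<in> z" "k \<notin> Y" by blast
      then have kn: "k \<in> {1..n}" using zn by blast
      have "max 0 (indicator z k - x k) \<le> deficit x z"
        unfolding deficit_def by (rule member_le_sum[OF kn]) auto
      then have "1 \<le> deficit x z" using x0[OF k(2)] k(1) by simp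
      moreover have "z \<notin> vertices t" unfolding vt using False s by auto
      ultimately show ?thesis using big unfolding x_def by blast
    next
      case zY: True
      have same: "x k = indicator z k" if "k \<noteq> p" "k \<noteq> q" for k
      proof (cases "k \<in> B")
        case True then show ?thesis using x1 Bz by (simp add: subset_iff)
      next
        case False
        then have "k \<notin> Y" using that s by auto
        then show ?thesis using x0 zY by (auto simp: indicator_def)
      qed
      have two: "(\<Sum>k=1..n. g k) = g p + g q" if "\<And>k. k \<noteq> p \<Longrightarrow> k \<noteq> q \<Longrightarrow> g k = 0" for g :: "nat \<Rightarrow> real"
      proof -
        have "(\<Sum>k=1..n. g k) = (\<Sum>k\<in>{p, q}. g k)"
          by (rule sum.mono_neutral_right) (use pqn that in auto)
        then show ?thesis using ne by simp
      qed
      have ex: "excess x z = max 0 (a - indicator z p) + max 0 (b - indicator z q)"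
        unfolding excess_def using two[of "\<lambda>k. max 0 (x k - indicator z k)"] same xp by simp
      have de: "deficit x z = max 0 (indicator z p - a) + max 0 (indicator z q - b)"
        unfolding deficit_def using two[of "\<lambda>k. max 0 (indicator z k - x k)"] same xp by simp
      have "z = B \<or> z = l \<or> z = r \<or> z = Y" unfolding s using Bz zY s by blast
      then consider "z = B" "p \<notin> z" "q \<notin> z" | "z = l" "p \<in> z" "q \<notin> z" | "z = r" "p \<notin> z" "q \<in> z" | "z = Y" "p \<in> z" "q \<in> z"
        unfolding s using s(4,5) ne by blast
      then have "f z = max 0 (1 - max (excess x z) (deficit x z))"
      proof cases
        case 1
        have "excess x z = a + b" "deficit x z = 0" unfolding ex de using 1(2,3) bounds by auto
        then show ?thesis using 1(1) bounds one nn[of B] nn[of Y] unfolding ab by auto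
      next
        case 2
        have "excess x z = b" "deficit x z = 1 - a" unfolding ex de using 2(2,3) bounds by auto
        then show ?thesis using 2(1) bounds one nn[of B] nn[of l] nn[of r] nn[of Y] unfolding ab by auto
      next
        case 3
        have "excess x z = a" "deficit x z = 1 - b" unfolding ex de using 3(2,3) bounds by auto
        then show ?thesis using 3(1) bounds one nn[of B] nn[of l] nn[of r] nn[of Y] unfolding ab by auto
      next
        case 4
        have "excess x z = 0" "deficit x z = (1 - a) + (1 - b)" unfolding ex de using 4(2,3) bounds by auto
        then show ?thesis using 4(1) bounds one nn[of B] nn[of Y] unfolding ab by auto
      qed
      then show ?thesis unfolding x_def .
    qed
  qed
qed

lemma point_inj:
  assumes f: "tile_lift s f" and g: "tile_lift t g" and e: "point f = point g"
  shows "f = g"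
proof
  fix z
  show "f z = g z"
  proof (cases "z \<in> tri_vertices")
    case True
    then show ?thesis using lift_weight[OF f True] lift_weight[OF g True] e by simp
  next
    case False
    then have "f z = 0" "g z = 0" using f g unfolding tile_lift_def tri_vertices_eq by blast+
    then show ?thesis by simp
  qed
qed

lemma cube_square_points:
  assumes t: "t \<in> tiles"
  shows "cube_square t = point ` {f. tile_lift t f}"
proof (intro subset_antisym subsetI)
  have inj: "inj_on (indicator :: nat set \<Rightarrow> nat \<Rightarrow> real) A" for A
  proof (rule inj_onI)
    fix x y :: "nat set" assume e: "(indicator x :: nat \<Rightarrow> real) = indicator y"
    have "k \<in> x \<longleftrightarrow> k \<in> y" for k using fun_cong[OF e, of k] by (auto simp: indicator_def split: if_splits)
    then show "x = y" by blast
  qed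
  {
    fix x assume "x \<in> cube_square t"
    then obtain u where u: "x = (\<lambda>k. \<Sum>v\<in>indicator ` vertices t. u v * v k)" "\<forall>v\<in>indicator ` vertices t. 0 \<le> u v"
      "sum u (indicator ` vertices t) = 1"
      unfolding cube_square_def conv_fin_def by auto
    define c where "c z = u (indicator z)" for z :: "nat set"
    define B l r Y where v: "B = base t" "l = left_v t" "r = right_v t" "Y = top_v t"
    have vt: "vertices t = {B, l, r, Y}" unfolding vertices_def bot_v_def v ..
    have d: "distinct [B, l, r, Y]" unfolding v using vertices_distinct[OF t] .
    have nn: "0 \<le> c B" "0 \<le> c l" "0 \<le> c r" "0 \<le> c Y" using u(2) unfolding c_def vt by auto
    have one: "c B + c l + c r + c Y = 1"
      using u(3) sum_vertices[OF t, of c] unfolding sum.reindex[OF inj] v c_def by (simp add: comp_def)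
    have xk: "x k = c B * indicator B k + c l * indicator l k + c r * indicator r k + c Y * indicator Y k" for k
      using sum_vertices[OF t, of "\<lambda>z. c z * indicator z k"]
      unfolding u(1) sum.reindex[OF inj] v c_def by (simp add: comp_def)
    \<comment> \<open>Moving the amount \<open>m\<close> from both ends of the diagonal from bottom
      to top to both ends of the other diagonal does not change the point and makes the bottom or
      the top weight vanish.\<close>
    define m where "m = min (c B) (c Y)"
    define f where "f z = (if z = B then c B - m else if z = l then c l + m else if z = r then c r + m
      else if z = Y then c Y - m else 0)" for z
    have fv: "f B = c B - m" "f l = c l + m" "f r = c r + m" "f Y = c Y - m" unfolding f_def using d by auto
    have m: "0 \<le> m" "m \<le> c B" "m \<le> c Y" unfolding m_def using nn by auto
    have "tile_lift t f"
      unfolding tile_lift_def vt v[symmetric] fv using t one m nn by (auto simp: f_def m_def)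
    moreover have "x = point f"
    proof
      fix k
      have "indicator B k + indicator Y k = (indicator l k + indicator r k :: real)" unfolding v using indicator_tile[OF t] .
      then have "m * (indicator B k + indicator Y k) = m * (indicator l k + indicator r k :: real)" by simp
      then show "x k = point f k"
        unfolding xk point_tile[OF calculation] v[symmetric] fv by (simp add: algebra_simps)
    qed
    ultimately show "x \<in> point ` {f. tile_lift t f}" by blast
  next
    fix x assume "x \<in> point ` {f. tile_lift t f}"
    then obtain f where f: "tile_lift t f" "x = point f" by blast
    define u where "u v = f {k. v k = 1}" for v :: "nat \<Rightarrow> real"
    have ui: "u (indicator z) = f z" for z
    proof -
      have "{k. (indicator z k :: real) = 1} = z" by (auto simp: indicator_def)
      then show ?thesis unfolding u_def by simp
    qed
    have "x = (\<lambda>k. \<Sum>v\<in>indicator ` vertices t. u v * v k)"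
    proof
      fix k
      show "x k = (\<Sum>v\<in>indicator ` vertices t. u v * v k)"
        unfolding f(2) point_tile[OF f(1)] sum.reindex[OF inj] comp_def ui sum_vertices[OF t] ..
    qed
    moreover have "\<forall>v\<in>indicator ` vertices t. 0 \<le> u v" using f(1) unfolding tile_lift_def by (auto simp: ui)
    moreover have "sum u (indicator ` vertices t) = 1"
      unfolding sum.reindex[OF inj] comp_def ui sum_vertices[OF t] using f(1) unfolding tile_lift_def by blast
    ultimately show "x \<in> cube_square t" unfolding cube_square_def conv_fin_def by blast
  }
qed

context
  assumes n2: "n \<ge> 2"
begin

interpretation tri: planar_triangulation triangles px py 0 height left_edge right_edge
  tri_vertices tri_edges turn crosses_down crosses_up
  by (rule planar_triangles[OF n2])
    (intro eq_reflection ext; simp only: tri_vertices_def tri_edges_def turn_def crosses_down_def crosses_up_def)+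

lemma lifts_tile: "f \<in> tri.lifts \<longleftrightarrow> (\<exists>t. tile_lift t f)"
proof
  assume "f \<in> tri.lifts"
  then obtain u v w where f: "tri.inside u v w f" unfolding tri.lifts_def by blast
  then have "(u, v, w) \<in> triangles" unfolding tri.inside_def by blast
  then obtain t where t: "t \<in> tiles" "(u, v, w) \<in> tile_triangles t" unfolding triangles_def by blast
  have uvw: "{u, v, w} = {base t, left_v t, right_v t} \<or> {u, v, w} = {top_v t, left_v t, right_v t}"
  proof -
    have "{u, v, w} = {base t, disc_left t, disc_right t} \<or> {u, v, w} = {top_v t, disc_left t, disc_right t}"
      using t(2) unfolding tile_triangles_def insert_iff empty_iff prod.inject
      by (elim disjE conjE; simp add: insert_commute)
    moreover have "{x, disc_left t, disc_right t} = {x, left_v t, right_v t}" for x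
      using disc_sides[OF t(1)] by (elim disjE conjE; simp add: insert_commute)
    ultimately show ?thesis by simp
  qed
  have d: "distinct [base t, left_v t, right_v t, top_v t]" using vertices_distinct[OF t(1)] .
  have z: "f z = 0" if "z \<notin> {u, v, w}" for z using f that unfolding tri.inside_def by blast
  have nn: "0 \<le> f z" for z using f z[of z] unfolding tri.inside_def by (cases "z \<in> {u, v, w}") auto
  have "u \<noteq> v \<and> v \<noteq> w \<and> u \<noteq> w" using tri.distinct \<open>(u, v, w) \<in> triangles\<close> by blast
  then have sum1: "(\<Sum>z\<in>{u, v, w}. f z) = 1" using f unfolding tri.inside_def by (simp add: add.assoc)
  have "f (base t) + f (left_v t) + f (right_v t) + f (top_v t) = 1 \<and> (f (base t) = 0 \<or> f (top_v t) = 0)"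
    using uvw
  proof
    assume e: "{u, v, w} = {base t, left_v t, right_v t}"
    have "top_v t \<notin> {u, v, w}" unfolding e using d by (simp add: eq_commute[of "top_v t"])
    then have "f (top_v t) = 0" by (rule z)
    moreover have "f (base t) + f (left_v t) + f (right_v t) = 1" using sum1 d unfolding e by (simp add: add.assoc)
    ultimately show ?thesis by simp
  next
    assume e: "{u, v, w} = {top_v t, left_v t, right_v t}"
    have "base t \<notin> {u, v, w}" unfolding e using d by simp
    then have "f (base t) = 0" by (rule z)
    moreover have ne: "left_v t \<noteq> top_v t" "right_v t \<noteq> top_v t" "left_v t \<noteq> right_v t" using d by simp_all
    then have "f (top_v t) + f (left_v t) + f (right_v t) = 1"
      using sum1 ne(1,2)[symmetric] unfolding e by (simp add: add.assoc)
    ultimately show ?thesis by simp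
  qed
  moreover have "{u, v, w} \<subseteq> vertices t"
    using uvw
  proof
    assume e: "{u, v, w} = {base t, left_v t, right_v t}"
    show ?thesis unfolding e vertices_def bot_v_def by simp
  next
    assume e: "{u, v, w} = {top_v t, left_v t, right_v t}"
    show ?thesis unfolding e vertices_def bot_v_def by simp
  qed
  then have "f z = 0" if "z \<notin> vertices t" for z using z[of z] that by (meson subsetD)
  ultimately have "tile_lift t f" unfolding tile_lift_def using t nn by blast
  then show "\<exists>t. tile_lift t f" by blast
next
  assume "\<exists>t. tile_lift t f"
  then obtain t where tl: "tile_lift t f" by blast
  then have t: "t \<in> tiles" unfolding tile_lift_def by blast
  have z: "f z = 0" if "z \<noteq> base t" "z \<noteq> left_v t" "z \<noteq> right_v t" "z \<noteq> top_v t" for z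
    using tl that unfolding tile_lift_def vertices_def bot_v_def by auto
  have nn: "0 \<le> f z" for z using tl unfolding tile_lift_def by blast
  have one: "f (base t) + f (left_v t) + f (right_v t) + f (top_v t) = 1" "f (base t) = 0 \<or> f (top_v t) = 0"
    using tl unfolding tile_lift_def by auto
  note ds = disc_sides[OF t]
  from one(2) show "f \<in> tri.lifts"
  proof
    assume 0: "f (top_v t) = 0"
    have m: "(base t, disc_right t, disc_left t) \<in> triangles" unfolding triangles_def tile_triangles_def using t by blast
    have "f (base t) + f (disc_right t) + f (disc_left t) = 1" using one 0 ds by auto
    moreover have "f z = 0" if "z \<noteq> base t" "z \<noteq> disc_right t" "z \<noteq> disc_left t" for z
      using z[of z] 0 ds that by (cases "z = top_v t") auto
    ultimately have "tri.inside (base t) (disc_right t) (disc_left t) f" unfolding tri.inside_def using m nn by blast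
    then show ?thesis unfolding tri.lifts_def by blast
  next
    assume 0: "f (base t) = 0"
    have m: "(top_v t, disc_left t, disc_right t) \<in> triangles" unfolding triangles_def tile_triangles_def using t by blast
    have "f (top_v t) + f (disc_left t) + f (disc_right t) = 1" using one 0 ds by auto
    moreover have "f z = 0" if "z \<noteq> top_v t" "z \<noteq> disc_left t" "z \<noteq> disc_right t" for z
      using z[of z] 0 ds that by (cases "z = base t") auto
    ultimately have "tri.inside (top_v t) (disc_left t) (disc_right t) f" unfolding tri.inside_def using m nn by blast
    then show ?thesis unfolding tri.lifts_def by blast
  qed
qed

lemma lifts_image_subset: "f \<in> tri.lifts \<Longrightarrow> (tri.X f, tri.Y f) \<in> disc_image"
proof -
  assume "f \<in> tri.lifts"
  then obtain u v w where f: "tri.inside u v w f" unfolding tri.lifts_def by blast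
  define l where "l i = f u * (real (digit u i) / 3) + f v * (real (digit v i) / 3) + f w * (real (digit w i) / 3)" for i
  have s: "lin g l = f u * pos g u + f v * pos g v + f w * pos g w" for g
    unfolding pos_lin(1) lin_def l_def by (simp add: sum.distrib sum_distrib_left algebra_simps)
  have nn: "0 \<le> f u" "0 \<le> f v" "0 \<le> f w" "f u + f v + f w = 1" using f unfolding tri.inside_def by auto
  have "0 \<le> l i \<and> l i \<le> 1" for i
  proof -
    have b: "0 \<le> real (digit z i) / 3 \<and> real (digit z i) / 3 \<le> 1" for z using digit_le[of z i] by auto
    have "f z * (real (digit z i) / 3) \<le> f z" if "0 \<le> f z" for z using b[of z] that by (meson mult_left_le)
    then have "l i \<le> f u + f v + f w" unfolding l_def using nn(1-3) by (intro add_mono) auto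
    moreover have "0 \<le> l i" unfolding l_def using nn b by simp
    ultimately show ?thesis using nn(4) by simp
  qed
  then have "l \<in> unit_box" unfolding unit_box_def by blast
  moreover have "(tri.X f, tri.Y f) = (lx l, ly l)" unfolding tri.inside_XY[OF f] s ..
  ultimately show ?thesis unfolding disc_image_def by blast
qed

text \<open>Below the top height the point lies between the two boundary crossings, because it is on
  the inner side of both edges. The top height is not covered by the half-open range of lines; there
  all coefficients are \<open>1\<close>, and the point is the vertex \<open>{1..n}\<close>.\<close>

lemma disc_image_covered:
  assumes l: "l \<in> unit_box"
  shows "\<exists>f\<in>tri.lifts. tri.X f = lx l \<and> tri.Y f = ly l"
proof -
  have b: "0 \<le> l i" "l i \<le> 1" if "i \<in> {1..n}" for i using l that unfolding unit_box_def by auto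
  have h: "height = (\<Sum>i=1..n. 1 * 4^i)" using py_initial[of n] by simp
  have c0: "0 \<le> ly l" unfolding lin_def by (intro sum_nonneg mult_nonneg_nonneg) (use b in auto)
  have c1: "ly l \<le> height" unfolding h lin_def by (intro sum_mono mult_right_mono) (use b in auto)
  show ?thesis
  proof (cases "ly l < height")
    case True
    note c = c0 True
    let ?c = "ly l"
    have "tri.cut ?c (left_edge ?c) \<le> lx l"
    proof -
      obtain u v where uv: "left_edge ?c = (u, v)" by (cases "left_edge ?c") auto
      have e: "(u, v) \<in> tri_edges" "(v, u) \<notin> tri_edges" "py v \<le> ?c" "?c < py u" using tri.lft[OF c] unfolding uv crosses_down_def by auto
      from e(1,2) show ?thesis
      proof (cases rule: boundary_tri_edges)
        case (right q)
        have "py v = py u + 4^q" unfolding right using pos_insert[OF boundary_mem(3,4)[OF right(1)]] by simp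
        then have "py u < py v" by simp
        then show ?thesis using e by simp
      next
        case (left q)
        have "0 \<le> (px v - px u) * (ly l - py u) - (lx l - px u) * (py v - py u)"
          unfolding left using left_boundary_side[OF left(1) l] .
        then have "(lx l - px u) * (py v - py u) \<le> (ly l - py u) * (px v - px u)" by (simp add: mult.commute)
        moreover have "py v - py u < 0" using e by simp
        ultimately have "(ly l - py u) * (px v - px u) / (py v - py u) \<le> lx l - px u" by (simp add: neg_divide_le_eq)
        then show ?thesis unfolding uv tri.cut_def by simp
      qed
    qed
    moreover have "lx l \<le> tri.cut ?c (right_edge ?c)"
    proof -
      obtain u v where uv: "right_edge ?c = (u, v)" by (cases "right_edge ?c") auto
      have e: "(u, v) \<in> tri_edges" "(v, u) \<notin> tri_edges" "py u \<le> ?c" "?c < py v" using tri.rgt[OF c] unfolding uv crosses_up_def by auto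
      from e(1,2) show ?thesis
      proof (cases rule: boundary_tri_edges)
        case (left q)
        have "py u = py v + 4^q" unfolding left using pos_insert[OF boundary_mem(1,2)[OF left(1)]] by simp
        then have "py v < py u" by simp
        then show ?thesis using e by simp
      next
        case (right q)
        have "0 \<le> (px v - px u) * (ly l - py u) - (lx l - px u) * (py v - py u)"
          unfolding right using right_boundary_side[OF right(1) l] .
        then have "(lx l - px u) * (py v - py u) \<le> (ly l - py u) * (px v - px u)" by (simp add: mult.commute)
        moreover have "py v - py u > 0" using e by simp
        ultimately have "lx l - px u \<le> (ly l - py u) * (px v - px u) / (py v - py u)" by (simp add: pos_le_divide_eq)
        then show ?thesis unfolding uv tri.cut_def by simp
      qed
    qed
    ultimately show ?thesis using tri.slab_exists[OF c] by blast
  next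
    case False
    then have "ly l = height" using c1 by simp
    then have "(\<Sum>i=1..n. (1 - l i) * 4^i) = 0" unfolding h lin_def by (simp add: sum_subtractf left_diff_distrib)
    then have z0: "\<forall>i\<in>{1..n}. (1 - l i) * 4^i = 0"
      by (subst (asm) sum_nonneg_eq_0_iff) (use b in auto)
    have l1: "l i = 1" if "i \<in> {1..n}" for i using z0 that by simp
    have m: "{1..n} \<in> D" using max_ws_collection_boundary(1)[OF max order_refl] .
    have e: "lin g l = pos g {1..n}" for g
      unfolding pos_mem_lin[OF m] lin_def by (rule sum.cong) (use l1 in auto)
    have "{1..n} \<in> tri_vertices" unfolding tri_vertices_eq using mem_covered[OF n2 m] by blast
    then obtain v w where t: "({1..n}, v, w) \<in> triangles" unfolding tri_vertices_def by blast
    define f where "f z = (if z = {1..n} then 1 else 0 :: real)" for z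
    have d: "{1..n} \<noteq> v" "{1..n} \<noteq> w" using tri.distinct[OF t] by auto
    have i: "tri.inside {1..n} v w f" unfolding tri.inside_def f_def using t d by auto
    have "tri.X f = lx l" "tri.Y f = ly l" unfolding tri.inside_XY[OF i] e using d by (auto simp: f_def)
    then show ?thesis using i unfolding tri.lifts_def by blast
  qed
qed

lemma T4: "tiling_T4 tiles"
proof -
  have P: "(\<lambda>f. (tri.X f, tri.Y f)) ` tri.lifts = disc_image"
  proof (intro subset_antisym subsetI)
    fix p assume "p \<in> (\<lambda>f. (tri.X f, tri.Y f)) ` tri.lifts"
    then show "p \<in> disc_image" using lifts_image_subset by auto
  next
    fix p assume "p \<in> disc_image"
    then obtain l where "l \<in> unit_box" "p = (lx l, ly l)" unfolding disc_image_def by blast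
    then show "p \<in> (\<lambda>f. (tri.X f, tri.Y f)) ` tri.lifts" using disc_image_covered[of l] by force
  qed
  have inj: "f = g" if "f \<in> tri.lifts" "g \<in> tri.lifts"
    "(\<lambda>k. \<Sum>z\<in>tri_vertices. f z * indicator z k) = (\<lambda>k. \<Sum>z\<in>tri_vertices. g z * indicator z k)" for f g
  proof -
    have "point f = point g" using that(3) unfolding point_def[abs_def] .
    then show ?thesis using point_inj that(1,2) unfolding lifts_tile by blast
  qed
  have "((\<lambda>f k. \<Sum>z\<in>tri_vertices. f z * indicator z k) ` tri.lifts) homeomorphic cball (0 :: real \<times> real) 1"
    by (rule tri.lifts_homeomorphic_disc[OF inj P convex_disc_image interior_disc_image[OF n2]])
  moreover have "(\<lambda>f k. \<Sum>z\<in>tri_vertices. f z * indicator z k) ` tri.lifts = (\<Union>t\<in>tiles. cube_square t)"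
  proof -
    have "(\<lambda>f k. \<Sum>z\<in>tri_vertices. f z * indicator z k) = point" unfolding point_def[abs_def] ..
    moreover have "tri.lifts = (\<Union>t\<in>tiles. {f. tile_lift t f})" using lifts_tile tile_lift_def by blast
    moreover have "point ` (\<Union>t\<in>tiles. {f. tile_lift t f}) = (\<Union>t\<in>tiles. cube_square t)"
      unfolding image_UN by (intro SUP_cong refl) (rule cube_square_points[symmetric])
    ultimately show ?thesis by metis
  qed
  ultimately show ?thesis unfolding tiling_T4_def by simp
qed

end

lemma g_tiling_tiles:
  assumes "n \<ge> 2" "generic_slopes n a"
  shows "g_tiling n a white_tiles black_tiles"
  unfolding g_tiling_def
  using finite_tiles white_black_disjoint tiles_is_tile T1[OF assms] T2[OF assms(2)] T3 T4[OF assms(1)] by blast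

end

theorem theorem9p3:
  fixes n :: nat and a :: "nat \<Rightarrow> real" and C :: "nat set set"
  assumes "n \<ge> 2"
    and "generic_slopes n a"
    and "max_ws_collection n C"
  shows "\<exists>W B. g_tiling n a W B \<and> C = spectrum W B"
proof -
  interpret full_structure n C using full_structure[OF assms(3)] .
  show ?thesis using g_tiling_tiles[OF assms(1,2)] spectrum_eq[OF assms(1)] by blast
qed

end
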